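(* Let $S=k_{\mathbf p}[x_1,\dots,x_n]$ be a noncommutative PI skew polynomial ring over a field $k$ of characteristic $0$, with center $Z$, with $p_{ij}=\xi^{b_{ij}}$ for a primitive $\ell$th root of unity $\xi$ ($\ell$ minimal), and let $O$ be the group generated by the conjugation automorphisms $\phi_1,\dots,\phi_n$ (full setting in the context). The following are equivalent. (1) $Z$ is regular. (2) $Z=k[x_1^{w_1},\dots,x_n^{w_n}]$ for some $w_i\ge1$. (3) $Z=k[x_1^{\mathfrak f_1},\dots,x_n^{\mathfrak f_n}]$. (4) $S$ is a free module over $Z$. (5) $O$ is a reflection group. (6) $|O|=\dfrac{\ell^n}{\prod_{s=1}^n\gcd\{b_{1s},b_{2s},\dots,b_{ns},\ell\}}$. (7) $|O|=\prod_{i=1}^n\mathfrak f_i$. (8) $O\cong\prod_{s=1}^n\langle\phi_s\rangle$. (9) $x_i^{\mathfrak f_i}\in Z$ for all $i$. Moreover, when $Z$ is regular, the ozone Jacobian $\mathfrak{oj}_S$ is equal to the Jacobian $\mathfrak j_{S,O}$ and the ozone arrangement $\mathfrak{oa}_S$ is equal to the reflection arrangement $\mathfrak a_{S,O}$ (equalities up to nonzero scalars).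
   Context: Setting: $k$ is a field with $\operatorname{char}k=0$. $\mathbf p=(p_{ij})\in M_n(k)$ is multiplicatively antisymmetric ($p_{ii}=1$, $p_{ji}=p_{ij}^{-1}$) with all $p_{ij}$ roots of unity. $S=k_{\mathbf p}[x_1,\dots,x_n]$ is the $k$-algebra generated by $x_1,\dots,x_n$ with relations $x_jx_i=p_{ij}x_ix_j$, graded by $\deg x_i=1$; $Z$ is its center. $\xi$ is a primitive $\ell$th root of unity and $p_{ij}=\xi^{b_{ij}}$ with integers $b_{ij}$, $b_{ii}=0$, $b_{ji}=-b_{ij}$; $\ell$ is minimal and $\ell>1$ (equivalently $S$ is noncommutative), hence $\gcd(\{b_{ij}\}_{i,j},\ell)=1$. $\phi_i(f)=x_i^{-1}fx_i$, so $\phi_i(x_s)=p_{is}x_s$, and $O=\langle\phi_1,\dots,\phi_n\rangle$, a finite group of graded automorphisms; $Z=S^O$. "$Z$ is regular" means that $Z$ is a polynomial ring (equivalently has finite global dimension). $\mathfrak f_i=\gcd\{d_i\mid \exists\, d_1,\dots,\widehat{d_i},\dots,d_n\text{ with }x_1^{d_1}\cdots x_i^{d_i}\cdots x_n^{d_n}\in Z\}$ (exponents nonnegative integers). $\mathfrak{oj}_S=\prod_{i=1}^n x_i^{\mathfrak f_i-1}$ and $\mathfrak{oa}_S=\prod_{\mathfrak f_i>1}x_i$. Reflections: a graded automorphism $\sigma\ne\mathrm{Id}$ of $S$ of finite order is a reflection if $\sum_{j\ge0}\operatorname{tr}(\sigma|_{S_j})t^j=\frac1{(1-t)^{n-1}q(t)}$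 with $q(1)\ne0$. A finite group of graded automorphisms is a reflection group if it is generated by reflections. For a diagonal automorphism $\sigma$ of $S$, $\sigma(x_i)=a_ix_i$ with $a_i\in k^\times$, the homological determinant is $\operatorname{hdet}(\sigma)=\prod_{i=1}^n a_i$ (every element of $O$ is diagonal). Let $S_{\operatorname{hdet}^{-1}}=\{x\in S\mid\sigma(x)=\operatorname{hdet}(\sigma)^{-1}x\ \forall\sigma\in O\}$ and $S_{\operatorname{hdet}}=\{x\in S\mid\sigma(x)=\operatorname{hdet}(\sigma)x\ \forall\sigma\in O\}$. If $S_{\operatorname{hdet}^{-1}}$ (resp. $S_{\operatorname{hdet}}$) is a free $S^O$-module of rank one on both sides generated by an element, that generator (determined up to a nonzero scalar) is the Jacobian $\mathfrak j_{S,O}$ (resp. the reflection arrangement $\mathfrak a_{S,O}$). *)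

theory Defs
  imports
    "HOL-Algebra.Algebra"
    "HOL-Algebra.Algebraic_Closure_Type"
    "HOL-Library.Poly_Mapping"
    "HOL-Computational_Algebra.Polynomial_FPS"
begin

text \<open>
  All algebras below are rings in the sense of HOL-Algebra, with scalars from a type of class
  \<^class>\<open>field\<close>. Generators are indexed by \<open>{1..n}\<close>; families such as \<open>p\<close>, \<open>b\<close> and exponent vectors
  are functions on \<^typ>\<open>nat\<close> whose values outside \<open>{1..n}\<close> play no role.
\<close>

section \<open>Generalities\<close>

definition primitive_root_of_unity :: "nat \<Rightarrow> 'k::field \<Rightarrow> bool" where
  "primitive_root_of_unity l z \<longleftrightarrow> 0 < l \<and> z ^ l = 1 \<and> (\<forall>m. 0 < m \<and> m < l \<longrightarrow> z ^ m \<noteq> 1)"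

text \<open>The coefficient family of a linear combination is required to vanish off \<open>B\<close>, so that
  uniqueness of the coefficients is meaningful for total functions.\<close>

definition module_basis :: "('r, 'c) ring_scheme \<Rightarrow> ('r, 'm, 'd) module_scheme \<Rightarrow> 'm set \<Rightarrow> bool" where
  "module_basis R M B \<longleftrightarrow> B \<subseteq> carrier M \<and>
     (\<forall>m \<in> carrier M. \<exists>!c. range c \<subseteq> carrier R \<and> finite {x. c x \<noteq> \<zero>\<^bsub>R\<^esub>} \<and> {x. c x \<noteq> \<zero>\<^bsub>R\<^esub>} \<subseteq> B \<and>
        m = (\<Oplus>\<^bsub>M\<^esub> x \<in> {x. c x \<noteq> \<zero>\<^bsub>R\<^esub>}. c x \<odot>\<^bsub>M\<^esub> x))"

definition free_module :: "('r, 'c) ring_scheme \<Rightarrow> ('r, 'm, 'd) module_scheme \<Rightarrow> bool" where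
  "free_module R M \<longleftrightarrow> Module.module R M \<and> (\<exists>B. module_basis R M B)"

definition free_rank_one_gen :: "('r, 'c) ring_scheme \<Rightarrow> ('r, 'm, 'd) module_scheme \<Rightarrow> 'm \<Rightarrow> bool" where
  "free_rank_one_gen R M g \<longleftrightarrow> Module.module R M \<and> module_basis R M {g}"

text \<open>The trace of an endomorphism of a finite-dimensional vector space: the sum of the diagonal
  entries of its matrix \<open>c\<close> with respect to a finite basis \<open>B\<close>.\<close>

definition lin_trace :: "('k::field, 'm, 'd) module_scheme \<Rightarrow> ('m \<Rightarrow> 'm) \<Rightarrow> 'k" where
  "lin_trace V f = (THE t. \<exists>B c. finite B \<and> module_basis (ring_of_type_algebra :: 'k ring) V B \<and>
      (\<forall>x \<in> B. f x = (\<Oplus>\<^bsub>V\<^esub> y \<in> B. c y x \<odot>\<^bsub>V\<^esub> y)) \<and> t = (\<Sum>x \<in> B. c x x))"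

definition left_module :: "('s, 'c) ring_scheme \<Rightarrow> 's set \<Rightarrow> ('s, 's) module" where
  "left_module S M = \<lparr>carrier = M, monoid.mult = monoid.mult S,
     monoid.one = \<one>\<^bsub>S\<^esub>, ring.zero = \<zero>\<^bsub>S\<^esub>, ring.add = ring.add S,
     module.smult = (\<lambda>z m. z \<otimes>\<^bsub>S\<^esub> m)\<rparr>"

definition right_module :: "('s, 'c) ring_scheme \<Rightarrow> 's set \<Rightarrow> ('s, 's) module" where
  "right_module S M = \<lparr>carrier = M, monoid.mult = monoid.mult S,
     monoid.one = \<one>\<^bsub>S\<^esub>, ring.zero = \<zero>\<^bsub>S\<^esub>, ring.add = ring.add S,
     module.smult = (\<lambda>z m. m \<otimes>\<^bsub>S\<^esub> z)\<rparr>"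

definition ring_center :: "('s, 'c) ring_scheme \<Rightarrow> 's set" where
  "ring_center S = {z \<in> carrier S. \<forall>s \<in> carrier S. z \<otimes>\<^bsub>S\<^esub> s = s \<otimes>\<^bsub>S\<^esub> z}"

text \<open>The commutative polynomial ring in \<open>m\<close> variables.\<close>

definition mpoly_ring :: "nat \<Rightarrow> ((nat \<Rightarrow>\<^sub>0 nat) \<Rightarrow>\<^sub>0 'k::field) ring" where
  "mpoly_ring m = ring_of_type_algebra
     \<lparr>carrier := {f. \<forall>a \<in> Poly_Mapping.keys f. Poly_Mapping.keys a \<subseteq> {1..m}}\<rparr>"

section \<open>Free algebras and skew polynomial rings\<close>

datatype 'i free_mon = FreeMon (letters: "'i list")

instantiation free_mon :: (type) monoid_add
begin

definition "0 = FreeMon []"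
definition "u + v = FreeMon (letters u @ letters v)"

instance
  by standard (simp_all add: zero_free_mon_def plus_free_mon_def)

end

text \<open>The free algebra is the monoid algebra of the free monoid; the convolution product on
  finitely supported functions is the multiplication of \<open>\<Rightarrow>\<^sub>0\<close>.\<close>

definition free_algebra :: "nat \<Rightarrow> (nat free_mon \<Rightarrow>\<^sub>0 'k::field) ring" where
  "free_algebra n = ring_of_type_algebra
     \<lparr>carrier := {f. \<forall>w \<in> Poly_Mapping.keys f. set (letters w) \<subseteq> {1..n}}\<rparr>"

definition free_gen :: "nat \<Rightarrow> (nat free_mon \<Rightarrow>\<^sub>0 'k::field)" where
  "free_gen i = Poly_Mapping.single (FreeMon [i]) 1"

definition skew_ideal :: "nat \<Rightarrow> (nat \<Rightarrow> nat \<Rightarrow> 'k::field) \<Rightarrow> (nat free_mon \<Rightarrow>\<^sub>0 'k) set" where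
  "skew_ideal n p = Idl\<^bsub>free_algebra n\<^esub>
     {free_gen j * free_gen i - Poly_Mapping.single 0 (p i j) * (free_gen i * free_gen j) | i j.
        i \<in> {1..n} \<and> j \<in> {1..n}}"

definition skew_poly :: "nat \<Rightarrow> (nat \<Rightarrow> nat \<Rightarrow> 'k::field) \<Rightarrow> (nat free_mon \<Rightarrow>\<^sub>0 'k) set ring" where
  "skew_poly n p = free_algebra n Quot skew_ideal n p"

definition skew_class ::
    "nat \<Rightarrow> (nat \<Rightarrow> nat \<Rightarrow> 'k::field) \<Rightarrow> (nat free_mon \<Rightarrow>\<^sub>0 'k) \<Rightarrow> (nat free_mon \<Rightarrow>\<^sub>0 'k) set" where
  "skew_class n p f = skew_ideal n p +>\<^bsub>free_algebra n\<^esub> f"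

definition skew_var :: "nat \<Rightarrow> (nat \<Rightarrow> nat \<Rightarrow> 'k::field) \<Rightarrow> nat \<Rightarrow> (nat free_mon \<Rightarrow>\<^sub>0 'k) set" where
  "skew_var n p i = skew_class n p (free_gen i)"

definition skew_const :: "nat \<Rightarrow> (nat \<Rightarrow> nat \<Rightarrow> 'k::field) \<Rightarrow> 'k \<Rightarrow> (nat free_mon \<Rightarrow>\<^sub>0 'k) set" where
  "skew_const n p c = skew_class n p (Poly_Mapping.single 0 c)"

definition skew_scale ::
    "nat \<Rightarrow> (nat \<Rightarrow> nat \<Rightarrow> 'k::field) \<Rightarrow> 'k \<Rightarrow> (nat free_mon \<Rightarrow>\<^sub>0 'k) set \<Rightarrow> (nat free_mon \<Rightarrow>\<^sub>0 'k) set" where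
  "skew_scale n p c s = skew_const n p c \<otimes>\<^bsub>skew_poly n p\<^esub> s"

definition skew_degree :: "nat \<Rightarrow> (nat \<Rightarrow> nat \<Rightarrow> 'k::field) \<Rightarrow> nat \<Rightarrow> (nat free_mon \<Rightarrow>\<^sub>0 'k) set set" where
  "skew_degree n p j = skew_class n p `
     {f \<in> carrier (free_algebra n). \<forall>w \<in> Poly_Mapping.keys f. length (letters w) = j}"

definition skew_degree_space ::
    "nat \<Rightarrow> (nat \<Rightarrow> nat \<Rightarrow> 'k::field) \<Rightarrow> nat \<Rightarrow> ('k, (nat free_mon \<Rightarrow>\<^sub>0 'k) set) module" where
  "skew_degree_space n p j = (let S = skew_poly n p in
     \<lparr>carrier = skew_degree n p j, monoid.mult = monoid.mult S,
     monoid.one = \<one>\<^bsub>S\<^esub>, ring.zero = \<zero>\<^bsub>S\<^esub>, ring.add = ring.add S,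
      module.smult = skew_scale n p\<rparr>)"

text \<open>The ordered monomial \<open>x\<^sub>1\<^bsup>d 1\<^esup> \<cdots> x\<^sub>n\<^bsup>d n\<^esup>\<close>.\<close>

definition skew_monom ::
    "nat \<Rightarrow> (nat \<Rightarrow> nat \<Rightarrow> 'k::field) \<Rightarrow> (nat \<Rightarrow> nat) \<Rightarrow> (nat free_mon \<Rightarrow>\<^sub>0 'k) set" where
  "skew_monom n p d = foldr (\<lambda>i s. (skew_var n p i [^]\<^bsub>skew_poly n p\<^esub> d i) \<otimes>\<^bsub>skew_poly n p\<^esub> s)
     [1..<Suc n] \<one>\<^bsub>skew_poly n p\<^esub>"

text \<open>The \<open>k\<close>-subalgebra \<open>k[H]\<close> generated by a subset \<open>H\<close>.\<close>

definition skew_subalgebra ::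
    "nat \<Rightarrow> (nat \<Rightarrow> nat \<Rightarrow> 'k::field) \<Rightarrow> (nat free_mon \<Rightarrow>\<^sub>0 'k) set set \<Rightarrow> (nat free_mon \<Rightarrow>\<^sub>0 'k) set set" where
  "skew_subalgebra n p H = generate_ring (skew_poly n p) (range (skew_const n p) \<union> H)"

section \<open>The center\<close>

definition skew_center :: "nat \<Rightarrow> (nat \<Rightarrow> nat \<Rightarrow> 'k::field) \<Rightarrow> (nat free_mon \<Rightarrow>\<^sub>0 'k) set set" where
  "skew_center n p = ring_center (skew_poly n p)"

definition skew_center_ring :: "nat \<Rightarrow> (nat \<Rightarrow> nat \<Rightarrow> 'k::field) \<Rightarrow> (nat free_mon \<Rightarrow>\<^sub>0 'k) set ring" where
  "skew_center_ring n p = (skew_poly n p)\<lparr>carrier := skew_center n p\<rparr>"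

text \<open>\<open>Z\<close> is isomorphic, as a \<open>k\<close>-algebra, to a polynomial ring in some number of variables.\<close>

definition center_regular :: "nat \<Rightarrow> (nat \<Rightarrow> nat \<Rightarrow> 'k::field) \<Rightarrow> bool" where
  "center_regular n p \<longleftrightarrow> (\<exists>m. \<exists>h \<in> ring_iso (mpoly_ring m) (skew_center_ring n p).
      \<forall>c. h (Poly_Mapping.single 0 c) = skew_const n p c)"

definition ozone_exp :: "nat \<Rightarrow> (nat \<Rightarrow> nat \<Rightarrow> 'k::field) \<Rightarrow> nat \<Rightarrow> nat" where
  "ozone_exp n p i = Gcd {d i | d. skew_monom n p d \<in> skew_center n p}"

definition ozone_jacobian :: "nat \<Rightarrow> (nat \<Rightarrow> nat \<Rightarrow> 'k::field) \<Rightarrow> (nat free_mon \<Rightarrow>\<^sub>0 'k) set" where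
  "ozone_jacobian n p = skew_monom n p (\<lambda>i. ozone_exp n p i - 1)"

definition ozone_arrangement :: "nat \<Rightarrow> (nat \<Rightarrow> nat \<Rightarrow> 'k::field) \<Rightarrow> (nat free_mon \<Rightarrow>\<^sub>0 'k) set" where
  "ozone_arrangement n p = skew_monom n p (\<lambda>i. if ozone_exp n p i > 1 then 1 else 0)"

section \<open>The ozone group\<close>

text \<open>\<open>x\<^sub>i\<close> is a normal regular element, and \<open>x\<^sub>i\<inverse> f x\<^sub>i\<close> is the element \<open>g\<close> of \<open>S\<close> with
  \<open>x\<^sub>i g = f x\<^sub>i\<close>.\<close>

definition ozone_conj :: "nat \<Rightarrow> (nat \<Rightarrow> nat \<Rightarrow> 'k::field) \<Rightarrow> nat \<Rightarrow>
    (nat free_mon \<Rightarrow>\<^sub>0 'k) set \<Rightarrow> (nat free_mon \<Rightarrow>\<^sub>0 'k) set" where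
  "ozone_conj n p i = (\<lambda>f \<in> carrier (skew_poly n p). THE g. g \<in> carrier (skew_poly n p) \<and>
      skew_var n p i \<otimes>\<^bsub>skew_poly n p\<^esub> g = f \<otimes>\<^bsub>skew_poly n p\<^esub> skew_var n p i)"

abbreviation skew_perms :: "nat \<Rightarrow> (nat \<Rightarrow> nat \<Rightarrow> 'k::field) \<Rightarrow>
    ((nat free_mon \<Rightarrow>\<^sub>0 'k) set \<Rightarrow> (nat free_mon \<Rightarrow>\<^sub>0 'k) set) monoid" where
  "skew_perms n p \<equiv> BijGroup (carrier (skew_poly n p))"

definition ozone_group :: "nat \<Rightarrow> (nat \<Rightarrow> nat \<Rightarrow> 'k::field) \<Rightarrow>
    ((nat free_mon \<Rightarrow>\<^sub>0 'k) set \<Rightarrow> (nat free_mon \<Rightarrow>\<^sub>0 'k) set) monoid" where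
  "ozone_group n p = (skew_perms n p)
     \<lparr>carrier := generate (skew_perms n p) (ozone_conj n p ` {1..n})\<rparr>"

definition ozone_cyclic :: "nat \<Rightarrow> (nat \<Rightarrow> nat \<Rightarrow> 'k::field) \<Rightarrow> nat \<Rightarrow>
    ((nat free_mon \<Rightarrow>\<^sub>0 'k) set \<Rightarrow> (nat free_mon \<Rightarrow>\<^sub>0 'k) set) monoid" where
  "ozone_cyclic n p s = (ozone_group n p)
     \<lparr>carrier := generate (ozone_group n p) {ozone_conj n p s}\<rparr>"

definition graded_automorphism :: "nat \<Rightarrow> (nat \<Rightarrow> nat \<Rightarrow> 'k::field) \<Rightarrow>
    ((nat free_mon \<Rightarrow>\<^sub>0 'k) set \<Rightarrow> (nat free_mon \<Rightarrow>\<^sub>0 'k) set) \<Rightarrow> bool" where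
  "graded_automorphism n p \<sigma> \<longleftrightarrow>
     \<sigma> \<in> Bij (carrier (skew_poly n p)) \<and> \<sigma> \<in> ring_hom (skew_poly n p) (skew_poly n p) \<and>
     (\<forall>c. \<sigma> (skew_const n p c) = skew_const n p c) \<and>
     (\<forall>j. \<sigma> ` skew_degree n p j = skew_degree n p j)"

text \<open>The trace series condition \<open>\<Sum>\<^sub>j tr(\<sigma>|S\<^sub>j) t\<^sup>j = 1 / ((1 - t)\<^bsup>n-1\<^esup> q(t))\<close> is stated with the
  denominator multiplied out in the power series ring; \<open>q\<close> is a polynomial over \<open>k\<close>.\<close>

definition skew_reflection :: "nat \<Rightarrow> (nat \<Rightarrow> nat \<Rightarrow> 'k::field) \<Rightarrow>
    ((nat free_mon \<Rightarrow>\<^sub>0 'k) set \<Rightarrow> (nat free_mon \<Rightarrow>\<^sub>0 'k) set) \<Rightarrow> bool" where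
  "skew_reflection n p \<sigma> \<longleftrightarrow> graded_automorphism n p \<sigma> \<and>
     \<sigma> \<noteq> \<one>\<^bsub>skew_perms n p\<^esub> \<and>
     (\<exists>m::nat. 0 < m \<and> \<sigma> [^]\<^bsub>skew_perms n p\<^esub> m = \<one>\<^bsub>skew_perms n p\<^esub>) \<and>
     (\<exists>q::'k poly. poly q 1 \<noteq> 0 \<and>
        Abs_fps (\<lambda>j. lin_trace (skew_degree_space n p j) \<sigma>) * fps_of_poly ([:1, -1:] ^ (n - 1) * q) = 1)"

definition reflection_group :: "nat \<Rightarrow> (nat \<Rightarrow> nat \<Rightarrow> 'k::field) \<Rightarrow>
    ((nat free_mon \<Rightarrow>\<^sub>0 'k) set \<Rightarrow> (nat free_mon \<Rightarrow>\<^sub>0 'k) set) monoid \<Rightarrow> bool" where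
  "reflection_group n p G \<longleftrightarrow> finite (carrier G) \<and> (\<forall>\<sigma> \<in> carrier G. graded_automorphism n p \<sigma>) \<and>
     (\<exists>R \<subseteq> carrier G. (\<forall>\<sigma> \<in> R. skew_reflection n p \<sigma>) \<and> generate G R = carrier G)"

section \<open>Jacobian and reflection arrangement\<close>

text \<open>Only meaningful for diagonal automorphisms.\<close>

definition hdet :: "nat \<Rightarrow> (nat \<Rightarrow> nat \<Rightarrow> 'k::field) \<Rightarrow>
    ((nat free_mon \<Rightarrow>\<^sub>0 'k) set \<Rightarrow> (nat free_mon \<Rightarrow>\<^sub>0 'k) set) \<Rightarrow> 'k" where
  "hdet n p \<sigma> = (THE h. \<exists>a. (\<forall>i \<in> {1..n}. a i \<noteq> 0 \<and>
      \<sigma> (skew_var n p i) = skew_scale n p (a i) (skew_var n p i)) \<and> h = (\<Prod>i = 1..n. a i))"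

definition ozone_fixed_ring :: "nat \<Rightarrow> (nat \<Rightarrow> nat \<Rightarrow> 'k::field) \<Rightarrow> (nat free_mon \<Rightarrow>\<^sub>0 'k) set ring" where
  "ozone_fixed_ring n p = (skew_poly n p)\<lparr>carrier :=
     {x \<in> carrier (skew_poly n p). \<forall>\<sigma> \<in> carrier (ozone_group n p). \<sigma> x = x}\<rparr>"

definition hdet_inv_semi_invariants ::
    "nat \<Rightarrow> (nat \<Rightarrow> nat \<Rightarrow> 'k::field) \<Rightarrow> (nat free_mon \<Rightarrow>\<^sub>0 'k) set set" where
  "hdet_inv_semi_invariants n p = {x \<in> carrier (skew_poly n p).
     \<forall>\<sigma> \<in> carrier (ozone_group n p). \<sigma> x = skew_scale n p (inverse (hdet n p \<sigma>)) x}"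

definition hdet_semi_invariants ::
    "nat \<Rightarrow> (nat \<Rightarrow> nat \<Rightarrow> 'k::field) \<Rightarrow> (nat free_mon \<Rightarrow>\<^sub>0 'k) set set" where
  "hdet_semi_invariants n p = {x \<in> carrier (skew_poly n p).
     \<forall>\<sigma> \<in> carrier (ozone_group n p). \<sigma> x = skew_scale n p (hdet n p \<sigma>) x}"

text \<open>The Jacobian and the reflection arrangement are determined only up to a nonzero scalar, so
  they are rendered as predicates on candidate generators.\<close>

definition is_jacobian :: "nat \<Rightarrow> (nat \<Rightarrow> nat \<Rightarrow> 'k::field) \<Rightarrow> (nat free_mon \<Rightarrow>\<^sub>0 'k) set \<Rightarrow> bool" where
  "is_jacobian n p g \<longleftrightarrow>
     free_rank_one_gen (ozone_fixed_ring n p) (left_module (skew_poly n p) (hdet_inv_semi_invariants n p)) g \<and>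
     free_rank_one_gen (ozone_fixed_ring n p) (right_module (skew_poly n p) (hdet_inv_semi_invariants n p)) g"

definition is_reflection_arrangement ::
    "nat \<Rightarrow> (nat \<Rightarrow> nat \<Rightarrow> 'k::field) \<Rightarrow> (nat free_mon \<Rightarrow>\<^sub>0 'k) set \<Rightarrow> bool" where
  "is_reflection_arrangement n p g \<longleftrightarrow>
     free_rank_one_gen (ozone_fixed_ring n p) (left_module (skew_poly n p) (hdet_semi_invariants n p)) g \<and>
     free_rank_one_gen (ozone_fixed_ring n p) (right_module (skew_poly n p) (hdet_semi_invariants n p)) g"

end

theory Submission
  imports Defs
begin

text \<open>Sorting words identifies \<open>S\<close> with the monoid algebra of \<open>\<nat>\<^sup>n\<close> twisted by a bimultiplicative cocycle.
  Monomials commute up to a bicharacter \<open>\<beta>\<close>, so \<open>Z\<close> is spanned by the \<open>x\<^sup>a\<close> with \<open>a\<close> in the kernel \<open>D\<close> of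
  \<open>\<beta>\<close>, and \<open>O\<close> consists of the characters \<open>\<beta>(b, -)\<close>. Let \<open>w\<^sub>i\<close> be the order of \<open>\<phi>\<^sub>i\<close>; each condition is
  equivalent to \<open>D\<close> being the product of the monoids \<open>w\<^sub>i \<nat>\<close>.

  Reduction modulo \<open>f\<^sub>i\<close> and modulo \<open>w\<^sub>i\<close> shows that \<open>|O|\<close> lies between the product of the \<open>f\<^sub>i\<close> and the product of
  the \<open>w\<^sub>i\<close>, with equality at either end only in the regular case. If \<open>Z\<close> is a polynomial ring in \<open>m\<close>
  variables, then \<open>m \<le> n\<close> by growth; the coefficient functionals at the indecomposable elements of \<open>D\<close>
  are derivations at the augmentation, so \<open>D\<close> has at most \<open>m\<close> indecomposables, and the \<open>n\<close> elements
  \<open>w\<^sub>i e\<^sub>i\<close> are already among them. If \<open>S\<close> is free over \<open>Z\<close>, coordinates of monomials satisfy the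
  relations of the monomials, which forces regularity. The trace series of a diagonal automorphism is
  the product of the \<open>1 / (1 - \<lambda>\<^sub>i t)\<close>, so reflections are the ones moving exactly one generator.\<close>

text \<open>Elements of \<open>S\<close> are cosets of an ideal, and several notions are definite
  descriptions (\<open>ozone_conj\<close>, \<open>hdet\<close>, \<open>lin_trace\<close>).
  Everything is therefore transported along the isomorphism \<open>nf\<close> to coefficient
  functions, where an identity becomes one equation per exponent. Exponents stay nonnegative
  throughout: the order of every p_ij divides \<open>l\<close>, so adding (l - 1) b takes the place
  of subtracting b. \<open>D\<close> consists of the nonnegative points of a subgroup of Z^n, hence
  it is closed under every subtraction that stays nonnegative; this makes division with remainder by
  w_i available. Two converse directions must do without homogeneity. An isomorphism from a
  polynomial ring may send the variables to elements of mixed degree with constant terms; growth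
  still bounds the number of variables, and point derivations ignore constant terms. A basis of
  \<open>S\<close> over \<open>Z\<close> may be infinite and inhomogeneous; hence only the
  coordinates of two monomials are compared, tied by a relation x_i^(w_i) x^u = c x^(d') x^v with a
  scalar c.\<close>

declare One_nat_def [simp del]

section \<open>Finitely supported functions\<close>

abbreviation lk :: "('a \<Rightarrow>\<^sub>0 'b::zero) \<Rightarrow> 'a \<Rightarrow> 'b" where "lk \<equiv> Poly_Mapping.lookup"
abbreviation ks :: "('a \<Rightarrow>\<^sub>0 'b::zero) \<Rightarrow> 'a set" where "ks \<equiv> Poly_Mapping.keys"
abbreviation sg :: "'a \<Rightarrow> 'b::zero \<Rightarrow> ('a \<Rightarrow>\<^sub>0 'b)" where "sg \<equiv> Poly_Mapping.single"

lemma pm_expand: "F = (\<Sum>a\<in>ks F. sg a (lk F a))"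
proof (rule poly_mapping_eqI)
  fix k
  show "lk F k = lk (\<Sum>a\<in>ks F. sg a (lk F a)) k"
    by (simp add: lookup_sum lookup_single when_def sum.delta in_keys_iff)
qed

text \<open>The support bound \<open>A\<close> is carried along because most maps below behave well
  only on coefficients supported in \<open>E\<close> or in the central exponents; partial sums of
  the expansion into single terms keep within \<open>A\<close>.\<close>

lemma pm_induct [consumes 1, case_names zero single add]:
  assumes "ks F \<subseteq> A" "P 0" "\<And>a x. a \<in> A \<Longrightarrow> P (sg a x)"
    and add: "\<And>F G. ks F \<subseteq> A \<Longrightarrow> ks G \<subseteq> A \<Longrightarrow> P F \<Longrightarrow> P G \<Longrightarrow> P (F + G)"
  shows "P (F::'a \<Rightarrow>\<^sub>0 'b::comm_monoid_add)"
proof -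
  have *: "ks (\<Sum>a\<in>B. sg a (lk F a)) \<subseteq> A \<and> P (\<Sum>a\<in>B. sg a (lk F a))" if "finite B" "B \<subseteq> A" for B
    using that
  proof (induction B)
    case (insert a B)
    have k: "ks (sg a (lk F a)) \<subseteq> A" using insert by auto
    have "ks (sg a (lk F a) + (\<Sum>a\<in>B. sg a (lk F a))) \<subseteq> A"
      by (rule order_trans[OF Poly_Mapping.keys_add]) (use k insert in auto)
    then show ?case using insert add[OF k] assms(3) by auto
  qed (use assms in auto)
  show ?thesis
    using *[of "ks F"] assms(1) pm_expand[of F] by simp
qed

text \<open>The additive map determined by its values on single terms. The twisted product, the
  normal form, its section and the embedding of a polynomial ring all arise this way.\<close>

definition lext :: "('a \<Rightarrow> 'b \<Rightarrow> 'c) \<Rightarrow> ('a \<Rightarrow>\<^sub>0 'b::comm_monoid_add) \<Rightarrow> 'c::comm_monoid_add" where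
  "lext g F = (\<Sum>a\<in>ks F. g a (lk F a))"

lemma lext_superset:
  assumes "\<And>a. g a 0 = 0" "finite A" "ks F \<subseteq> A"
  shows "lext g F = (\<Sum>a\<in>A. g a (lk F a))"
  unfolding lext_def
  by (rule sum.mono_neutral_left) (use assms in \<open>auto simp: in_keys_iff\<close>)

lemma lext_zero [simp]: "lext g 0 = 0"
  by (simp add: lext_def)

lemma lext_single: "g a 0 = 0 \<Longrightarrow> lext g (sg a x) = g a x"
  by (cases "x = 0") (simp_all add: lext_def)

lemma lext_add:
  assumes "\<And>a. g a 0 = 0" "\<And>a x y. g a (x + y) = g a x + g a y"
  shows "lext g (F + G) = lext g F + lext g G"
proof -
  let ?A = "ks F \<union> ks G"
  have "lext g (F + G) = (\<Sum>a\<in>?A. g a (lk (F + G) a))"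
    by (rule lext_superset) (use assms Poly_Mapping.keys_add[of F G] in auto)
  moreover have "lext g F = (\<Sum>a\<in>?A. g a (lk F a))"
    by (rule lext_superset) (use assms in auto)
  moreover have "lext g G = (\<Sum>a\<in>?A. g a (lk G a))"
    by (rule lext_superset) (use assms in auto)
  ultimately show ?thesis by (simp add: lookup_add assms sum.distrib)
qed

lemma ks_lext: "ks (lext g F) \<subseteq> (\<Union>a\<in>ks F. ks (g a (lk F a)))"
  unfolding lext_def by (rule keys_sum)

section \<open>The twisted monoid algebra\<close>

abbreviation ev :: "nat \<Rightarrow> (nat \<Rightarrow>\<^sub>0 nat)" where "ev i \<equiv> sg i (1::nat)"

definition expo :: "nat \<Rightarrow> (nat \<Rightarrow>\<^sub>0 nat) set" where
  "expo n = {a. ks a \<subseteq> {1..n}}"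

lemma expo_0 [simp]: "0 \<in> expo n" by (simp add: expo_def)
lemma expo_add_iff: "a + b \<in> expo n \<longleftrightarrow> a \<in> expo n \<and> b \<in> expo n"
  by (auto simp: expo_def in_keys_iff lookup_add subset_iff)
lemma expo_add [intro]: "a \<in> expo n \<Longrightarrow> b \<in> expo n \<Longrightarrow> a + b \<in> expo n"
  by (simp add: expo_add_iff)
lemma expo_single [intro]: "i \<in> {1..n} \<Longrightarrow> sg i k \<in> expo n" by (simp add: expo_def)

text \<open>Induction on the total degree: an exponent of positive degree has a positive entry, from
  which a unit vector splits off. Multiplicative statements thereby reduce to the
  generators.\<close>

lemma expo_induct [consumes 1, case_names zero add]:
  assumes "a \<in> expo n" "P 0" "\<And>a i. a \<in> expo n \<Longrightarrow> i \<in> {1..n} \<Longrightarrow> P a \<Longrightarrow> P (ev i + a)"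
  shows "P a"
proof -
  have "ks a \<subseteq> {1..n}" using assms(1) by (simp add: expo_def)
  then show ?thesis
  proof -
    have gen: "a \<in> expo n \<longrightarrow> P a" if "(\<Sum>i\<in>{1..n}. lk a i) = m" for m a
      using that
    proof (induction m arbitrary: a)
      case 0
      show ?case
      proof
        assume "a \<in> expo n"
        then have "a = 0" using 0 by (intro poly_mapping_eqI) (auto simp: expo_def in_keys_iff)
        then show "P a" using assms(2) by simp
      qed
    next
      case (Suc m)
      show ?case
      proof
        assume a: "a \<in> expo n"
        obtain i where i: "i \<in> {1..n}" "lk a i > 0"
          using Suc.prems by (metis bot_nat_0.not_eq_extremum nat.distinct(1) sum.neutral)
        define a' where "a' = a - ev i"
        have aa: "a = ev i + a'" unfolding a'_def
          by (rule poly_mapping_eqI) (use i in \<open>auto simp: lookup_add lookup_minus lookup_single when_def\<close>)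
        have "(\<Sum>i\<in>{1..n}. lk a i) = Suc (\<Sum>i\<in>{1..n}. lk a' i)"
          using i by (simp add: aa lookup_add sum.distrib lookup_single when_def sum.delta')
        then show "P a" using Suc aa a assms(3)[of a' i] i expo_add_iff by auto
      qed
    qed
    then show ?thesis using assms(1) by blast
  qed
qed

lemma expo_out: "a \<in> expo n \<Longrightarrow> i \<notin> {1..n} \<Longrightarrow> lk a i = 0"
  unfolding expo_def using not_in_keys_iff_lookup_eq_zero[of i a] by blast

section \<open>Cutting functions down to exponents, and boxes of residues\<close>

definition rst :: "nat set \<Rightarrow> (nat \<Rightarrow> nat) \<Rightarrow> (nat \<Rightarrow>\<^sub>0 nat)" where
  "rst A d = Abs_poly_mapping (\<lambda>i. if i \<in> A then d i else 0)"

lemma lk_rst: "finite A \<Longrightarrow> lk (rst A d) i = (if i \<in> A then d i else 0)"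
  unfolding rst_def by (subst lookup_Abs_poly_mapping) (auto intro: finite_subset)

lemma rst_expo: "rst {1..n} d \<in> expo n"
  unfolding expo_def by (auto simp: in_keys_iff lk_rst split: if_splits)

lemma rst_lk: "a \<in> expo n \<Longrightarrow> rst {1..n} (lk a) = a"
  unfolding expo_def by (intro poly_mapping_eqI) (auto simp: in_keys_iff lk_rst)

definition box :: "nat \<Rightarrow> (nat \<Rightarrow> nat) \<Rightarrow> (nat \<Rightarrow>\<^sub>0 nat) set" where
  "box n w = {a \<in> expo n. \<forall>i\<in>{1..n}. lk a i < w i}"

lemma bij_box: "bij_betw (rst {1..n}) (PiE {1..n} (\<lambda>i. {..<w i})) (box n w)"
  unfolding bij_betw_def
proof (intro conjI subset_antisym subsetI)
  show "inj_on (rst {1..n}) (PiE {1..n} (\<lambda>i. {..<w i}))"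
  proof (rule inj_onI)
    fix x y assume xy: "x \<in> PiE {1..n} (\<lambda>i. {..<w i})" "y \<in> PiE {1..n} (\<lambda>i. {..<w i})"
      and e: "rst {1..n} x = rst {1..n} y"
    have "x i = y i" if "i \<in> {1..n}" for i
      using arg_cong[OF e, of "\<lambda>a. lk a i"] that by (simp add: lk_rst)
    then show "x = y" using xy by (rule PiE_ext[rotated 2])
  qed
next
  fix a assume "a \<in> rst {1..n} ` (PiE {1..n} (\<lambda>i. {..<w i}))"
  then show "a \<in> box n w" by (auto simp: box_def rst_expo lk_rst)
next
  fix a assume a: "a \<in> box n w"
  have "a = rst {1..n} (restrict (lk a) {1..n})"
    using a rst_lk[of a n] unfolding box_def
    by (intro poly_mapping_eqI) (auto simp: lk_rst expo_def in_keys_iff)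
  moreover have "restrict (lk a) {1..n} \<in> PiE {1..n} (\<lambda>i. {..<w i})"
    using a by (auto simp: box_def)
  ultimately show "a \<in> rst {1..n} ` (PiE {1..n} (\<lambda>i. {..<w i}))" by blast
qed

lemma card_box: "card (box n w) = (\<Prod>i = 1..n. w i)"
  using bij_betw_same_card[OF bij_box[of n w]] by (simp add: card_PiE)

lemma finite_box: "finite (box n w)"
  using bij_betw_finite[OF bij_box[of n w]] by (simp add: finite_PiE)

text \<open>\<open>x\<^sup>a x\<^sup>b = cocyc a b x\<^sup>a\<^sup>+\<^sup>b\<close>: sorting the product moves each of the \<open>a\<^sub>j\<close> factors \<open>x\<^sub>j\<close> past each of the
  \<open>b\<^sub>i\<close> factors \<open>x\<^sub>i\<close> with \<open>i < j\<close>.\<close>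

definition cocyc :: "nat \<Rightarrow> (nat \<Rightarrow> nat \<Rightarrow> 'k::field) \<Rightarrow> (nat \<Rightarrow>\<^sub>0 nat) \<Rightarrow> (nat \<Rightarrow>\<^sub>0 nat) \<Rightarrow> 'k" where
  "cocyc n p a b = (\<Prod>j\<in>{1..n}. \<Prod>i\<in>{1..<j}. p i j ^ (lk a j * lk b i))"

lemma cocyc_add_left: "cocyc n p (a + a') b = cocyc n p a b * cocyc n p a' b"
  by (simp add: cocyc_def lookup_add algebra_simps power_add prod.distrib)

lemma cocyc_add_right: "cocyc n p a (b + b') = cocyc n p a b * cocyc n p a b'"
  by (simp add: cocyc_def lookup_add algebra_simps power_add prod.distrib)

lemma cocyc_0 [simp]: "cocyc n p 0 b = 1" "cocyc n p a 0 = 1"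
  by (simp_all add: cocyc_def)

definition tmul :: "nat \<Rightarrow> (nat \<Rightarrow> nat \<Rightarrow> 'k::field) \<Rightarrow> ((nat \<Rightarrow>\<^sub>0 nat) \<Rightarrow>\<^sub>0 'k) \<Rightarrow> ((nat \<Rightarrow>\<^sub>0 nat) \<Rightarrow>\<^sub>0 'k)
    \<Rightarrow> ((nat \<Rightarrow>\<^sub>0 nat) \<Rightarrow>\<^sub>0 'k)" where
  "tmul n p F G = lext (\<lambda>a x. lext (\<lambda>b y. sg (a + b) (cocyc n p a b * x * y)) G) F"

lemma tmul_add_left: "tmul n p (F + F') G = tmul n p F G + tmul n p F' G"
  unfolding tmul_def
  by (rule lext_add) (simp_all add: lext_def algebra_simps single_add sum.distrib)

lemma tmul_add_right: "tmul n p F (G + G') = tmul n p F G + tmul n p F G'"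
proof -
  have "tmul n p F (G + G') = lext (\<lambda>a x. lext (\<lambda>b y. sg (a + b) (cocyc n p a b * x * y)) G
      + lext (\<lambda>b y. sg (a + b) (cocyc n p a b * x * y)) G') F"
    unfolding tmul_def by (subst lext_add) (simp_all add: algebra_simps single_add)
  then show ?thesis by (simp add: tmul_def lext_def sum.distrib)
qed

lemma tmul_zero [simp]: "tmul n p 0 G = 0" "tmul n p F 0 = 0"
  by (simp_all add: tmul_def) (simp add: lext_def)

lemma tmul_single: "tmul n p (sg a x) (sg b y) = sg (a + b) (cocyc n p a b * x * y)"
  by (simp add: tmul_def lext_single)

lemma lk_tmul:
  "lk (tmul n p F G) g = (\<Sum>a\<in>ks F. \<Sum>b\<in>ks G. if a + b = g then cocyc n p a b * lk F a * lk G b else 0)"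
  by (simp add: tmul_def lext_def lookup_sum lookup_single when_def)

lemma ks_tmul: "ks (tmul n p F G) \<subseteq> {a + b | a b. a \<in> ks F \<and> b \<in> ks G}"
proof
  fix g assume "g \<in> ks (tmul n p F G)"
  then have "lk (tmul n p F G) g \<noteq> 0" by (simp add: in_keys_iff)
  then obtain a where a: "a \<in> ks F"
    "(\<Sum>b\<in>ks G. if a + b = g then cocyc n p a b * lk F a * lk G b else 0) \<noteq> 0"
    unfolding lk_tmul by (rule sum.not_neutral_contains_not_neutral)
  from a(2) obtain b where "b \<in> ks G" "(if a + b = g then cocyc n p a b * lk F a * lk G b else 0) \<noteq> 0"
    by (rule sum.not_neutral_contains_not_neutral)
  then show "g \<in> {a + b | a b. a \<in> ks F \<and> b \<in> ks G}" using a by (auto split: if_splits)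
qed

text \<open>Addition of exponents is cancellative, so exactly one summand reaches
  \<open>a + b\<close>. Multiplication by a monomial can be undone coefficientwise.\<close>

lemma lk_tmul_single_right: "lk (tmul n p F (sg b y)) (a + b) = cocyc n p a b * lk F a * y"
proof (cases "y = 0")
  case False
  have "lk (tmul n p F (sg b y)) (a + b) = (\<Sum>a'\<in>ks F. if a' = a then cocyc n p a' b * lk F a' * y else 0)"
    unfolding lk_tmul using False by (intro sum.cong) auto
  also have "\<dots> = cocyc n p a b * lk F a * y"
    by (simp add: sum.delta in_keys_iff)
  finally show ?thesis .
qed simp

lemma lk_tmul_single_left: "lk (tmul n p (sg b y) F) (b + a) = cocyc n p b a * y * lk F a"
proof (cases "y = 0")
  case False
  have "lk (tmul n p (sg b y) F) (b + a) = (\<Sum>a'\<in>ks F. if a' = a then cocyc n p b a' * y * lk F a' else 0)"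
    unfolding lk_tmul using False by simp
  also have "\<dots> = cocyc n p b a * y * lk F a"
    by (simp add: sum.delta in_keys_iff)
  finally show ?thesis .
qed simp

definition twisted :: "nat \<Rightarrow> (nat \<Rightarrow> nat \<Rightarrow> 'k::field) \<Rightarrow> ((nat \<Rightarrow>\<^sub>0 nat) \<Rightarrow>\<^sub>0 'k) ring" where
  "twisted n p = \<lparr>carrier = {F. ks F \<subseteq> expo n}, monoid.mult = tmul n p, monoid.one = sg 0 1,
     ring.zero = 0, ring.add = (+)\<rparr>"

lemma twisted_simps [simp]:
  "carrier (twisted n p) = {F. ks F \<subseteq> expo n}" "monoid.mult (twisted n p) = tmul n p"
  "monoid.one (twisted n p) = sg 0 1" "ring.zero (twisted n p) = 0" "ring.add (twisted n p) = (+)"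
  by (simp_all add: twisted_def)

section \<open>The free algebra\<close>

lemma free_algebra_simps [simp]:
  "carrier (free_algebra n) = {f. \<forall>w\<in>ks f. set (letters w) \<subseteq> {1..n}}"
  "monoid.mult (free_algebra n) = (*)" "monoid.one (free_algebra n) = 1"
  "ring.zero (free_algebra n) = 0" "ring.add (free_algebra n) = (+)"
  by (simp_all add: free_algebra_def ring_of_type_algebra_def)

lemma letters_simps [simp]: "letters 0 = []" "letters (u + v) = letters u @ letters v"
  by (simp_all add: zero_free_mon_def plus_free_mon_def)

lemma ring_free_algebra: "ring (free_algebra n :: (nat free_mon \<Rightarrow>\<^sub>0 'k::field) ring)"
proof (rule ringI)
  show "abelian_group (free_algebra n :: (nat free_mon \<Rightarrow>\<^sub>0 'k) ring)"
  proof (rule abelian_groupI)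
    fix x :: "nat free_mon \<Rightarrow>\<^sub>0 'k" assume x: "x \<in> carrier (free_algebra n)"
    then have "-x \<in> carrier (free_algebra n)" by (auto simp: in_keys_iff)
    moreover have "-x + x = 0" by simp
    ultimately show "\<exists>y\<in>carrier (free_algebra n). y \<oplus>\<^bsub>free_algebra n\<^esub> x = \<zero>\<^bsub>free_algebra n\<^esub>"
      by (metis free_algebra_simps(4) free_algebra_simps(5))
  next
    fix x y :: "nat free_mon \<Rightarrow>\<^sub>0 'k"
    assume xy: "x \<in> carrier (free_algebra n)" "y \<in> carrier (free_algebra n)"
    then show "x \<oplus>\<^bsub>free_algebra n\<^esub> y \<in> carrier (free_algebra n)"
      using Poly_Mapping.keys_add[of x y] by auto
  qed (auto simp: algebra_simps)
  show "monoid (free_algebra n :: (nat free_mon \<Rightarrow>\<^sub>0 'k) ring)"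
  proof (rule monoidI)
    fix x y :: "nat free_mon \<Rightarrow>\<^sub>0 'k"
    assume xy: "x \<in> carrier (free_algebra n)" "y \<in> carrier (free_algebra n)"
    then show "x \<otimes>\<^bsub>free_algebra n\<^esub> y \<in> carrier (free_algebra n)"
      using keys_mult[of x y] by fastforce
  qed (auto simp: algebra_simps)
qed (auto simp: algebra_simps)

lemma minus_free_algebra:
  fixes f g :: "nat free_mon \<Rightarrow>\<^sub>0 'k::field"
  assumes "f \<in> carrier (free_algebra n)" "g \<in> carrier (free_algebra n)"
  shows "f \<ominus>\<^bsub>free_algebra n\<^esub> g = f - g"
proof -
  interpret ring "free_algebra n :: (nat free_mon \<Rightarrow>\<^sub>0 'k) ring" by (rule ring_free_algebra)
  have m: "-g \<in> carrier (free_algebra n)" using assms by (auto simp: in_keys_iff)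
  have "\<ominus>\<^bsub>free_algebra n\<^esub> g = -g"
    using minus_equality[of "-g" g] m assms by simp
  then show ?thesis by (simp add: a_minus_def)
qed

section \<open>Words, their abelianisation \<open>cnt\<close> and their sorted form\<close>

primrec cnt :: "nat list \<Rightarrow> (nat \<Rightarrow>\<^sub>0 nat)" where
  "cnt [] = 0" | "cnt (j # w) = ev j + cnt w"

lemma cnt_append: "cnt (u @ v) = cnt u + cnt v"
  by (induction u) (simp_all add: add.assoc)

lemma lk_cnt: "lk (cnt w) i = count_list w i"
  by (induction w) (auto simp: lookup_add lookup_single when_def)

lemma cnt_expo: "set w \<subseteq> {1..n} \<Longrightarrow> cnt w \<in> expo n"
  by (induction w) (auto intro!: expo_add expo_single)

lemma cnt_insort: "cnt (insort j w) = ev j + cnt w"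
  by (induction w) (auto simp: algebra_simps)

lemma cnt_sort: "cnt (sort w) = cnt w"
  by (induction w) (auto simp: cnt_insort)

lemma sort_eq_of_cnt_eq: "cnt u = cnt v \<Longrightarrow> sort u = sort v"
proof -
  assume "cnt u = cnt v"
  then have "mset u = mset v"
    by (intro multiset_eqI) (metis count_mset lk_cnt)
  then show ?thesis by (metis mset_sort properties_for_sort sorted_sort)
qed

lemma cnt_ex: "a \<in> expo n \<Longrightarrow> \<exists>w. set w \<subseteq> {1..n} \<and> cnt w = a"
proof (induction rule: expo_induct)
  case zero then show ?case by (intro exI[of _ "[]"]) auto
next
  case (add a i)
  then obtain w where "set w \<subseteq> {1..n}" "cnt w = a" by blast
  then show ?case using add by (intro exI[of _ "i # w"]) auto
qed

text \<open>The scalar collected while sorting: modulo the relations a word equals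
  \<open>wcoef\<close> times its sorted rearrangement.\<close>

primrec wcoef :: "nat \<Rightarrow> (nat \<Rightarrow> nat \<Rightarrow> 'k::field) \<Rightarrow> nat list \<Rightarrow> 'k" where
  "wcoef n p [] = 1"
| "wcoef n p (j # w) = cocyc n p (ev j) (cnt w) * wcoef n p w"

lemma wcoef_append: "wcoef n p (u @ v) = cocyc n p (cnt u) (cnt v) * wcoef n p u * wcoef n p v"
  by (induction u) (simp_all add: cnt_append cocyc_add_left cocyc_add_right)

definition nform :: "nat \<Rightarrow> (nat \<Rightarrow> nat \<Rightarrow> 'k::field) \<Rightarrow> (nat free_mon \<Rightarrow>\<^sub>0 'k) \<Rightarrow> ((nat \<Rightarrow>\<^sub>0 nat) \<Rightarrow>\<^sub>0 'k)" where
  "nform n p f = lext (\<lambda>w x. sg (cnt (letters w)) (wcoef n p (letters w) * x)) f"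

lemma nform_add: "nform n p (f + g) = nform n p f + nform n p g"
  unfolding nform_def by (rule lext_add) (simp_all add: algebra_simps single_add)

lemma nform_single: "nform n p (sg w x) = sg (cnt (letters w)) (wcoef n p (letters w) * x)"
  by (simp add: nform_def lext_single)

lemma nform_zero [simp]: "nform n p 0 = 0" by (simp add: nform_def)

lemma nform_diff: "nform n p (f - g) = nform n p f - nform n p g"
  using nform_add[of n p "f - g" g] by (simp add: algebra_simps)

text \<open>On words this is \<open>wcoef_append\<close>, which rests on the bimultiplicativity of
  the cocycle; the rest is biadditivity.\<close>

lemma nform_mult: "nform n p (f * g) = tmul n p (nform n p f) (nform n p g)"
proof -
  have "ks f \<subseteq> UNIV" by simp
  then show ?thesis
  proof (induction rule: pm_induct)
    case (single u x)
    have "ks g \<subseteq> UNIV" by simp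
    then show ?case
    proof (induction rule: pm_induct)
      case (single v y)
      then show ?case
        by (simp add: mult_single nform_single tmul_single cnt_append wcoef_append mult_ac)
    next
      case (add F G) then show ?case by (simp add: nform_add tmul_add_right distrib_left)
    qed simp
  next
    case (add F G) then show ?case by (simp add: nform_add tmul_add_left distrib_right)
  qed simp
qed

lemma nform_carrier: "f \<in> carrier (free_algebra n) \<Longrightarrow> ks (nform n p f) \<subseteq> expo n"
proof -
  assume f: "f \<in> carrier (free_algebra n)"
  have "ks (nform n p f) \<subseteq> (\<Union>w\<in>ks f. {cnt (letters w)})"
    unfolding nform_def by (rule order_trans[OF ks_lext]) (auto simp: lookup_single in_keys_iff when_def)
  also have "\<dots> \<subseteq> expo n" using f cnt_expo by auto
  finally show ?thesis .
qed

text \<open>Any word with exponent \<open>a\<close> may be chosen, since sorting erases the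
  difference; the outcome is the ordered monomial x^a as a word.\<close>

definition wrd :: "nat \<Rightarrow> (nat \<Rightarrow>\<^sub>0 nat) \<Rightarrow> nat list" where
  "wrd n a = sort (SOME w. set w \<subseteq> {1..n} \<and> cnt w = a)"

lemma wrd: "a \<in> expo n \<Longrightarrow> set (wrd n a) \<subseteq> {1..n} \<and> cnt (wrd n a) = a"
  using someI_ex[OF cnt_ex, of a n] by (simp add: wrd_def cnt_sort)

lemma sort_eq_wrd: "set w \<subseteq> {1..n} \<Longrightarrow> sort w = wrd n (cnt w)"
  unfolding wrd_def
  by (rule sort_eq_of_cnt_eq) (use someI_ex[OF cnt_ex[OF cnt_expo], of w n] in simp)

text \<open>A section of \<open>nform\<close>, sending x^a to its ordered word.\<close>

definition lift :: "nat \<Rightarrow> (nat \<Rightarrow> nat \<Rightarrow> 'k::field) \<Rightarrow> ((nat \<Rightarrow>\<^sub>0 nat) \<Rightarrow>\<^sub>0 'k) \<Rightarrow> (nat free_mon \<Rightarrow>\<^sub>0 'k)" where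
  "lift n p F = lext (\<lambda>a x. sg (FreeMon (wrd n a)) x) F"

lemma lift_add: "lift n p (F + G) = lift n p F + lift n p G"
  unfolding lift_def by (rule lext_add) (simp_all add: single_add)

lemma lift_single: "lift n p (sg a x) = sg (FreeMon (wrd n a)) x"
  by (simp add: lift_def lext_single)

lemma lift_zero [simp]: "lift n p 0 = 0" by (simp add: lift_def)

lemma ks_lift: "ks (lift n p F) \<subseteq> (\<lambda>a. FreeMon (wrd n a)) ` ks F"
  unfolding lift_def by (rule order_trans[OF ks_lext]) (auto split: if_splits)

lemma lift_carrier: "ks F \<subseteq> expo n \<Longrightarrow> lift n p F \<in> carrier (free_algebra n)"
proof -
  assume F: "ks F \<subseteq> expo n"
  have "set (letters w) \<subseteq> {1..n}" if w: "w \<in> ks (lift n p F)" for w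
  proof -
    obtain a where "a \<in> ks F" "w = FreeMon (wrd n a)" using w ks_lift[of n p F] by blast
    then show ?thesis using wrd[of a n] F by auto
  qed
  then show ?thesis by simp
qed

text \<open>Only strict inversions contribute to the cocycle, and a sorted word has none.\<close>

lemma wcoef_sorted: "sorted w \<Longrightarrow> wcoef n p w = 1"
proof (induction w)
  case (Cons j w)
  have "cocyc n p (ev j) (cnt w) = 1"
    unfolding cocyc_def
  proof (intro prod.neutral ballI)
    fix j' i assume "j' \<in> {1..n}" "i \<in> {1..<j'}"
    moreover have "i \<notin> set w" if "j = j'" using Cons.prems calculation that by force
    ultimately show "p i j' ^ (lk (ev j) j' * lk (cnt w) i) = 1"
      by (cases "j = j'") (auto simp: lookup_single lk_cnt count_list_0_iff)
  qed
  then show ?case using Cons by simp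
qed simp

lemma nform_lift: "ks F \<subseteq> expo n \<Longrightarrow> nform n p (lift n p F) = F"
proof (induction rule: pm_induct)
  case (single a x)
  have "sorted (wrd n a)" by (simp add: wrd_def)
  then show ?case using single wrd by (simp add: lift_single nform_single wcoef_sorted)
next
  case (add F G) then show ?case by (simp add: nform_add lift_add)
qed simp

section \<open>The normal form isomorphism\<close>

text \<open>The common value of \<open>nform\<close> on a coset of the ideal; it is meaningful
  because the ideal is the kernel of \<open>nform\<close>.\<close>

definition nf :: "nat \<Rightarrow> (nat \<Rightarrow> nat \<Rightarrow> 'k::field) \<Rightarrow> (nat free_mon \<Rightarrow>\<^sub>0 'k) set \<Rightarrow> ((nat \<Rightarrow>\<^sub>0 nat) \<Rightarrow>\<^sub>0 'k)" where
  "nf n p s = the_elem (nform n p ` s)"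

definition cls :: "nat \<Rightarrow> (nat \<Rightarrow> nat \<Rightarrow> 'k::field) \<Rightarrow> ((nat \<Rightarrow>\<^sub>0 nat) \<Rightarrow>\<^sub>0 'k) \<Rightarrow> (nat free_mon \<Rightarrow>\<^sub>0 'k) set" where
  "cls n p F = skew_class n p (lift n p F)"

locale skew_ring =
  fixes n :: nat and p :: "nat \<Rightarrow> nat \<Rightarrow> 'k::field"
  assumes p_diag: "\<And>i. i \<in> {1..n} \<Longrightarrow> p i i = 1"
    and p_antisym: "\<And>i j. i \<in> {1..n} \<Longrightarrow> j \<in> {1..n} \<Longrightarrow> p j i = inverse (p i j)"
    and p_nz: "\<And>i j. i \<in> {1..n} \<Longrightarrow> j \<in> {1..n} \<Longrightarrow> p i j \<noteq> 0"
begin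

abbreviation "FA \<equiv> free_algebra n :: (nat free_mon \<Rightarrow>\<^sub>0 'k) ring"
abbreviation "I \<equiv> skew_ideal n p"
abbreviation "S \<equiv> skew_poly n p"
abbreviation "T \<equiv> twisted n p"
abbreviation "E \<equiv> expo n"
abbreviation "coc \<equiv> cocyc n p"
abbreviation tm (infixl "\<star>" 70) where "tm \<equiv> tmul n p"
abbreviation sm (infixl "\<cdot>" 70) where "sm \<equiv> monoid.mult S"
abbreviation "nff \<equiv> nf n p"
abbreviation "cl \<equiv> cls n p"

lemmas FA_ring = ring_free_algebra[where 'k = 'k and n = n]

abbreviation "gens \<equiv> {free_gen j * free_gen i - sg 0 (p i j) * (free_gen i * free_gen j) | i j.
        i \<in> {1..n} \<and> j \<in> {1..n}}"

lemma FA_diff: "f \<in> carrier FA \<Longrightarrow> g \<in> carrier FA \<Longrightarrow> f - g \<in> carrier FA"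
  using ring.ring_simprules(4)[OF FA_ring, of f g] minus_free_algebra[of f n g] by (simp only:)

lemma FA_single: "set (letters w) \<subseteq> {1..n} \<Longrightarrow> sg w x \<in> carrier FA"
  by simp

lemma free_gen_prod: "free_gen j * free_gen i = (sg (FreeMon [j, i]) 1 :: nat free_mon \<Rightarrow>\<^sub>0 'k)"
  by (simp add: free_gen_def mult_single plus_free_mon_def)

lemma gens_eq: "gens = {sg (FreeMon [j, i]) 1 - sg (FreeMon [i, j]) (p i j) | i j. i \<in> {1..n} \<and> j \<in> {1..n}}"
  by (simp add: free_gen_prod mult_single)

lemma gens_carrier: "gens \<subseteq> carrier FA"
proof
  fix x assume "x \<in> gens"
  then obtain i j where x: "x = sg (FreeMon [j, i]) 1 - sg (FreeMon [i, j]) (p i j)"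
    and ij: "i \<in> {1..n}" "j \<in> {1..n}"
    unfolding gens_eq by blast
  show "x \<in> carrier FA" unfolding x
    by (rule FA_diff; rule FA_single) (use ij in auto)
qed

section \<open>The ideal of relations as the kernel of the normal form\<close>

lemma ideal_I: "ideal I FA"
  unfolding skew_ideal_def by (rule ring.genideal_ideal[OF FA_ring gens_carrier])

lemma gens_I: "gens \<subseteq> I"
  unfolding skew_ideal_def by (rule ring.genideal_self[OF FA_ring gens_carrier])

lemma I_add: "f \<in> I \<Longrightarrow> g \<in> I \<Longrightarrow> f + g \<in> I"
  using additive_subgroup.a_closed[OF ideal.axioms(1)[OF ideal_I], of f g] by simp
lemma I_lmult: "f \<in> I \<Longrightarrow> g \<in> carrier FA \<Longrightarrow> g * f \<in> I"
  using ideal.I_l_closed[OF ideal_I, of f g] by simp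
lemma I_rmult: "f \<in> I \<Longrightarrow> g \<in> carrier FA \<Longrightarrow> f * g \<in> I"
  using ideal.I_r_closed[OF ideal_I, of f g] by simp
lemma I_zero [simp]: "0 \<in> I"
  using additive_subgroup.zero_closed[OF ideal.axioms(1)[OF ideal_I]] by simp

lemma coc_ev: "i \<in> {1..n} \<Longrightarrow> j \<in> {1..n} \<Longrightarrow> coc (ev j) (ev i) = (if i < j then p i j else 1)"
proof -
  assume ij: "i \<in> {1..n}" "j \<in> {1..n}"
  have "coc (ev j) (ev i) = (\<Prod>j'\<in>{1..n}. if j' = j then (if i < j then p i j else 1) else 1)"
    unfolding cocyc_def
  proof (rule prod.cong[OF refl])
    fix j' assume "j' \<in> {1..n}"
    have "(\<Prod>i'\<in>{1..<j'}. p i' j' ^ (lk (ev j) j' * lk (ev i) i'))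
        = (\<Prod>i'\<in>{1..<j'}. if i' = i then (if j' = j then p i j else 1) else 1)"
      by (rule prod.cong) (auto simp: lookup_single)
    also have "\<dots> = (if j' = j then (if i < j then p i j else 1) else 1)"
      using ij by (auto simp: prod.delta)
    finally show "(\<Prod>i'\<in>{1..<j'}. p i' j' ^ (lk (ev j) j' * lk (ev i) i'))
        = (if j' = j then (if i < j then p i j else 1) else 1)" .
  qed
  then show ?thesis using ij by (simp add: prod.delta)
qed

lemma p_inv: "i \<in> {1..n} \<Longrightarrow> j \<in> {1..n} \<Longrightarrow> p i j * p j i = 1"
  using p_antisym[of i j] p_nz[of i j] by simp

lemma coc_swap_ev: "i \<in> {1..n} \<Longrightarrow> j \<in> {1..n} \<Longrightarrow> coc (ev j) (ev i) = p i j * coc (ev i) (ev j)"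
  using coc_ev[of i j] coc_ev[of j i] p_inv[of i j] p_diag[of i]
  by (cases i j rule: linorder_cases) auto

lemma nform_hom: "nform n p \<in> ring_hom FA T"
proof (rule ring_hom_memI)
  fix x assume "x \<in> carrier FA"
  then show "nform n p x \<in> carrier T" using nform_carrier by simp
next
  show "nform n p \<one>\<^bsub>FA\<^esub> = \<one>\<^bsub>T\<^esub>" using nform_single[of n p 0 1] by simp
qed (simp_all add: nform_add nform_mult)

lemma nform_surj: "nform n p ` carrier FA = carrier T"
proof
  show "nform n p ` carrier FA \<subseteq> carrier T" using nform_carrier by auto
  show "carrier T \<subseteq> nform n p ` carrier FA"
  proof
    fix F assume "F \<in> carrier T"
    then show "F \<in> nform n p ` carrier FA"
      using nform_lift[of F n p] lift_carrier[of F n p] by (metis imageI mem_Collect_eq twisted_simps(1))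
  qed
qed

text \<open>Associativity of the twisted product is inherited: \<open>T\<close> is the image of the
  free algebra under a map that respects sums, products and one.\<close>

lemma ring_T: "ring T"
proof -
  have "T\<lparr>carrier := nform n p ` carrier FA, zero := nform n p \<zero>\<^bsub>FA\<^esub>\<rparr> = T"
    unfolding nform_surj by (simp add: twisted_def)
  then show ?thesis using ring.ring_hom_imp_img_ring[OF FA_ring nform_hom] by simp
qed

lemma nform_hom_ring: "ring_hom_ring FA T (nform n p)"
  by (rule ring_hom_ringI2[OF ring_free_algebra ring_T nform_hom])

lemma I_kernel: "I \<subseteq> a_kernel FA T (nform n p)"
  unfolding skew_ideal_def
proof (rule ring.genideal_minimal[OF FA_ring ring_hom_ring.kernel_is_ideal[OF nform_hom_ring]])
  show "gens \<subseteq> a_kernel FA T (nform n p)"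
  proof
    fix x assume x: "x \<in> gens"
    then obtain i j where xe: "x = sg (FreeMon [j, i]) 1 - sg (FreeMon [i, j]) (p i j)"
      and ij: "i \<in> {1..n}" "j \<in> {1..n}"
      unfolding gens_eq by blast
    have "nform n p x = 0"
      using coc_swap_ev[OF ij] by (simp add: xe nform_diff nform_single add.commute mult.commute)
    moreover have "x \<in> carrier FA" using x gens_carrier by blast
    ultimately show "x \<in> a_kernel FA T (nform n p)"
      unfolding a_kernel_def' by (simp del: free_algebra_simps(1))
  qed
qed

lemma swap_I: "i \<in> {1..n} \<Longrightarrow> j \<in> {1..n} \<Longrightarrow> sg (FreeMon [j, i]) x - sg (FreeMon [i, j]) (p i j * x) \<in> I"
proof -
  assume ij: "i \<in> {1..n}" "j \<in> {1..n}"
  have "sg (FreeMon [j, i]) 1 - sg (FreeMon [i, j]) (p i j) \<in> I"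
    using gens_I unfolding gens_eq using ij by blast
  then have "sg 0 x * (sg (FreeMon [j, i]) 1 - sg (FreeMon [i, j]) (p i j)) \<in> I"
    by (rule I_lmult) simp
  then show ?thesis by (simp add: right_diff_distrib mult_single mult.commute)
qed

text \<open>Each step moves \<open>j\<close> past one smaller letter by a defining relation, and
  multiplying by further letters stays in the ideal.\<close>

lemma insort_I:
  "sorted w \<Longrightarrow> set w \<subseteq> {1..n} \<Longrightarrow> j \<in> {1..n} \<Longrightarrow>
    sg (FreeMon (j # w)) x - sg (FreeMon (insort j w)) (coc (ev j) (cnt w) * x) \<in> I"
proof (induction w arbitrary: x)
  case Nil then show ?case by simp
next
  case (Cons y w)
  show ?case
  proof (cases "j \<le> y")
    case True
    \<comment> \<open>Both words are sorted, so comparing their coefficients shows that the cocycle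
      factor of \<open>j\<close> is 1.\<close>
    then have "sorted (j # y # w)" using Cons.prems by auto
    then have "wcoef n p (j # y # w) = 1" "wcoef n p (y # w) = 1"
      using Cons.prems wcoef_sorted by blast+
    then have "coc (ev j) (cnt (y # w)) = 1" by simp
    then show ?thesis using True by simp
  next
    case False
    then have c: "coc (ev j) (ev y) = p y j" using Cons.prems coc_ev[of y j] by auto
    have y: "y \<in> {1..n}" "set w \<subseteq> {1..n}" using Cons.prems by auto
    have "(sg (FreeMon [j, y]) x - sg (FreeMon [y, j]) (p y j * x)) * sg (FreeMon w) 1 \<in> I"
      by (rule I_rmult[OF swap_I]) (use y Cons.prems in auto)
    then have 1: "sg (FreeMon (j # y # w)) x - sg (FreeMon (y # j # w)) (p y j * x) \<in> I"
      by (simp add: left_diff_distrib mult_single plus_free_mon_def)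
    have "sg (FreeMon [y]) 1 * (sg (FreeMon (j # w)) (p y j * x)
        - sg (FreeMon (insort j w)) (coc (ev j) (cnt w) * (p y j * x))) \<in> I"
      by (rule I_lmult[OF Cons.IH]) (use y Cons.prems in auto)
    then have 2: "sg (FreeMon (y # j # w)) (p y j * x)
        - sg (FreeMon (y # insort j w)) (coc (ev j) (cnt w) * (p y j * x)) \<in> I"
      by (simp add: right_diff_distrib mult_single plus_free_mon_def)
    show ?thesis using I_add[OF 1 2] False c by (simp add: cocyc_add_right mult_ac)
  qed
qed

lemma sort_I: "set w \<subseteq> {1..n} \<Longrightarrow> sg (FreeMon w) x - sg (FreeMon (sort w)) (wcoef n p w * x) \<in> I"
proof (induction w arbitrary: x)
  case (Cons j w)
  then have j: "j \<in> {1..n}" "set w \<subseteq> {1..n}" by auto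
  have "sg (FreeMon [j]) 1 * (sg (FreeMon w) x - sg (FreeMon (sort w)) (wcoef n p w * x)) \<in> I"
    by (rule I_lmult[OF Cons.IH]) (use j in auto)
  then have 1: "sg (FreeMon (j # w)) x - sg (FreeMon (j # sort w)) (wcoef n p w * x) \<in> I"
    by (simp add: right_diff_distrib mult_single plus_free_mon_def)
  have 2: "sg (FreeMon (j # sort w)) (wcoef n p w * x)
      - sg (FreeMon (insort j (sort w))) (coc (ev j) (cnt (sort w)) * (wcoef n p w * x)) \<in> I"
    by (rule insort_I) (use j in auto)
  show ?case using I_add[OF 1 2] by (simp add: cnt_sort mult_ac)
qed simp

text \<open>Every element is congruent to a combination of ordered words. This spanning half of the
  basis theorem puts the kernel inside the ideal; \<open>I_kernel\<close> is the independence
  half.\<close>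

lemma lift_nform: "f \<in> carrier FA \<Longrightarrow> f - lift n p (nform n p f) \<in> I"
proof -
  assume "f \<in> carrier FA"
  then have "ks f \<subseteq> {w. set (letters w) \<subseteq> {1..n}}" by auto
  then show ?thesis
  proof (induction rule: pm_induct)
    case (single w x)
    then show ?case using sort_I[of "letters w" x] sort_eq_wrd[of "letters w" n]
      by (simp add: nform_single lift_single)
  next
    case (add F G)
    then show ?case using I_add[of "F - lift n p (nform n p F)" "G - lift n p (nform n p G)"]
      by (simp add: nform_add lift_add algebra_simps)
  qed simp
qed

lemma kernel_eq: "a_kernel FA T (nform n p) = I"
proof
  show "a_kernel FA T (nform n p) \<subseteq> I"
  proof
    fix f assume "f \<in> a_kernel FA T (nform n p)"
    then have "f \<in> carrier FA" "nform n p f = 0" unfolding a_kernel_def' by simp_all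
    then show "f \<in> I" using lift_nform[of f] by simp
  qed
qed (rule I_kernel)

lemma nf_iso: "nff \<in> ring_iso S T"
  using ring_hom_ring.FactRing_iso_set[OF nform_hom_ring nform_surj] kernel_eq unfolding skew_poly_def nf_def[abs_def] by simp

lemma ring_S: "ring S"
  unfolding skew_poly_def by (rule ideal.quotient_is_ring[OF ideal_I])

sublocale S: ring S by (rule ring_S)

lemma nf_class: "f \<in> carrier FA \<Longrightarrow> nff (skew_class n p f) = nform n p f"
  using ring_hom_ring.the_elem_simp[OF nform_hom_ring, of f] unfolding nf_def skew_class_def kernel_eq .

lemma class_carrier: "f \<in> carrier FA \<Longrightarrow> skew_class n p f \<in> carrier S"
  unfolding skew_poly_def skew_class_def FactRing_def
  using abelian_group.a_rcosetsI[OF ring.is_abelian_group[OF FA_ring]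
      additive_subgroup.a_subset[OF ideal.axioms(1)[OF ideal_I]], of f] by simp

section \<open>Transport of the structure of \<open>S\<close> along the normal form\<close>

lemma nf_closed: "s \<in> carrier S \<Longrightarrow> ks (nff s) \<subseteq> E"
  using nf_iso unfolding ring_iso_def ring_hom_def by auto

lemma nf_mult: "s \<in> carrier S \<Longrightarrow> t \<in> carrier S \<Longrightarrow> nff (s \<cdot> t) = nff s \<star> nff t"
  using nf_iso unfolding ring_iso_def ring_hom_def by auto

lemma nf_add: "s \<in> carrier S \<Longrightarrow> t \<in> carrier S \<Longrightarrow> nff (s \<oplus>\<^bsub>S\<^esub> t) = nff s + nff t"
  using nf_iso unfolding ring_iso_def ring_hom_def by auto

lemma nf_one: "nff \<one>\<^bsub>S\<^esub> = sg 0 1"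
  using nf_iso unfolding ring_iso_def ring_hom_def by auto

lemma nf_zero: "nff \<zero>\<^bsub>S\<^esub> = 0"
  using ring_hom_zero[OF _ ring_S ring_T, of nff] nf_iso unfolding ring_iso_def by simp

lemma nf_inj: "s \<in> carrier S \<Longrightarrow> t \<in> carrier S \<Longrightarrow> nff s = nff t \<Longrightarrow> s = t"
  using nf_iso unfolding ring_iso_def bij_betw_def inj_on_def by auto

lemma cl_closed: "ks F \<subseteq> E \<Longrightarrow> cl F \<in> carrier S"
  unfolding cls_def by (rule class_carrier[OF lift_carrier])

lemma nf_cl: "ks F \<subseteq> E \<Longrightarrow> nff (cl F) = F"
  unfolding cls_def by (simp only: nf_class[OF lift_carrier] nform_lift)

lemma cl_nf: "s \<in> carrier S \<Longrightarrow> cl (nff s) = s"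
  by (rule nf_inj) (simp_all add: cl_closed nf_cl nf_closed)

lemma const_closed: "skew_const n p c \<in> carrier S"
  unfolding skew_const_def by (rule class_carrier) simp

lemma nf_const: "nff (skew_const n p c) = sg 0 c"
  unfolding skew_const_def using nf_class[of "sg 0 c"] by (simp add: nform_single)

lemma var_closed: "i \<in> {1..n} \<Longrightarrow> skew_var n p i \<in> carrier S"
  unfolding skew_var_def free_gen_def by (rule class_carrier) simp

lemma nf_var: "i \<in> {1..n} \<Longrightarrow> nff (skew_var n p i) = sg (ev i) 1"
  unfolding skew_var_def free_gen_def using nf_class[of "sg (FreeMon [i]) 1"] by (simp add: nform_single)

lemma scale_closed: "s \<in> carrier S \<Longrightarrow> skew_scale n p c s \<in> carrier S"
  unfolding skew_scale_def by (simp add: const_closed)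

lemma lk_scale: "s \<in> carrier S \<Longrightarrow> lk (nff (skew_scale n p c s)) a = c * lk (nff s) a"
  unfolding skew_scale_def using lk_tmul_single_left[of n p 0 c "nff s" a]
  by (simp add: nf_mult const_closed nf_const)

lemma nf_var_pow: "i \<in> {1..n} \<Longrightarrow> nff (skew_var n p i [^]\<^bsub>S\<^esub> k) = sg (sg i k) 1"
proof (induction k)
  case (Suc k)
  have "coc (sg i k) (ev i) = 1"
    unfolding cocyc_def by (intro prod.neutral ballI) (auto simp: lookup_single when_def)
  moreover have "sg i k + ev i = sg i (Suc k)"
    by (rule poly_mapping_eqI) (simp add: lookup_add lookup_single when_def)
  ultimately show ?case using Suc
    by (simp add: nf_mult var_closed nf_var tmul_single)
qed (simp add: nf_one)

lemma monom_aux: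
  assumes "sorted xs" "distinct xs" "set xs \<subseteq> {1..n}"
  shows "foldr (\<lambda>i s. (skew_var n p i [^]\<^bsub>S\<^esub> d i) \<cdot> s) xs \<one>\<^bsub>S\<^esub> \<in> carrier S \<and>
    nff (foldr (\<lambda>i s. (skew_var n p i [^]\<^bsub>S\<^esub> d i) \<cdot> s) xs \<one>\<^bsub>S\<^esub>) = sg (rst (set xs) d) 1"
  using assms
proof (induction xs)
  case Nil
  have "rst {} d = 0" by (rule poly_mapping_eqI) (simp add: lk_rst)
  then show ?case by (simp add: nf_one)
next
  case (Cons i xs)
  let ?m = "foldr (\<lambda>i s. (skew_var n p i [^]\<^bsub>S\<^esub> d i) \<cdot> s) xs \<one>\<^bsub>S\<^esub>"
  have IH: "?m \<in> carrier S" "nff ?m = sg (rst (set xs) d) 1" using Cons by auto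
  have i: "i \<in> {1..n}" using Cons by auto
  \<comment> \<open>The remaining letters are larger than \<open>i\<close>, so nothing has to be
    moved past a smaller letter.\<close>
  have c: "coc (sg i (d i)) (rst (set xs) d) = 1"
    unfolding cocyc_def
  proof (intro prod.neutral ballI)
    fix j k assume "j \<in> {1..n}" "k \<in> {1..<j}"
    moreover have "k \<notin> set xs" if "j = i" using Cons.prems calculation that by force
    ultimately show "p k j ^ (lk (sg i (d i)) j * lk (rst (set xs) d) k) = 1"
      by (cases "j = i") (auto simp: lookup_single lk_rst)
  qed
  have e: "sg i (d i) + rst (set xs) d = rst (set (i # xs)) d"
    using Cons.prems by (intro poly_mapping_eqI) (auto simp: lookup_add lk_rst lookup_single when_def)
  show ?case using i IH c e by (simp add: nf_mult var_closed nf_var_pow tmul_single)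
qed

abbreviation mono :: "(nat \<Rightarrow>\<^sub>0 nat) \<Rightarrow> (nat free_mon \<Rightarrow>\<^sub>0 'k) set" where
  "mono a \<equiv> cl (sg a 1)"

lemma monom_closed: "skew_monom n p d \<in> carrier S"
  and nf_monom: "nff (skew_monom n p d) = sg (rst {1..n} d) 1"
proof -
  have "set [1..<Suc n] = {1..n}" by auto
  moreover have "set [1..<Suc n] \<subseteq> {1..n}" by auto
  ultimately show "skew_monom n p d \<in> carrier S" "nff (skew_monom n p d) = sg (rst {1..n} d) 1"
    using monom_aux[of "[1..<Suc n]" d] unfolding skew_monom_def by (simp_all del: upt_Suc)
qed

text \<open>The length of a word is the total degree of its exponent, so sorting respects the
  grading.\<close>

lemma degree_eq: "skew_degree n p j =
  {s \<in> carrier S. \<forall>a\<in>ks (nff s). (\<Sum>i\<in>{1..n}. lk a i) = j}"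
proof -
  have len: "length w = (\<Sum>i\<in>{1..n}. lk (cnt w) i)" if "set w \<subseteq> {1..n}" for w
    using that by (induction w) (simp_all add: lookup_add sum.distrib lookup_single when_def sum.delta')
  show ?thesis
  proof (intro subset_antisym subsetI)
    fix s assume "s \<in> skew_degree n p j"
    then obtain f where f: "f \<in> carrier FA" "\<forall>w\<in>ks f. length (letters w) = j" "s = skew_class n p f"
      unfolding skew_degree_def by blast
    have "ks (nff s) \<subseteq> (\<Union>w\<in>ks f. {cnt (letters w)})"
      unfolding f(3) nf_class[OF f(1)] nform_def
      by (rule order_trans[OF ks_lext]) (auto simp: lookup_single in_keys_iff when_def)
    then show "s \<in> {s \<in> carrier S. \<forall>a\<in>ks (nff s). (\<Sum>i\<in>{1..n}. lk a i) = j}"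
      using f class_carrier len by fastforce
  next
    fix s assume s: "s \<in> {s \<in> carrier S. \<forall>a\<in>ks (nff s). (\<Sum>i\<in>{1..n}. lk a i) = j}"
    let ?f = "lift n p (nff s)"
    have f: "?f \<in> carrier FA" using s nf_closed by (intro lift_carrier) auto
    have "length (letters w) = j" if w: "w \<in> ks ?f" for w
    proof -
      obtain a where a: "a \<in> ks (nff s)" "w = FreeMon (wrd n a)" using w ks_lift[of n p "nff s"] by blast
      then have "a \<in> E" using s nf_closed by auto
      then show ?thesis using wrd[of a n] len[of "wrd n a"] a s by auto
    qed
    moreover have "skew_class n p ?f = s" using s cl_nf[of s] unfolding cls_def by simp
    ultimately show "s \<in> skew_degree n p j" unfolding skew_degree_def using f by force
  qed
qed

end

section \<open>The center and the ozone group\<close>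

definition sc :: "nat \<Rightarrow> (nat \<Rightarrow>\<^sub>0 nat) \<Rightarrow> (nat \<Rightarrow>\<^sub>0 nat)" where
  "sc k a = Poly_Mapping.map ((*) k) a"

lemma lk_sc [simp]: "lk (sc k a) i = k * lk a i"
  by (simp add: sc_def Poly_Mapping.map.rep_eq when_def)

lemma sc_expo [intro]: "a \<in> expo n \<Longrightarrow> sc k a \<in> expo n"
  by (auto simp: expo_def in_keys_iff)

text \<open>The scalar by which conjugation by x^b acts on x^a: x^a x^b =
  \<open>bichar n p b a\<close> x^b x^a.\<close>

definition bichar :: "nat \<Rightarrow> (nat \<Rightarrow> nat \<Rightarrow> 'k::field) \<Rightarrow> (nat \<Rightarrow>\<^sub>0 nat) \<Rightarrow> (nat \<Rightarrow>\<^sub>0 nat) \<Rightarrow> 'k" where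
  "bichar n p b a = (\<Prod>i\<in>{1..n}. \<Prod>s\<in>{1..n}. p i s ^ (lk b i * lk a s))"

lemma bichar_add_left: "bichar n p (b + b') a = bichar n p b a * bichar n p b' a"
  by (simp add: bichar_def lookup_add algebra_simps power_add prod.distrib)

lemma bichar_add_right: "bichar n p b (a + a') = bichar n p b a * bichar n p b a'"
  by (simp add: bichar_def lookup_add algebra_simps power_add prod.distrib)

lemma bichar_0 [simp]: "bichar n p 0 a = 1" "bichar n p b 0 = 1"
  by (simp_all add: bichar_def)

lemma bichar_sc_left: "bichar n p (sc k b) a = bichar n p b a ^ k"
  by (simp add: bichar_def prod_power_distrib power_mult[symmetric] mult_ac)

lemma bichar_sc_right: "bichar n p b (sc k a) = bichar n p b a ^ k"
  by (simp add: bichar_def prod_power_distrib power_mult[symmetric] mult_ac)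

text \<open>The diagonal operator with eigenvalue \<chi>(a) on the monomial x^a.\<close>

definition twist :: "('a \<Rightarrow> 'k) \<Rightarrow> ('a \<Rightarrow>\<^sub>0 'k::field) \<Rightarrow> ('a \<Rightarrow>\<^sub>0 'k)" where
  "twist \<chi> F = Poly_Mapping.mapp (\<lambda>a x. \<chi> a * x) F"

lemma lk_twist: "lk (twist \<chi> F) a = \<chi> a * lk F a"
  by (simp add: twist_def lookup_mapp when_def in_keys_iff)

lemma ks_twist: "ks (twist \<chi> F) \<subseteq> ks F"
  by (auto simp: in_keys_iff lk_twist)

lemma twist_add: "twist \<chi> (F + G) = twist \<chi> F + twist \<chi> G"
  by (rule poly_mapping_eqI) (simp add: lk_twist lookup_add algebra_simps)

lemma twist_single: "twist \<chi> (sg a x) = sg a (\<chi> a * x)"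
  by (rule poly_mapping_eqI) (simp add: lk_twist lookup_single when_def)

lemma twist_zero [simp]: "twist \<chi> 0 = 0"
  by (rule poly_mapping_eqI) (simp add: lk_twist)

context skew_ring
begin

abbreviation "\<beta> \<equiv> bichar n p"

lemma \<beta>_nz: "\<beta> b a \<noteq> 0"
  by (simp add: bichar_def p_nz)

lemma coc_nz: "coc a b \<noteq> 0"
  by (auto simp: cocyc_def p_nz)

lemma \<beta>_ev: "i \<in> {1..n} \<Longrightarrow> s \<in> {1..n} \<Longrightarrow> \<beta> (ev i) (ev s) = p i s"
proof -
  assume i: "i \<in> {1..n}" and s: "s \<in> {1..n}"
  have "\<beta> (ev i) (ev s) = (\<Prod>i'\<in>{1..n}. if i' = i then (\<Prod>s'\<in>{1..n}. if s' = s then p i s else 1) else 1)"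
    unfolding bichar_def
  proof (rule prod.cong[OF refl])
    fix i' assume "i' \<in> {1..n}"
    have "p i s' ^ lk (ev s) s' = (if s' = s then p i s else 1)" for s'
      by (simp add: lookup_single when_def)
    then show "(\<Prod>s'\<in>{1..n}. p i' s' ^ (lk (ev i) i' * lk (ev s) s'))
        = (if i' = i then (\<Prod>s'\<in>{1..n}. if s' = s then p i s else 1) else 1)"
      by (cases "i' = i") (simp_all add: lookup_single)
  qed
  then show ?thesis using i s by (simp add: prod.delta)
qed

text \<open>Both sides are multiplicative in each argument, so two inductions reduce the claim to a
  pair of generators.\<close>

lemma coc_swap: "a \<in> E \<Longrightarrow> b \<in> E \<Longrightarrow> coc a b = \<beta> b a * coc b a"
proof (induction a rule: expo_induct)
  case (add a j)
  have "coc (ev j) b = \<beta> b (ev j) * coc b (ev j)" using \<open>b \<in> E\<close>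
  proof (induction b rule: expo_induct)
    case (add b i)
    then show ?case using coc_swap_ev[of i j] \<beta>_ev[of i j] \<open>j \<in> {1..n}\<close>
      by (simp add: cocyc_add_left cocyc_add_right bichar_add_left)
  qed simp
  then show ?case using add by (simp add: cocyc_add_left cocyc_add_right bichar_add_right)
qed simp

lemma \<beta>_swap: "a \<in> E \<Longrightarrow> b \<in> E \<Longrightarrow> \<beta> b a * \<beta> a b = 1"
  using coc_swap[of a b] coc_swap[of b a] coc_nz[of a b] by (metis mult.assoc mult_cancel_right1)

section \<open>Central exponents and the center\<close>

definition "Ds = {a \<in> E. \<forall>b\<in>E. \<beta> b a = 1}"

lemma Ds_E: "a \<in> Ds \<Longrightarrow> a \<in> E" by (simp add: Ds_def)
lemma Ds_0 [simp]: "0 \<in> Ds" by (simp add: Ds_def)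
lemma Ds_add: "a \<in> Ds \<Longrightarrow> b \<in> Ds \<Longrightarrow> a + b \<in> Ds"
  by (auto simp: Ds_def bichar_add_right)
text \<open>The values of a character form a group, so a difference of central exponents that is
  still an exponent is central. Divisions with remainder below rest on this.\<close>

lemma Ds_cancel: "a + b \<in> Ds \<Longrightarrow> a \<in> Ds \<Longrightarrow> b \<in> Ds"
  by (auto simp: Ds_def bichar_add_right expo_add_iff)
lemma Ds_sc: "a \<in> Ds \<Longrightarrow> sc k a \<in> Ds"
  by (auto simp: Ds_def bichar_sc_right)
lemma Ds_left: "a \<in> Ds \<Longrightarrow> b \<in> E \<Longrightarrow> \<beta> a b = 1"
  using \<beta>_swap[of a b] by (auto simp: Ds_def)
lemma Ds_iff_left: "a \<in> E \<Longrightarrow> a \<in> Ds \<longleftrightarrow> (\<forall>b\<in>E. \<beta> a b = 1)"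
  using \<beta>_swap[of a] Ds_left[of a] by (auto simp: Ds_def)
lemma Ds_iff_ev: "a \<in> E \<Longrightarrow> a \<in> Ds \<longleftrightarrow> (\<forall>i\<in>{1..n}. \<beta> (ev i) a = 1)"
proof
  assume a: "a \<in> E" and ev: "\<forall>i\<in>{1..n}. \<beta> (ev i) a = 1"
  have "\<beta> b a = 1" if "b \<in> E" for b
    using that by (induction rule: expo_induct) (simp_all add: bichar_add_left ev)
  then show "a \<in> Ds" using a by (simp add: Ds_def)
qed (auto simp: Ds_def)

lemma coc_Ds: "a \<in> Ds \<Longrightarrow> b \<in> E \<Longrightarrow> coc a b = coc b a"
  using coc_swap[of a b] by (auto simp: Ds_def)

lemma mono_closed: "a \<in> E \<Longrightarrow> mono a \<in> carrier S" by (rule cl_closed) simp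
lemma nf_mono: "a \<in> E \<Longrightarrow> nff (mono a) = sg a 1" by (rule nf_cl) simp
lemma var_pow_eq: "i \<in> {1..n} \<Longrightarrow> skew_var n p i [^]\<^bsub>S\<^esub> k = mono (sg i k)"
  by (rule nf_inj) (auto simp: var_closed nf_var_pow mono_closed nf_mono expo_single)
lemma monom_eq: "skew_monom n p d = mono (rst {1..n} d)"
  by (rule nf_inj) (auto simp: monom_closed nf_monom mono_closed nf_mono rst_expo)

text \<open>Comparing the coefficients of s x_i and x_i s at each shifted exponent shows that every
  single monomial of a central element commutes with every x_i.\<close>

lemma center_eq: "skew_center n p = {s \<in> carrier S. ks (nff s) \<subseteq> Ds}"
proof (intro subset_antisym subsetI)
  fix s assume "s \<in> skew_center n p"
  then have s: "s \<in> carrier S" and c: "\<And>t. t \<in> carrier S \<Longrightarrow> s \<cdot> t = t \<cdot> s"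
    unfolding skew_center_def ring_center_def by auto
  have "a \<in> Ds" if a: "a \<in> ks (nff s)" for a
  proof -
    have aE: "a \<in> E" using a nf_closed[OF s] by auto
    have "\<beta> (ev i) a = 1" if i: "i \<in> {1..n}" for i
    proof -
      have iE: "ev i \<in> E" using i by auto
      have "nff s \<star> sg (ev i) 1 = sg (ev i) 1 \<star> nff s"
        using c[OF mono_closed[OF iE]] s iE by (metis nf_mult nf_mono mono_closed)
      then have "coc a (ev i) * lk (nff s) a * 1 = coc (ev i) a * 1 * lk (nff s) a"
        using lk_tmul_single_right[of n p "nff s" "ev i" 1 a] lk_tmul_single_left[of n p "ev i" 1 "nff s" a]
        by (simp add: add.commute)
      then show ?thesis using a coc_swap[OF aE iE] coc_nz[of "ev i" a] by (simp add: in_keys_iff)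
    qed
    then show ?thesis using Ds_iff_ev[OF aE] by blast
  qed
  then show "s \<in> {s \<in> carrier S. ks (nff s) \<subseteq> Ds}" using s by blast
next
  fix s assume s: "s \<in> {s \<in> carrier S. ks (nff s) \<subseteq> Ds}"
  have "F \<star> G = G \<star> F" if "ks F \<subseteq> Ds" "ks G \<subseteq> E" for F G
    using that(1)
  proof (induction rule: pm_induct)
    case (single a x)
    show ?case using that(2)
    proof (induction rule: pm_induct)
      case (single b y)
      then show ?case using coc_Ds[OF \<open>a \<in> Ds\<close> single] by (simp add: tmul_single add.commute mult_ac)
    qed (simp_all add: tmul_add_left tmul_add_right)
  qed (simp_all add: tmul_add_left tmul_add_right)
  then have "s \<cdot> t = t \<cdot> s" if "t \<in> carrier S" for t
    using s that nf_closed[OF that] by (intro nf_inj) (auto simp: nf_mult)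
  then show "s \<in> skew_center n p" using s unfolding skew_center_def ring_center_def by blast
qed

lemma mono_center_iff: "a \<in> E \<Longrightarrow> mono a \<in> skew_center n p \<longleftrightarrow> a \<in> Ds"
  by (simp add: center_eq mono_closed nf_mono)

section \<open>The diagonal automorphisms given by the bicharacter\<close>

definition sig :: "(nat \<Rightarrow>\<^sub>0 nat) \<Rightarrow> (nat free_mon \<Rightarrow>\<^sub>0 'k) set \<Rightarrow> (nat free_mon \<Rightarrow>\<^sub>0 'k) set" where
  "sig b = (\<lambda>s\<in>carrier S. cl (twist (\<beta> b) (nff s)))"

lemma sig_closed: "s \<in> carrier S \<Longrightarrow> sig b s \<in> carrier S"
  unfolding sig_def using cl_closed order_trans[OF ks_twist nf_closed] by simp
lemma nf_sig: "s \<in> carrier S \<Longrightarrow> nff (sig b s) = twist (\<beta> b) (nff s)"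
  unfolding sig_def using nf_cl order_trans[OF ks_twist nf_closed] by simp
lemma sig_sig: "s \<in> carrier S \<Longrightarrow> sig b (sig b' s) = sig (b + b') s"
  by (rule nf_inj) (auto simp: sig_closed nf_sig lk_twist bichar_add_left intro!: poly_mapping_eqI)
lemma sig_0: "s \<in> carrier S \<Longrightarrow> sig 0 s = s"
  by (rule nf_inj) (auto simp: sig_closed nf_sig lk_twist intro!: poly_mapping_eqI)

lemma sig_cong: "(\<And>a. a \<in> E \<Longrightarrow> \<beta> b a = \<beta> b' a) \<Longrightarrow> sig b = sig b'"
proof -
  assume h: "\<And>a. a \<in> E \<Longrightarrow> \<beta> b a = \<beta> b' a"
  have "twist (\<beta> b) (nff s) = twist (\<beta> b') (nff s)" if "s \<in> carrier S" for s
    using h nf_closed[OF that] by (intro poly_mapping_eqI) (auto simp: lk_twist in_keys_iff subset_iff)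
  then show ?thesis unfolding sig_def by (intro restrict_ext) simp
qed

lemma sig_mono: "a \<in> E \<Longrightarrow> nff (sig b (mono a)) = sg a (\<beta> b a)"
  by (simp add: nf_sig mono_closed nf_mono twist_single)

lemma sig_eq_iff: "sig b = sig b' \<longleftrightarrow> (\<forall>a\<in>E. \<beta> b a = \<beta> b' a)"
proof
  assume "sig b = sig b'"
  then show "\<forall>a\<in>E. \<beta> b a = \<beta> b' a" using sig_mono by (metis lookup_single_eq)
qed (auto intro: sig_cong)

lemma twist_mult: "ks F \<subseteq> E \<Longrightarrow> ks G \<subseteq> E \<Longrightarrow> twist (\<beta> b) (F \<star> G) = twist (\<beta> b) F \<star> twist (\<beta> b) G"
proof (induction rule: pm_induct)
  case (single a x)
  from \<open>ks G \<subseteq> E\<close> show ?case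
    by (induction rule: pm_induct)
      (simp_all add: tmul_single twist_single bichar_add_right mult_ac tmul_add_left tmul_add_right twist_add)
qed (simp_all add: tmul_add_left tmul_add_right twist_add)

lemma const_eq: "skew_const n p c = cl (sg 0 c)"
  by (rule nf_inj) (auto simp: const_closed nf_const cl_closed nf_cl split: if_splits)

abbreviation "Perm \<equiv> skew_perms n p"
abbreviation "OG \<equiv> ozone_group n p"

lemma sig_mult_restr: "compose (carrier S) (sig b) (sig b') = sig (b + b')"
  by (rule extensionalityI[of _ "carrier S"]) (auto simp: compose_def sig_sig, simp add: sig_def)

text \<open>The equation x_i g = f x_i is solved coefficient by coefficient at the exponents
  divisible by x_i; the solution is unique because the cocycle has no zeros, which makes the
  definite description meaningful.\<close>

lemma ozone_conj_eq: "i \<in> {1..n} \<Longrightarrow> ozone_conj n p i = sig (ev i)"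
proof -
  assume i: "i \<in> {1..n}"
  have iE: "ev i \<in> E" using i by auto
  have "(THE g. g \<in> carrier S \<and> skew_var n p i \<cdot> g = f \<cdot> skew_var n p i) = sig (ev i) f"
    if f: "f \<in> carrier S" for f
  proof -
    have iff: "skew_var n p i \<cdot> g = f \<cdot> skew_var n p i \<longleftrightarrow> g = sig (ev i) f" if g: "g \<in> carrier S" for g
    proof -
      have l: "lk (sg (ev i) 1 \<star> nff g) (ev i + a) = coc (ev i) a * lk (nff g) a" for a
        using lk_tmul_single_left[of n p "ev i" 1 "nff g" a] by simp
      \<comment> \<open>The swap formula is available only for \<open>a\<close> in \<open>E\<close>;
        elsewhere the coefficient of \<open>f\<close> vanishes.\<close>
      have r: "lk (nff f \<star> sg (ev i) 1) (ev i + a) = coc (ev i) a * (\<beta> (ev i) a * lk (nff f) a)" for a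
      proof (cases "a \<in> E")
        case True
        then show ?thesis
          using lk_tmul_single_right[of n p "nff f" "ev i" 1 a] coc_swap[OF True iE] by (simp add: add.commute)
      next
        case False
        then have "lk (nff f) a = 0" using nf_closed[OF f] by (auto simp: in_keys_iff)
        then show ?thesis
          using lk_tmul_single_right[of n p "nff f" "ev i" 1 a] by (simp add: add.commute)
      qed
      \<comment> \<open>An exponent not divisible by x_i occurs in neither product.\<close>
      have o: "lk (sg (ev i) 1 \<star> nff g) c = lk (nff f \<star> sg (ev i) 1) c" if "\<nexists>a. c = ev i + a" for c
      proof -
        have "c \<notin> ks (sg (ev i) 1 \<star> nff g)" "c \<notin> ks (nff f \<star> sg (ev i) 1)"
          using that ks_tmul[of n p "sg (ev i) 1" "nff g"] ks_tmul[of n p "nff f" "sg (ev i) 1"]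
          by (auto simp: add.commute)
        then show ?thesis by (simp add: in_keys_iff)
      qed
      have "skew_var n p i \<cdot> g = f \<cdot> skew_var n p i \<longleftrightarrow> sg (ev i) 1 \<star> nff g = nff f \<star> sg (ev i) 1"
        using nf_inj[of "skew_var n p i \<cdot> g" "f \<cdot> skew_var n p i"] i f g
        by (auto simp: nf_mult var_closed nf_var) (metis nf_mult nf_var var_closed i)
      also have "\<dots> \<longleftrightarrow> (\<forall>a. lk (nff g) a = \<beta> (ev i) a * lk (nff f) a)"
      proof
        assume eq: "sg (ev i) 1 \<star> nff g = nff f \<star> sg (ev i) 1"
        show "\<forall>a. lk (nff g) a = \<beta> (ev i) a * lk (nff f) a"
        proof
          fix a show "lk (nff g) a = \<beta> (ev i) a * lk (nff f) a"
            using l[of a] r[of a] coc_nz[of "ev i" a] by (simp add: eq)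
        qed
      next
        assume eq: "\<forall>a. lk (nff g) a = \<beta> (ev i) a * lk (nff f) a"
        show "sg (ev i) 1 \<star> nff g = nff f \<star> sg (ev i) 1"
        proof (rule poly_mapping_eqI)
          fix c show "lk (sg (ev i) 1 \<star> nff g) c = lk (nff f \<star> sg (ev i) 1) c"
            using o[of c] l r eq by (cases "\<exists>a. c = ev i + a") auto
        qed
      qed
      also have "\<dots> \<longleftrightarrow> nff g = nff (sig (ev i) f)"
        by (simp add: poly_mapping_eq_iff fun_eq_iff nf_sig f lk_twist)
      also have "\<dots> \<longleftrightarrow> g = sig (ev i) f"
        using nf_inj[OF g sig_closed[OF f]] by auto
      finally show ?thesis .
    qed
    show ?thesis
      by (rule the_equality) (use iff sig_closed[OF f] in blast)+
  qed
  then show ?thesis unfolding ozone_conj_def sig_def by (auto simp: restrict_def fun_eq_iff)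
qed

end

text \<open>\<open>l\<close> is a common exponent of all p_ij, so the (l - 1)-st power of a
  character \<beta>(b, -) is its inverse and inverses keep nonnegative exponents.\<close>

locale ozone = skew_ring n p for n and p :: "nat \<Rightarrow> nat \<Rightarrow> 'k::field" +
  fixes l :: nat
  assumes l_pos: "l > 0" and p_l: "\<And>i j. i \<in> {1..n} \<Longrightarrow> j \<in> {1..n} \<Longrightarrow> p i j ^ l = 1"
begin

lemma \<beta>_l: "\<beta> b a ^ l = 1"
proof -
  have "\<beta> b a ^ l = (\<Prod>i\<in>{1..n}. \<Prod>s\<in>{1..n}. (p i s ^ l) ^ (lk b i * lk a s))"
    by (simp add: bichar_def prod_power_distrib power_mult[symmetric] mult.commute)
  also have "\<dots> = 1" by (simp add: p_l)
  finally show ?thesis .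
qed

lemma sig_inverse: "s \<in> carrier S \<Longrightarrow> sig (sc (l - 1) b) (sig b s) = s"
  "s \<in> carrier S \<Longrightarrow> sig b (sig (sc (l - 1) b) s) = s"
proof -
  have "\<beta> (sc (l - 1) b + b) a = \<beta> 0 a" for a
    using \<beta>_l[of b a] l_pos
    by (metis One_nat_def Suc_pred bichar_0(1) bichar_add_left bichar_sc_left power_Suc2)
  then have "sig (sc (l - 1) b + b) = sig 0" by (intro sig_cong)
  then show "s \<in> carrier S \<Longrightarrow> sig (sc (l - 1) b) (sig b s) = s"
    "s \<in> carrier S \<Longrightarrow> sig b (sig (sc (l - 1) b) s) = s"
    by (simp_all add: sig_sig sig_0 add.commute)
qed

lemma sig_Bij: "sig b \<in> Bij (carrier S)"
proof -
  have "bij_betw (sig b) (carrier S) (carrier S)"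
    by (rule bij_betw_byWitness[where f' = "sig (sc (l - 1) b)"]) (auto simp: sig_inverse sig_closed)
  then show ?thesis by (simp add: Bij_def) (simp add: sig_def)
qed

lemma Perm_mult: "sig b \<otimes>\<^bsub>Perm\<^esub> sig b' = sig (b + b')"
  by (simp add: BijGroup_def sig_Bij sig_mult_restr)

lemma Perm_one: "\<one>\<^bsub>Perm\<^esub> = sig 0"
  by (rule extensionalityI[of _ "carrier S"]) (auto simp: BijGroup_def sig_0, simp add: sig_def)

lemma Perm_inv: "inv\<^bsub>Perm\<^esub> (sig b) = sig (sc (l - 1) b)"
proof -
  interpret P: group Perm by (rule group_BijGroup)
  have c: "sig b \<in> carrier Perm" for b by (simp add: BijGroup_def sig_Bij)
  have "sig (sc (l - 1) b) \<otimes>\<^bsub>Perm\<^esub> sig b = \<one>\<^bsub>Perm\<^esub>"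
    unfolding Perm_mult Perm_one
    by (rule extensionalityI[of _ "carrier S"])
      (auto simp: sig_sig[symmetric] sig_inverse sig_0, simp_all add: sig_def)
  then show ?thesis using P.inv_equality c by blast
qed

text \<open>The automorphisms \<open>sig b\<close> are closed under composition, which adds the
  exponents, and under inversion, which multiplies them by \<open>l - 1\<close>; conversely every
  \<open>b\<close> is a sum of unit vectors.\<close>

lemma OG_carrier: "carrier OG = sig ` E"
proof -
  have "carrier OG = generate Perm ((\<lambda>i. sig (ev i)) ` {1..n})"
    unfolding ozone_group_def using ozone_conj_eq by (auto intro!: arg_cong[where f = "generate Perm"])
  also have "\<dots> = sig ` E"
  proof (intro subset_antisym subsetI)
    fix x assume "x \<in> generate Perm ((\<lambda>i. sig (ev i)) ` {1..n})"
    then show "x \<in> sig ` E"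
    proof (induction rule: generate.induct)
      case one then show ?case unfolding Perm_one by auto
    next
      case (incl h) then show ?case by auto
    next
      case (inv h) then show ?case by (auto simp: Perm_inv intro!: sc_expo expo_single)
    next
      case (eng h1 h2) then show ?case using Perm_mult by auto
    qed
  next
    fix x assume "x \<in> sig ` E"
    then obtain b where b: "b \<in> E" "x = sig b" by auto
    from b(1) have "sig b \<in> generate Perm ((\<lambda>i. sig (ev i)) ` {1..n})"
    proof (induction rule: expo_induct)
      case zero then show ?case using generate.one[of Perm] by (simp add: Perm_one)
    next
      case (add a i)
      then show ?case unfolding Perm_mult[symmetric]
        by (intro generate.eng[OF generate.incl]) auto
    qed
    then show "x \<in> generate Perm ((\<lambda>i. sig (ev i)) ` {1..n})" using b by simp
  qed
  finally show ?thesis .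
qed

lemma OG_simps: "monoid.mult OG = monoid.mult Perm" "\<one>\<^bsub>OG\<^esub> = sig 0"
  by (simp_all add: ozone_group_def Perm_one)

lemma OG_mult: "sig b \<otimes>\<^bsub>OG\<^esub> sig b' = sig (b + b')"
  by (simp add: OG_simps Perm_mult)

lemma group_OG: "group OG"
proof (rule groupI)
  fix x assume "x \<in> carrier OG"
  then obtain b where b: "x = sig b" "b \<in> E" unfolding OG_carrier by blast
  have "sig (sc (l - 1) b) \<otimes>\<^bsub>OG\<^esub> sig b = \<one>\<^bsub>OG\<^esub>"
    using group.l_inv[OF group_BijGroup, of "sig b" "carrier S"] Perm_inv[of b] sig_Bij[of b]
    by (simp add: OG_simps Perm_one[symmetric]) (simp add: BijGroup_def)
  then show "\<exists>y\<in>carrier OG. y \<otimes>\<^bsub>OG\<^esub> x = \<one>\<^bsub>OG\<^esub>" using b unfolding OG_carrier by blast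
qed (auto simp: OG_carrier OG_mult OG_simps(2) add.assoc)

lemma graded_sig: "graded_automorphism n p (sig b)"
  unfolding graded_automorphism_def
proof (intro conjI allI)
  show "sig b \<in> Bij (carrier S)" by (rule sig_Bij)
  show "sig b \<in> ring_hom S S"
  proof (rule ring_hom_memI)
    fix x y assume xy: "x \<in> carrier S" "y \<in> carrier S"
    show "sig b (x \<cdot> y) = sig b x \<cdot> sig b y"
      by (rule nf_inj) (auto simp: xy sig_closed nf_sig nf_mult twist_mult nf_closed)
    show "sig b (x \<oplus>\<^bsub>S\<^esub> y) = sig b x \<oplus>\<^bsub>S\<^esub> sig b y"
      by (rule nf_inj) (auto simp: xy sig_closed nf_sig nf_add twist_add)
  next
    show "sig b \<one>\<^bsub>S\<^esub> = \<one>\<^bsub>S\<^esub>"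
      by (rule nf_inj) (auto simp: sig_closed nf_sig nf_one twist_single simp del: single_one)
  qed (rule sig_closed)
  fix c show "sig b (skew_const n p c) = skew_const n p c"
    by (rule nf_inj) (auto simp: sig_closed nf_sig nf_const twist_single const_closed)
  fix j
  \<comment> \<open>Proved for every exponent, so that it applies to the inverse as well and gives
    equality.\<close>
  have sub: "sig b ` skew_degree n p j \<subseteq> skew_degree n p j" for b
    using ks_twist by (fastforce simp: degree_eq sig_closed nf_sig)
  show "sig b ` skew_degree n p j = skew_degree n p j"
  proof
    show "skew_degree n p j \<subseteq> sig b ` skew_degree n p j"
    proof
      fix s assume s: "s \<in> skew_degree n p j"
      then have "s \<in> carrier S" by (simp add: degree_eq)
      then show "s \<in> sig b ` skew_degree n p j"
        using sub[of "sc (l - 1) b"] s sig_inverse(2)[of s b] by (metis image_eqI image_subset_iff)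
    qed
  qed (rule sub)
qed

end

section \<open>Counting the ozone group\<close>

lemma sg_sc: "sg i k = sc k (ev i)"
  by (rule poly_mapping_eqI) (simp add: lookup_single when_def)

context skew_ring
begin

definition md :: "(nat \<Rightarrow> nat) \<Rightarrow> (nat \<Rightarrow>\<^sub>0 nat) \<Rightarrow> (nat \<Rightarrow>\<^sub>0 nat)" where
  "md w a = rst {1..n} (\<lambda>i. lk a i mod w i)"

lemma lk_md: "i \<in> {1..n} \<Longrightarrow> lk (md w a) i = lk a i mod w i"
  by (simp add: md_def lk_rst)
lemma md_expo: "md w a \<in> E" by (simp add: md_def rst_expo)
lemma md_box: "(\<And>i. i \<in> {1..n} \<Longrightarrow> w i > 0) \<Longrightarrow> md w a \<in> box n w"
  by (simp add: box_def md_expo lk_md)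

lemma md_split: "a \<in> E \<Longrightarrow> \<exists>d\<in>E. a = md w a + d \<and> (\<forall>i\<in>{1..n}. w i dvd lk d i)"
proof
  assume a: "a \<in> E"
  let ?d = "rst {1..n} (\<lambda>i. lk a i - lk a i mod w i)"
  show "?d \<in> E" by (rule rst_expo)
  have "a = md w a + ?d"
    by (rule poly_mapping_eqI) (use a in \<open>auto simp: lookup_add md_def lk_rst expo_def in_keys_iff\<close>)
  then show "a = md w a + ?d \<and> (\<forall>i\<in>{1..n}. w i dvd lk ?d i)"
    by (simp add: lk_rst dvd_minus_mod)
qed

lemma Ds_sum: "finite A \<Longrightarrow> (\<And>i. i \<in> A \<Longrightarrow> f i \<in> Ds) \<Longrightarrow> sum f A \<in> Ds"
  by (induction A rule: finite_induct) (auto intro: Ds_add)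

lemma sig_add_Ds: "d \<in> Ds \<Longrightarrow> sig (b + d) = sig b"
  by (rule sig_cong) (simp add: bichar_add_left Ds_left)

lemma nf_minus: "s \<in> carrier S \<Longrightarrow> nff (\<ominus>\<^bsub>S\<^esub> s) = - nff s"
proof -
  assume s: "s \<in> carrier S"
  have "nff (\<ominus>\<^bsub>S\<^esub> s) + nff s = 0"
    using nf_add[of "\<ominus>\<^bsub>S\<^esub> s" s] s by (simp add: S.l_neg nf_zero)
  then show ?thesis by (simp add: eq_neg_iff_add_eq_0)
qed

lemma cl_add: "ks F \<subseteq> E \<Longrightarrow> ks G \<subseteq> E \<Longrightarrow> cl (F + G) = cl F \<oplus>\<^bsub>S\<^esub> cl G"
proof -
  assume h: "ks F \<subseteq> E" "ks G \<subseteq> E"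
  then have "ks (F + G) \<subseteq> E" using Poly_Mapping.keys_add[of F G] by blast
  then show ?thesis using h by (intro nf_inj) (simp_all add: cl_closed nf_add nf_cl)
qed

lemma cl_zero: "cl 0 = \<zero>\<^bsub>S\<^esub>"
  by (rule nf_inj) (auto simp: cl_closed nf_cl nf_zero)

lemma cl_single: "a \<in> E \<Longrightarrow> cl (sg a x) = skew_const n p x \<cdot> mono a"
  by (rule nf_inj) (auto simp: cl_closed nf_cl const_closed nf_mult nf_const tmul_single split: if_splits)

text \<open>The generators are monomials, so the subalgebra is spanned by the monomials it contains.
  Conversely such a monomial is the ordered product of powers of the generators.\<close>

lemma subalgebra_eq:
  "skew_subalgebra n p ((\<lambda>i. skew_var n p i [^]\<^bsub>S\<^esub> w i) ` {1..n}) =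
    {s \<in> carrier S. \<forall>a\<in>ks (nff s). \<forall>i\<in>{1..n}. w i dvd lk a i}" (is "?L = ?R")
proof (intro subset_antisym subsetI)
  fix s assume "s \<in> ?L"
  then have "s \<in> generate_ring S (range (skew_const n p) \<union> (\<lambda>i. skew_var n p i [^]\<^bsub>S\<^esub> w i) ` {1..n})"
    by (simp add: skew_subalgebra_def)
  then show "s \<in> ?R"
  proof (induction rule: generate_ring.induct)
    case one then show ?case by (auto simp: nf_one)
  next
    case (incl h)
    then show ?case
      by (auto simp: const_closed nf_const var_closed nf_var_pow lookup_single when_def split: if_splits)
  next
    case (a_inv h) then show ?case by (auto simp: nf_minus)
  next
    case (eng_add h1 h2)
    then show ?case using Poly_Mapping.keys_add[of "nff h1" "nff h2"] by (auto simp: nf_add)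
  next
    case (eng_mult h1 h2)
    have "\<forall>i\<in>{1..n}. w i dvd lk a i" if a: "a \<in> ks (nff h1 \<star> nff h2)" for a
    proof -
      obtain b c where "a = b + c" "b \<in> ks (nff h1)" "c \<in> ks (nff h2)"
        using a ks_tmul[of n p "nff h1" "nff h2"] by blast
      then show ?thesis using eng_mult by (auto simp: lookup_add)
    qed
    then show ?case using eng_mult by (auto simp: nf_mult)
  qed
next
  let ?G = "generate_ring S (range (skew_const n p) \<union> (\<lambda>i. skew_var n p i [^]\<^bsub>S\<^esub> w i) ` {1..n})"
  fix s assume s: "s \<in> ?R"
  have pow: "skew_var n p i [^]\<^bsub>S\<^esub> (w i * k) \<in> ?G" if i: "i \<in> {1..n}" for i k
  proof (induction k)
    case 0 then show ?case using generate_ring.one by simp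
  next
    case (Suc k)
    have e: "skew_var n p i [^]\<^bsub>S\<^esub> (w i * Suc k) = skew_var n p i [^]\<^bsub>S\<^esub> w i \<cdot> skew_var n p i [^]\<^bsub>S\<^esub> (w i * k)"
      using S.nat_pow_mult[OF var_closed[OF i], of "w i" "w i * k"] by simp
    have "skew_var n p i [^]\<^bsub>S\<^esub> w i \<in> ?G" by (rule generate_ring.incl) (use i in blast)
    then show ?case unfolding e using Suc by (rule generate_ring.eng_mult)
  qed
  have mon: "mono a \<in> ?G" if a: "a \<in> E" "\<forall>i\<in>{1..n}. w i dvd lk a i" for a
  proof -
    have "foldr (\<lambda>i s. (skew_var n p i [^]\<^bsub>S\<^esub> lk a i) \<cdot> s) xs \<one>\<^bsub>S\<^esub> \<in> ?G"
      if "set xs \<subseteq> {1..n}" for xs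
      using that
    proof (induction xs)
      case Nil then show ?case using generate_ring.one by simp
    next
      case (Cons i xs)
      then have "w i dvd lk a i" using a by auto
      then obtain k where k: "lk a i = w i * k" by (rule dvdE)
      have "foldr (\<lambda>i s. (skew_var n p i [^]\<^bsub>S\<^esub> lk a i) \<cdot> s) xs \<one>\<^bsub>S\<^esub> \<in> ?G"
        using Cons by simp
      then show ?case using generate_ring.eng_mult[OF pow[of i k]] Cons.prems k by simp
    qed
    from this[of "[1..<Suc n]"] have "skew_monom n p (lk a) \<in> ?G"
      unfolding skew_monom_def by (simp del: upt_Suc add: atLeastLessThanSuc_atLeastAtMost)
    then show ?thesis using a by (simp add: monom_eq rst_lk)
  qed
  have "ks (nff s) \<subseteq> {a \<in> E. \<forall>i\<in>{1..n}. w i dvd lk a i}" using s nf_closed by auto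
  then have "cl (nff s) \<in> ?G"
  proof (induction rule: pm_induct)
    case zero
    \<comment> \<open>The introduction rules of \<open>generate_ring\<close> produce no zero
      directly; it is obtained as 1 - 1.\<close>
    have "\<one>\<^bsub>S\<^esub> \<oplus>\<^bsub>S\<^esub> \<ominus>\<^bsub>S\<^esub> \<one>\<^bsub>S\<^esub> \<in> ?G"
      by (intro generate_ring.eng_add generate_ring.one generate_ring.a_inv)
    then show ?case by (simp add: cl_zero S.r_neg)
  next
    case (single a x)
    then have aE: "a \<in> E" and m: "mono a \<in> ?G" using mon[of a] by simp_all
    have "skew_const n p x \<in> ?G" by (rule generate_ring.incl) simp
    then show ?case unfolding cl_single[OF aE, of x] using m by (rule generate_ring.eng_mult)
  next
    case (add F G)
    then have e: "cl (F + G) = cl F \<oplus>\<^bsub>S\<^esub> cl G" by (intro cl_add) auto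
    show ?case unfolding e using add(3,4) by (rule generate_ring.eng_add)
  qed
  then show "s \<in> ?L" using s by (simp add: cl_nf skew_subalgebra_def)
qed

text \<open>Both sides are spanned by monomials, so equality is a statement about exponents.\<close>

lemma center_eq_subalgebra_iff:
  "skew_center n p = skew_subalgebra n p ((\<lambda>i. skew_var n p i [^]\<^bsub>S\<^esub> w i) ` {1..n})
    \<longleftrightarrow> (\<forall>a\<in>E. a \<in> Ds \<longleftrightarrow> (\<forall>i\<in>{1..n}. w i dvd lk a i))"
proof
  assume e: "skew_center n p = skew_subalgebra n p ((\<lambda>i. skew_var n p i [^]\<^bsub>S\<^esub> w i) ` {1..n})"
  show "\<forall>a\<in>E. a \<in> Ds \<longleftrightarrow> (\<forall>i\<in>{1..n}. w i dvd lk a i)"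
  proof
    fix a assume a: "a \<in> E"
    have "mono a \<in> skew_center n p \<longleftrightarrow> (\<forall>i\<in>{1..n}. w i dvd lk a i)"
      unfolding e subalgebra_eq using a by (simp add: mono_closed nf_mono)
    then show "a \<in> Ds \<longleftrightarrow> (\<forall>i\<in>{1..n}. w i dvd lk a i)" using a by (simp add: mono_center_iff)
  qed
next
  assume h: "\<forall>a\<in>E. a \<in> Ds \<longleftrightarrow> (\<forall>i\<in>{1..n}. w i dvd lk a i)"
  show "skew_center n p = skew_subalgebra n p ((\<lambda>i. skew_var n p i [^]\<^bsub>S\<^esub> w i) ` {1..n})"
    unfolding center_eq subalgebra_eq
  proof (intro Collect_cong conj_cong refl)
    fix s assume s: "s \<in> carrier S"
    show "ks (nff s) \<subseteq> Ds \<longleftrightarrow> (\<forall>a\<in>ks (nff s). \<forall>i\<in>{1..n}. w i dvd lk a i)"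
      using h nf_closed[OF s] unfolding subset_iff by meson
  qed
qed

end

context ozone
begin

section \<open>Orders of the generators, gcds of central exponents, and regularity\<close>

lemma l_Ds: "i \<in> {1..n} \<Longrightarrow> sg i l \<in> Ds"
  unfolding sg_sc[of i l] by (auto simp: Ds_def bichar_sc_right \<beta>_l intro!: sc_expo expo_single)

text \<open>The order of \<open>\<phi>\<^sub>i\<close>: by antisymmetry of the bicharacter, \<open>\<phi>\<^sub>i\<^sup>k = 1\<close> iff \<open>x\<^sub>i\<^sup>k\<close> is central.\<close>

definition wi :: "nat \<Rightarrow> nat" where
  "wi i = (LEAST k. k > 0 \<and> sg i k \<in> Ds)"

lemma wi: "i \<in> {1..n} \<Longrightarrow> wi i > 0 \<and> sg i (wi i) \<in> Ds"
  unfolding wi_def by (rule LeastI[of _ l]) (use l_Ds l_pos in auto)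

text \<open>The remainder of \<open>k\<close> modulo \<open>wi i\<close> is again the exponent of a
  central power by cancellation, so minimality forces it to be 0.\<close>

lemma wi_dvd_iff: "i \<in> {1..n} \<Longrightarrow> sg i k \<in> Ds \<longleftrightarrow> wi i dvd k"
proof
  assume i: "i \<in> {1..n}" and k: "sg i k \<in> Ds"
  have "sg i k = sc (k div wi i) (sg i (wi i)) + sg i (k mod wi i)"
    by (rule poly_mapping_eqI) (simp add: lookup_single lookup_add when_def)
  then have r: "sg i (k mod wi i) \<in> Ds" using Ds_cancel Ds_sc wi[OF i] k by metis
  have "\<not> (k mod wi i > 0)"
  proof
    assume "k mod wi i > 0"
    then have "wi i \<le> k mod wi i" unfolding wi_def[of i] using r unfolding wi_def by (intro Least_le) simp
    then show False using wi[OF i] by (meson mod_less_divisor not_le)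
  qed
  then show "wi i dvd k" by auto
next
  assume i: "i \<in> {1..n}" and "wi i dvd k"
  then obtain q where q: "k = wi i * q" by auto
  have "sg i k = sc q (sg i (wi i))"
    by (rule poly_mapping_eqI) (simp add: q lookup_single when_def)
  then show "sg i k \<in> Ds" using wi[OF i] Ds_sc by simp
qed

abbreviation "fi \<equiv> ozone_exp n p"

lemma fi_eq: "i \<in> {1..n} \<Longrightarrow> fi i = Gcd ((\<lambda>a. lk a i) ` Ds)"
proof -
  assume i: "i \<in> {1..n}"
  have "{d i | d. skew_monom n p d \<in> skew_center n p} = (\<lambda>a. lk a i) ` Ds"
  proof (intro subset_antisym subsetI)
    fix k assume "k \<in> {d i | d. skew_monom n p d \<in> skew_center n p}"
    then obtain d where "k = d i" "skew_monom n p d \<in> skew_center n p" by blast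
    then show "k \<in> (\<lambda>a. lk a i) ` Ds"
      using i by (intro image_eqI[of _ _ "rst {1..n} d"]) (auto simp: monom_eq mono_center_iff rst_expo lk_rst)
  next
    fix k assume "k \<in> (\<lambda>a. lk a i) ` Ds"
    then obtain a where a: "k = lk a i" "a \<in> Ds" by auto
    then have "skew_monom n p (lk a) \<in> skew_center n p"
      using Ds_E by (simp add: monom_eq rst_lk mono_center_iff)
    then show "k \<in> {d i | d. skew_monom n p d \<in> skew_center n p}" using a by blast
  qed
  then show ?thesis by (simp add: ozone_exp_def)
qed

lemma fi_dvd: "i \<in> {1..n} \<Longrightarrow> a \<in> Ds \<Longrightarrow> fi i dvd lk a i"
  by (auto simp: fi_eq)

lemma dvd_fi: "i \<in> {1..n} \<Longrightarrow> (\<And>a. a \<in> Ds \<Longrightarrow> k dvd lk a i) \<Longrightarrow> k dvd fi i"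
  by (auto simp: fi_eq intro!: Gcd_greatest)

lemma fi_dvd_wi: "i \<in> {1..n} \<Longrightarrow> fi i dvd wi i"
  using fi_dvd[of i "sg i (wi i)"] wi by simp

lemma fi_pos: "i \<in> {1..n} \<Longrightarrow> fi i > 0"
  using fi_dvd_wi[of i] wi[of i] by (auto intro: Nat.gr0I)

lemma wi_dvd_l: "i \<in> {1..n} \<Longrightarrow> wi i dvd l"
  using wi_dvd_iff l_Ds by blast

text \<open>All the conditions of the theorem are compared with this one.\<close>

definition "reg \<longleftrightarrow> (\<forall>a\<in>Ds. \<forall>i\<in>{1..n}. wi i dvd lk a i)"

text \<open>Since w_i e_i is a central exponent, f_i always divides w_i; regularity is the opposite
  divisibility.\<close>

lemma reg_iff_fi: "reg \<longleftrightarrow> (\<forall>i\<in>{1..n}. fi i = wi i)"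
proof
  assume reg
  then show "\<forall>i\<in>{1..n}. fi i = wi i"
    unfolding reg_def using dvd_fi fi_dvd_wi by (intro ballI dvd_antisym) auto
next
  assume "\<forall>i\<in>{1..n}. fi i = wi i"
  then show reg unfolding reg_def using fi_dvd by (metis)
qed

lemma reg_iff_dvd: "reg \<longleftrightarrow> (\<forall>i\<in>{1..n}. sg i (fi i) \<in> Ds)"
  unfolding reg_iff_fi using wi_dvd_iff fi_dvd_wi by (metis dvd_antisym dvd_refl)

text \<open>Such an exponent is the sum of its axis components, each of them central. Thus the
  product of the monoids w_i N always lies in \<open>Ds\<close>, and regularity is the reverse
  inclusion.\<close>

lemma dvd_Ds: "a \<in> E \<Longrightarrow> (\<And>i. i \<in> {1..n} \<Longrightarrow> wi i dvd lk a i) \<Longrightarrow> a \<in> Ds"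
proof -
  assume a: "a \<in> E" and h: "\<And>i. i \<in> {1..n} \<Longrightarrow> wi i dvd lk a i"
  have "sg i (lk a i) \<in> Ds" if "i \<in> ks a" for i
  proof -
    have "i \<in> {1..n}" using that a by (auto simp: expo_def)
    then show ?thesis using h wi_dvd_iff by blast
  qed
  then have "(\<Sum>i\<in>ks a. sg i (lk a i)) \<in> Ds" by (intro Ds_sum) auto
  then show ?thesis using pm_expand[of a] by simp
qed

lemma reg_Ds_iff: "reg \<Longrightarrow> a \<in> E \<Longrightarrow> a \<in> Ds \<longleftrightarrow> (\<forall>i\<in>{1..n}. wi i dvd lk a i)"
  using dvd_Ds unfolding reg_def by blast

text \<open>Here b + (l - 1) b' stands for b - b'.\<close>

lemma sig_eq_Ds: "b \<in> E \<Longrightarrow> b' \<in> E \<Longrightarrow> sig b = sig b' \<longleftrightarrow> b + sc (l - 1) b' \<in> Ds"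
proof -
  assume b: "b \<in> E" "b' \<in> E"
  have "\<beta> b a = \<beta> b' a \<longleftrightarrow> \<beta> (b + sc (l - 1) b') a = 1" for a
  proof -
    have e: "\<beta> b' a ^ (l - 1) * \<beta> b' a = 1"
      using \<beta>_l[of b' a] l_pos by (metis One_nat_def Suc_pred power_Suc2)
    have "\<beta> (b + sc (l - 1) b') a = \<beta> b a * \<beta> b' a ^ (l - 1)"
      by (simp add: bichar_add_left bichar_sc_left)
    then show ?thesis using e \<beta>_nz[of b' a]
      by (metis mult.commute mult.right_neutral mult_cancel_right power_not_zero)
  qed
  then show ?thesis using b by (simp add: sig_eq_iff Ds_iff_left expo_add sc_expo)
qed

lemma mod_eq_of_dvd_add: "k dvd x + (l - 1) * y \<Longrightarrow> k dvd l \<Longrightarrow> x mod k = (y::nat) mod k"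
proof -
  assume h: "k dvd x + (l - 1) * y" "k dvd l"
  have "x + l * y = (x + (l - 1) * y) + y" using l_pos by (cases l) auto
  then have "(x + l * y) mod k = y mod k" using h(1) by (metis mod_add_left_eq mod_0_imp_dvd dvd_imp_mod_0 add_0)
  moreover have "(x + l * y) mod k = x mod k"
    using h(2) by (metis add.right_neutral dvd_imp_mod_0 dvd_mult2 mod_add_right_eq)
  ultimately show ?thesis by simp
qed

text \<open>The difference of two exponents of the same automorphism is central, so f_i divides its
  entries; f_i also divides \<open>l\<close>, which turns l - 1 into -1. Residues modulo f_i are
  therefore invariants of the automorphism.\<close>

lemma sig_eq_mod: "b \<in> E \<Longrightarrow> b' \<in> E \<Longrightarrow> sig b = sig b' \<Longrightarrow> i \<in> {1..n} \<Longrightarrow> lk b i mod fi i = lk b' i mod fi i"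
  using fi_dvd[of i "b + sc (l - 1) b'"] sig_eq_Ds[of b b'] fi_dvd_wi[of i] wi_dvd_l[of i]
  by (intro mod_eq_of_dvd_add) (auto simp: lookup_add intro: dvd_trans)

text \<open>The discarded part has entries divisible by w_i, hence is central and acts trivially. So
  the box of \<open>wi\<close> exhausts \<open>O\<close>, giving the upper bound.\<close>

lemma sig_md: "b \<in> E \<Longrightarrow> sig (md wi b) = sig b"
  using md_split[of b wi] dvd_Ds sig_add_Ds by metis

lemma OG_box: "carrier OG = sig ` box n wi"
proof -
  have "sig b \<in> sig ` box n wi" if "b \<in> E" for b
    using sig_md[OF that] md_box[of wi b] wi by (metis imageI)
  then show ?thesis unfolding OG_carrier by (auto simp: box_def)
qed

lemma finite_OG: "finite (carrier OG)"
  unfolding OG_box using finite_box by blast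

lemma card_OG_le: "card (carrier OG) \<le> (\<Prod>i = 1..n. wi i)"
  unfolding OG_box card_box[symmetric] by (rule card_image_le[OF finite_box])

text \<open>Exponents in this box equal their own residues modulo f_i, and the automorphism
  remembers those; this gives the lower bound.\<close>

lemma inj_sig_fi: "inj_on sig (box n fi)"
proof (rule inj_onI)
  fix b b' assume b: "b \<in> box n fi" "b' \<in> box n fi" and e: "sig b = sig b'"
  then have E: "b \<in> E" "b' \<in> E" by (auto simp: box_def)
  have "lk b i = lk b' i" for i
  proof (cases "i \<in> {1..n}")
    case True
    then show ?thesis using sig_eq_mod[OF E e True] b by (simp add: box_def)
  next
    case False
    then show ?thesis using E expo_out by metis
  qed
  then show "b = b'" by (rule poly_mapping_eqI)
qed

lemma sig_box_sub: "sig ` box n w \<subseteq> carrier OG"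
  unfolding OG_carrier by (auto simp: box_def)

lemma card_OG_ge: "(\<Prod>i = 1..n. fi i) \<le> card (carrier OG)"
  using card_mono[OF finite_OG sig_box_sub[of fi]] card_image[OF inj_sig_fi] by (simp add: card_box)

lemma card_OG_reg: "reg \<Longrightarrow> card (carrier OG) = (\<Prod>i = 1..n. fi i) \<and> card (carrier OG) = (\<Prod>i = 1..n. wi i)"
proof -
  assume reg
  then have "(\<Prod>i = 1..n. fi i) = (\<Prod>i = 1..n. wi i)" by (simp add: reg_iff_fi)
  then show ?thesis using card_OG_le card_OG_ge by linarith
qed

lemma sig_eq_0: "b \<in> E \<Longrightarrow> sig b = sig 0 \<longleftrightarrow> b \<in> Ds"
  by (simp add: sig_eq_iff Ds_iff_left)

text \<open>If the lower bound is attained, the box of \<open>fi\<close> represents every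
  automorphism, in particular the f_i-th power of \<phi>_i. Its representative has all residues 0,
  so it is 0, and x_i^(f_i) is central.\<close>

lemma reg_iff_card_fi: "reg \<longleftrightarrow> card (carrier OG) = (\<Prod>i = 1..n. fi i)"
proof
  assume c: "card (carrier OG) = (\<Prod>i = 1..n. fi i)"
  have im: "sig ` box n fi = carrier OG"
    by (rule card_subset_eq[OF finite_OG sig_box_sub]) (simp add: c card_image[OF inj_sig_fi] card_box)
  have "sg i (fi i) \<in> Ds" if i: "i \<in> {1..n}" for i
  proof -
    have iE: "sg i (fi i) \<in> E" using i by auto
    then have "sig (sg i (fi i)) \<in> sig ` box n fi" unfolding im OG_carrier by blast
    then obtain b where b: "b \<in> box n fi" "sig (sg i (fi i)) = sig b" by blast
    then have bE: "b \<in> E" by (simp add: box_def)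
    have "lk b j = 0" for j
    proof (cases "j \<in> {1..n}")
      case True
      then show ?thesis using sig_eq_mod[OF iE bE b(2) True] b(1)
        by (auto simp: box_def lookup_single when_def split: if_splits)
    next
      case False
      then show ?thesis using bE expo_out by metis
    qed
    then have "b = 0" by (intro poly_mapping_eqI) simp
    then show ?thesis using b(2) sig_eq_0[OF iE] by simp
  qed
  then show reg unfolding reg_iff_dvd by blast
qed (use card_OG_reg in blast)

text \<open>If the upper bound is attained, distinct exponents in the box of \<open>wi\<close> act
  differently. The residue of a central exponent acts like 0, hence is 0.\<close>

lemma reg_iff_card_wi: "reg \<longleftrightarrow> card (carrier OG) = (\<Prod>i = 1..n. wi i)"
proof
  assume c: "card (carrier OG) = (\<Prod>i = 1..n. wi i)"
  have inj: "inj_on sig (box n wi)"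
    by (rule eq_card_imp_inj_on[OF finite_box]) (simp add: c OG_box[symmetric] card_box)
  show reg
    unfolding reg_def
  proof (intro ballI)
    fix a i assume a: "a \<in> Ds" and i: "i \<in> {1..n}"
    have "sig (md wi a) = sig 0" using sig_md[OF Ds_E[OF a]] sig_eq_0[OF Ds_E[OF a]] a by simp
    moreover have "md wi a \<in> box n wi" using md_box[of wi a] wi by blast
    moreover have "0 \<in> box n wi" using wi by (auto simp: box_def)
    ultimately have "md wi a = 0" using inj by (metis inj_onD)
    then have "lk a i mod wi i = 0" using lk_md[OF i, of wi a] by simp
    then show "wi i dvd lk a i" by auto
  qed
qed (use card_OG_reg in blast)

section \<open>The cyclic subgroups and their product\<close>

lemma cyclic_carrier: "s \<in> {1..n} \<Longrightarrow> carrier (ozone_cyclic n p s) = {sig (sg s k) | k. True}"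
proof -
  assume s: "s \<in> {1..n}"
  interpret G: group OG by (rule group_OG)
  have gE: "sig (sg s k) \<in> carrier OG" for k using s unfolding OG_carrier by (intro imageI expo_single)
  have "generate OG {sig (ev s)} = {sig (sg s k) | k. True}"
  proof (intro subset_antisym subsetI)
    fix x assume "x \<in> generate OG {sig (ev s)}"
    then show "x \<in> {sig (sg s k) | k. True}"
    proof (induction rule: generate.induct)
      case one then show ?case unfolding OG_simps by (auto intro: exI[of _ 0])
    next
      case (incl h) then show ?case by auto
    next
      case (inv h)
      have "sig (sg s (l - 1)) \<otimes>\<^bsub>OG\<^esub> sig (ev s) = \<one>\<^bsub>OG\<^esub>"
      proof -
        have e: "sg s (l - 1) + ev s = 0 + sg s l"
          using l_pos by (intro poly_mapping_eqI) (simp add: lookup_add lookup_single when_def)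
        show ?thesis unfolding OG_mult OG_simps(2) e by (rule sig_add_Ds[OF l_Ds[OF s]])
      qed
      then have "inv\<^bsub>OG\<^esub> h = sig (sg s (l - 1))" using inv gE G.inv_equality by auto
      then show ?case by auto
    next
      case (eng h1 h2) then show ?case by (auto simp: OG_mult single_add[symmetric])
    qed
  next
    fix x assume "x \<in> {sig (sg s k) | k. True}"
    then obtain k where k: "x = sig (sg s k)" by auto
    have "sig (sg s k) \<in> generate OG {sig (ev s)}"
    proof (induction k)
      case 0 then show ?case using generate.one[of OG] by (simp add: OG_simps)
    next
      case (Suc k)
      have "sg s (Suc k) = ev s + sg s k"
        by (rule poly_mapping_eqI) (simp add: lookup_add lookup_single when_def)
      then show ?case unfolding OG_mult[symmetric] using Suc
        by (auto simp: OG_mult[symmetric] intro!: generate.eng[OF generate.incl])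
    qed
    then show "x \<in> generate OG {sig (ev s)}" using k by simp
  qed
  then show ?thesis using s by (simp add: ozone_cyclic_def ozone_conj_eq)
qed

lemma sig_sg_eq_iff: "s \<in> {1..n} \<Longrightarrow> sig (sg s j) = sig (sg s k) \<longleftrightarrow> j mod wi s = k mod wi s"
proof
  assume s: "s \<in> {1..n}" and "sig (sg s j) = sig (sg s k)"
  then have "sg s j + sc (l - 1) (sg s k) \<in> Ds" using s by (subst sig_eq_Ds[symmetric]) auto
  also have "sg s j + sc (l - 1) (sg s k) = sg s (j + (l - 1) * k)"
    by (rule poly_mapping_eqI) (simp add: lookup_add lookup_single when_def)
  finally show "j mod wi s = k mod wi s"
    using wi_dvd_iff[OF s] wi_dvd_l[OF s] mod_eq_of_dvd_add by blast
next
  assume s: "s \<in> {1..n}" and e: "j mod wi s = k mod wi s"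
  have r: "sig (sg s j) = sig (sg s (j mod wi s))" for j
  proof -
    have "sg s j = sg s (j mod wi s) + sc (j div wi s) (sg s (wi s))"
      by (rule poly_mapping_eqI) (simp add: lookup_add lookup_single when_def)
    then show ?thesis using sig_add_Ds Ds_sc wi[OF s] by metis
  qed
  show "sig (sg s j) = sig (sg s k)" using r[of j] r[of k] e by simp
qed

lemma card_cyclic: "s \<in> {1..n} \<Longrightarrow> card (carrier (ozone_cyclic n p s)) = wi s"
proof -
  assume s: "s \<in> {1..n}"
  have "carrier (ozone_cyclic n p s) = (\<lambda>k. sig (sg s k)) ` {..<wi s}"
  proof -
    have "sig (sg s k) \<in> (\<lambda>k. sig (sg s k)) ` {..<wi s}" for k
      by (rule image_eqI[of _ _ "k mod wi s"]) (use wi[OF s] sig_sg_eq_iff[OF s] in auto)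
    then show ?thesis unfolding cyclic_carrier[OF s] by auto
  qed
  moreover have "inj_on (\<lambda>k. sig (sg s k)) {..<wi s}"
    using sig_sg_eq_iff[OF s] by (auto simp: inj_on_def)
  ultimately show ?thesis by (simp add: card_image)
qed

abbreviation "PG \<equiv> product_group {1..n} (ozone_cyclic n p)"

lemma card_PG: "card (carrier PG) = (\<Prod>i = 1..n. wi i)"
  by (simp add: card_PiE card_cyclic)

lemma cyclic_mult: "monoid.mult (ozone_cyclic n p s) = monoid.mult OG"
  by (simp add: ozone_cyclic_def)

text \<open>An abstract isomorphism already forces |O| to be the product of the w_i. Conversely,
  recording the powers of the \<phi>_s separately is well defined when f_s = w_s, because residues
  modulo f_s are invariants.\<close>

lemma reg_iff_product: "reg \<longleftrightarrow> OG \<cong> PG"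
proof
  assume "OG \<cong> PG"
  then obtain h where "bij_betw h (carrier OG) (carrier PG)" unfolding is_iso_def iso_def by blast
  then show reg using card_PG bij_betw_same_card reg_iff_card_wi by metis
next
  assume reg: reg
  \<comment> \<open>The exponent of an automorphism is only determined up to \<open>Ds\<close>, so
    one is chosen; the next claim shows independence of the choice.\<close>
  define h where "h = (\<lambda>\<sigma>. let b = (SOME b. b \<in> E \<and> \<sigma> = sig b) in (\<lambda>s\<in>{1..n}. sig (sg s (lk b s))))"
  have h: "h (sig b) = (\<lambda>s\<in>{1..n}. sig (sg s (lk b s)))" if b: "b \<in> E" for b
  proof -
    define b' where "b' = (SOME b'. b' \<in> E \<and> sig b = sig b')"
    have "\<exists>b'. b' \<in> E \<and> sig b = sig b'" using b by blast
    then have b': "b' \<in> E" "sig b = sig b'" unfolding b'_def by (metis (mono_tags, lifting) someI_ex)+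
    have "sig (sg s (lk b s)) = sig (sg s (lk b' s))" if "s \<in> {1..n}" for s
      using sig_eq_mod[OF b b' that] reg that by (simp add: sig_sg_eq_iff reg_iff_fi)
    then show ?thesis unfolding h_def Let_def b'_def[symmetric] by (intro restrict_ext) simp
  qed
  have hom: "h \<in> hom OG PG"
  proof (rule homI)
    fix x assume "x \<in> carrier OG"
    then obtain b where "b \<in> E" "x = sig b" unfolding OG_carrier by blast
    then show "h x \<in> carrier PG" by (auto simp: h cyclic_carrier)
  next
    fix x y assume "x \<in> carrier OG" "y \<in> carrier OG"
    then obtain b b' where b: "b \<in> E" "x = sig b" "b' \<in> E" "y = sig b'" unfolding OG_carrier by blast
    have "h (x \<otimes>\<^bsub>OG\<^esub> y) = h (sig (b + b'))" by (simp add: b OG_mult)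
    also have "\<dots> = h x \<otimes>\<^bsub>PG\<^esub> h y"
      by (auto simp: b h expo_add cyclic_mult OG_mult single_add lookup_add intro!: restrict_ext)
    finally show "h (x \<otimes>\<^bsub>OG\<^esub> y) = h x \<otimes>\<^bsub>PG\<^esub> h y" .
  qed
  have inj: "inj_on h (carrier OG)"
  proof (rule inj_onI)
    fix x y assume "x \<in> carrier OG" "y \<in> carrier OG" and e: "h x = h y"
    then obtain b b' where b: "b \<in> box n wi" "x = sig b" "b' \<in> box n wi" "y = sig b'" unfolding OG_box by blast
    then have E: "b \<in> E" "b' \<in> E" by (auto simp: box_def)
    have "lk b s = lk b' s" for s
    proof (cases "s \<in> {1..n}")
      case True
      have "sig (sg s (lk b s)) = sig (sg s (lk b' s))"
        using fun_cong[OF e, of s] True by (simp add: b(2,4) h E)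
      then show ?thesis using True b by (simp add: sig_sg_eq_iff box_def)
    next
      case False
      then show ?thesis using E expo_out by metis
    qed
    then show "x = y" using b poly_mapping_eqI by metis
  qed
  have fin: "finite (carrier PG)"
  proof -
    have "card (carrier PG) > 0" unfolding card_PG using wi by (intro prod_pos) auto
    then show ?thesis using card_gt_0_iff by blast
  qed
  have "h ` carrier OG = carrier PG"
  proof (rule card_subset_eq[OF fin])
    show "h ` carrier OG \<subseteq> carrier PG" using hom unfolding hom_def by auto
    show "card (h ` carrier OG) = card (carrier PG)"
      using card_image[OF inj] card_PG reg reg_iff_card_wi by simp
  qed
  then have "h \<in> iso OG PG" using hom inj by (simp add: iso_def bij_betw_def)
  then show "OG \<cong> PG" unfolding is_iso_def by blast
qed

lemma reg_iff_center_powers: "reg \<longleftrightarrow> (\<forall>i\<in>{1..n}. skew_var n p i [^]\<^bsub>S\<^esub> fi i \<in> skew_center n p)"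
  unfolding reg_iff_dvd by (auto simp: var_pow_eq mono_center_iff expo_single)

lemma reg_iff_subalgebra_fi:
  "reg \<longleftrightarrow> skew_center n p = skew_subalgebra n p ((\<lambda>i. skew_var n p i [^]\<^bsub>S\<^esub> fi i) ` {1..n})"
  unfolding center_eq_subalgebra_iff
proof
  assume reg
  then show "\<forall>a\<in>E. (a \<in> Ds) = (\<forall>i\<in>{1..n}. fi i dvd lk a i)"
    using reg_Ds_iff by (simp add: reg_iff_fi)
next
  assume h: "\<forall>a\<in>E. (a \<in> Ds) = (\<forall>i\<in>{1..n}. fi i dvd lk a i)"
  then show reg unfolding reg_iff_dvd by (auto simp: lookup_single when_def expo_single)
qed

lemma reg_iff_subalgebra:
  "reg \<longleftrightarrow> (\<exists>w. (\<forall>i\<in>{1..n}. w i \<ge> (1::nat)) \<and>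
     skew_center n p = skew_subalgebra n p ((\<lambda>i. skew_var n p i [^]\<^bsub>S\<^esub> w i) ` {1..n}))"
proof
  assume reg: reg
  have "\<forall>i\<in>{1..n}. fi i \<ge> 1"
  proof
    fix i assume "i \<in> {1..n}"
    then have "fi i > 0" by (rule fi_pos)
    then show "fi i \<ge> 1" by linarith
  qed
  then show "\<exists>w. (\<forall>i\<in>{1..n}. w i \<ge> (1::nat)) \<and>
     skew_center n p = skew_subalgebra n p ((\<lambda>i. skew_var n p i [^]\<^bsub>S\<^esub> w i) ` {1..n})"
    using iffD1[OF reg_iff_subalgebra_fi reg] by - (rule exI[of _ fi], rule conjI)
next
  assume "\<exists>w. (\<forall>i\<in>{1..n}. w i \<ge> (1::nat)) \<and>
     skew_center n p = skew_subalgebra n p ((\<lambda>i. skew_var n p i [^]\<^bsub>S\<^esub> w i) ` {1..n})"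
  then obtain w where h: "\<forall>a\<in>E. (a \<in> Ds) = (\<forall>i\<in>{1..n}. w i dvd lk a i)"
    unfolding center_eq_subalgebra_iff by blast
  \<comment> \<open>The generator x_i^(w i) is central, so the given exponents are multiples of the
    orders; divisibility by \<open>w i\<close> then implies regularity.\<close>
  have "wi i dvd w i" if i: "i \<in> {1..n}" for i
  proof -
    have "sg i (w i) \<in> Ds" using h i by (auto simp: lookup_single when_def expo_single)
    then show ?thesis using wi_dvd_iff[OF i] by blast
  qed
  then show reg unfolding reg_def using h Ds_E by (meson dvd_trans)
qed

end

section \<open>Modules over the center\<close>

declare single_one [simp del]

context ozone
begin

abbreviation "Z \<equiv> skew_center n p"
abbreviation "ZR \<equiv> skew_center_ring n p"

lemma ZR_simps [simp]: "carrier ZR = Z" "monoid.mult ZR = monoid.mult S" "\<one>\<^bsub>ZR\<^esub> = \<one>\<^bsub>S\<^esub>"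
  "\<zero>\<^bsub>ZR\<^esub> = \<zero>\<^bsub>S\<^esub>" "ring.add ZR = ring.add S"
  by (simp_all add: skew_center_ring_def)

lemma Z_closed: "z \<in> Z \<Longrightarrow> z \<in> carrier S"
  and Z_ks: "z \<in> Z \<Longrightarrow> ks (nff z) \<subseteq> Ds"
  by (simp_all add: center_eq)

lemma ZI: "s \<in> carrier S \<Longrightarrow> ks (nff s) \<subseteq> Ds \<Longrightarrow> s \<in> Z"
  by (simp add: center_eq)

lemma Z_comm: "z \<in> Z \<Longrightarrow> s \<in> carrier S \<Longrightarrow> z \<cdot> s = s \<cdot> z"
  unfolding skew_center_def ring_center_def by blast

lemma cl_Z: "ks F \<subseteq> Ds \<Longrightarrow> cl F \<in> Z"
  using Ds_E by (intro ZI) (auto simp: cl_closed nf_cl subset_iff)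

lemma ks_tmul_sub:
  "ks F \<subseteq> A \<Longrightarrow> ks G \<subseteq> B \<Longrightarrow> (\<And>a b. a \<in> A \<Longrightarrow> b \<in> B \<Longrightarrow> a + b \<in> C) \<Longrightarrow> ks (F \<star> G) \<subseteq> C"
  using ks_tmul[of n p F G] by blast

lemma Z_mult: "y \<in> Z \<Longrightarrow> z \<in> Z \<Longrightarrow> y \<cdot> z \<in> Z"
  by (rule ZI) (use ks_tmul_sub[of "nff y" Ds "nff z" Ds Ds] in \<open>auto simp: Z_closed nf_mult Z_ks Ds_add\<close>)

lemma subcring_Z: "subcring Z S"
proof (rule S.subcringI)
  show "subring Z S"
  proof (rule S.subringI)
    show "Z \<subseteq> carrier S" using Z_closed by blast
    show "\<one>\<^bsub>S\<^esub> \<in> Z" by (rule ZI) (simp_all add: nf_one)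
    fix y z assume y: "y \<in> Z" and z: "z \<in> Z"
    show "\<ominus>\<^bsub>S\<^esub> y \<in> Z" by (rule ZI) (use y in \<open>simp_all add: Z_closed nf_minus Z_ks\<close>)
    show "y \<cdot> z \<in> Z" using y z by (rule Z_mult)
    show "y \<oplus>\<^bsub>S\<^esub> z \<in> Z"
      using Poly_Mapping.keys_add[of "nff y" "nff z"] Z_ks[OF y] Z_ks[OF z] y z
      by (intro ZI) (auto simp: Z_closed nf_add)
  qed
  fix y z assume "y \<in> Z" "z \<in> Z"
  then show "y \<cdot> z = z \<cdot> y" using Z_comm Z_closed by blast
qed

lemma cring_ZR: "cring ZR"
  unfolding skew_center_ring_def
  using S.subcring_iff[of Z] subcring_Z Z_closed by blast

text \<open>The additive part of a monomial module, kept apart from the scalars because it serves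
  both modules over \<open>Z\<close> and the graded pieces over the field.\<close>

definition mono_group :: "((nat free_mon \<Rightarrow>\<^sub>0 'k) set, 'c) ring_scheme \<Rightarrow> (nat \<Rightarrow>\<^sub>0 nat) set \<Rightarrow> bool"
  where "mono_group V U \<longleftrightarrow> carrier V = {s \<in> carrier S. ks (nff s) \<subseteq> U} \<and>
    ring.zero V = \<zero>\<^bsub>S\<^esub> \<and> ring.add V = ring.add S"

context
  fixes V :: "((nat free_mon \<Rightarrow>\<^sub>0 'k) set, 'c) ring_scheme" and U
  assumes V: "mono_group V U"
begin

lemma G_carrier: "carrier V = {s \<in> carrier S. ks (nff s) \<subseteq> U}"
  and G_zero: "\<zero>\<^bsub>V\<^esub> = \<zero>\<^bsub>S\<^esub>" and G_add: "ring.add V = ring.add S"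
  using V unfolding mono_group_def by auto

lemma G_S: "m \<in> carrier V \<Longrightarrow> m \<in> carrier S" and G_ks: "m \<in> carrier V \<Longrightarrow> ks (nff m) \<subseteq> U"
  by (simp_all add: G_carrier)

lemma GI: "m \<in> carrier S \<Longrightarrow> ks (nff m) \<subseteq> U \<Longrightarrow> m \<in> carrier V"
  by (simp add: G_carrier)

lemma mono_group_abelian: "abelian_group V"
proof (rule abelian_groupI)
  fix x y z assume x: "x \<in> carrier V" and y: "y \<in> carrier V" and z: "z \<in> carrier V"
  show "x \<oplus>\<^bsub>V\<^esub> y \<in> carrier V" unfolding G_add
    using Poly_Mapping.keys_add[of "nff x" "nff y"] G_ks[OF x] G_ks[OF y]
    by (intro GI) (auto simp: G_S x y nf_add)
  show "x \<oplus>\<^bsub>V\<^esub> y \<oplus>\<^bsub>V\<^esub> z = x \<oplus>\<^bsub>V\<^esub> (y \<oplus>\<^bsub>V\<^esub> z)"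
    unfolding G_add by (rule S.a_assoc) (simp_all add: G_S x y z)
  show "x \<oplus>\<^bsub>V\<^esub> y = y \<oplus>\<^bsub>V\<^esub> x"
    unfolding G_add by (rule S.a_comm) (simp_all add: G_S x y z)
  show "\<zero>\<^bsub>V\<^esub> \<oplus>\<^bsub>V\<^esub> x = x" unfolding G_add G_zero by (simp add: G_S x)
  show "\<exists>y\<in>carrier V. y \<oplus>\<^bsub>V\<^esub> x = \<zero>\<^bsub>V\<^esub>"
    unfolding G_add G_zero
    by (rule bexI[of _ "\<ominus>\<^bsub>S\<^esub> x"]) (use G_ks[OF x] in \<open>auto simp: G_S x S.l_neg nf_minus intro!: GI\<close>)
qed (auto simp: G_zero nf_zero intro: GI)

lemma mono_group_finsum:
  assumes "finite A" "\<And>x. x \<in> A \<Longrightarrow> g x \<in> carrier V"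
  shows "finsum V g A \<in> carrier V \<and> nff (finsum V g A) = (\<Sum>x\<in>A. nff (g x))"
proof -
  interpret V: abelian_group V by (rule mono_group_abelian)
  show ?thesis using assms
  proof (induction A rule: finite_induct)
    case empty
    then show ?case using V.zero_closed by (simp add: G_zero nf_zero)
  next
    case (insert x A)
    have s: "finsum V g A \<in> carrier V" using insert by simp
    have g: "g x \<in> carrier V" using insert by simp
    have "finsum V g (insert x A) = g x \<oplus>\<^bsub>V\<^esub> finsum V g A"
      by (rule V.finsum_insert) (use insert in auto)
    then show ?case using insert V.add.m_closed[OF g s] by (simp add: G_add nf_add G_S)
  qed
qed

end

text \<open>All the module structures in question are spanned by monomials: \<open>V\<close> consists of the elements
  supported on a set \<open>U\<close> of exponents that is stable under translation by the exponents of central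
  monomials.\<close>

definition mono_module :: "((nat free_mon \<Rightarrow>\<^sub>0 'k) set, (nat free_mon \<Rightarrow>\<^sub>0 'k) set) module \<Rightarrow> (nat \<Rightarrow>\<^sub>0 nat) set \<Rightarrow> bool"
  where "mono_module V U \<longleftrightarrow> mono_group V U \<and> U \<subseteq> E \<and> (\<forall>d\<in>Ds. \<forall>x\<in>U. d + x \<in> U) \<and>
    (\<forall>z\<in>Z. \<forall>m\<in>carrier V. z \<odot>\<^bsub>V\<^esub> m = z \<cdot> m)"

lemma mono_module_group: "mono_module V U \<Longrightarrow> mono_group V U"
  by (simp add: mono_module_def)

lemma mono_module_left:
  "U \<subseteq> E \<Longrightarrow> (\<And>d x. d \<in> Ds \<Longrightarrow> x \<in> U \<Longrightarrow> d + x \<in> U) \<Longrightarrow>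
    mono_module (left_module S {s \<in> carrier S. ks (nff s) \<subseteq> U}) U"
  by (simp add: mono_module_def mono_group_def left_module_def)

text \<open>Scalars are central, so the right action coincides with left multiplication and both
  kinds of modules share one theory.\<close>

lemma mono_module_right:
  "U \<subseteq> E \<Longrightarrow> (\<And>d x. d \<in> Ds \<Longrightarrow> x \<in> U \<Longrightarrow> d + x \<in> U) \<Longrightarrow>
    mono_module (right_module S {s \<in> carrier S. ks (nff s) \<subseteq> U}) U"
  by (auto simp: mono_module_def mono_group_def right_module_def intro!: Z_comm[symmetric])

context
  fixes V U
  assumes V: "mono_module V U"
begin

lemmas V_add = G_add[OF mono_module_group[OF V]]
  and V_S = G_S[OF mono_module_group[OF V]]
  and V_ks = G_ks[OF mono_module_group[OF V]]
  and VI = GI[OF mono_module_group[OF V]]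

lemma V_smult: "z \<in> Z \<Longrightarrow> m \<in> carrier V \<Longrightarrow> z \<odot>\<^bsub>V\<^esub> m = z \<cdot> m"
  and U_E: "U \<subseteq> E" and U_add: "d \<in> Ds \<Longrightarrow> x \<in> U \<Longrightarrow> d + x \<in> U"
  using V unfolding mono_module_def by auto

lemma V_mult: "z \<in> Z \<Longrightarrow> m \<in> carrier V \<Longrightarrow> z \<cdot> m \<in> carrier V"
  using ks_tmul_sub[of "nff z" Ds "nff m" U U] U_add
  by (intro VI) (auto simp: Z_closed V_S nf_mult Z_ks V_ks)

lemmas V_group = mono_group_abelian[OF mono_module_group[OF V]]

lemma V_module: "Module.module ZR V"
proof (rule moduleI[OF cring_ZR V_group])
  fix z m assume z: "z \<in> carrier ZR" and m: "m \<in> carrier V"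
  then show "z \<odot>\<^bsub>V\<^esub> m \<in> carrier V" by (simp add: V_smult V_mult)
  fix y assume y: "y \<in> carrier ZR"
  have yz: "y \<oplus>\<^bsub>S\<^esub> z \<in> Z" using cring.cring_simprules(1)[OF cring_ZR y z] by simp
  show "(y \<oplus>\<^bsub>ZR\<^esub> z) \<odot>\<^bsub>V\<^esub> m = y \<odot>\<^bsub>V\<^esub> m \<oplus>\<^bsub>V\<^esub> z \<odot>\<^bsub>V\<^esub> m"
    using y z m yz by (simp add: V_smult V_add S.l_distr Z_closed V_S)
  show "(y \<otimes>\<^bsub>ZR\<^esub> z) \<odot>\<^bsub>V\<^esub> m = y \<odot>\<^bsub>V\<^esub> (z \<odot>\<^bsub>V\<^esub> m)"
    using y z m by (simp add: V_smult Z_mult V_mult S.m_assoc Z_closed V_S)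
next
  fix z m m' assume z: "z \<in> carrier ZR" and m: "m \<in> carrier V" "m' \<in> carrier V"
  then have mm: "m \<oplus>\<^bsub>V\<^esub> m' \<in> carrier V"
    using abelian_groupE(1)[OF V_group] by blast
  show "z \<odot>\<^bsub>V\<^esub> (m \<oplus>\<^bsub>V\<^esub> m') = z \<odot>\<^bsub>V\<^esub> m \<oplus>\<^bsub>V\<^esub> z \<odot>\<^bsub>V\<^esub> m'"
    using z m mm by (simp add: V_smult) (simp add: V_add S.r_distr Z_closed V_S)
next
  fix m assume m: "m \<in> carrier V"
  have "\<one>\<^bsub>S\<^esub> \<in> Z" using cring.cring_simprules(6)[OF cring_ZR] by simp
  then show "\<one>\<^bsub>ZR\<^esub> \<odot>\<^bsub>V\<^esub> m = m" using m by (simp add: V_smult V_S)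
qed

lemmas nf_finsum = mono_group_finsum[OF mono_module_group[OF V]]

abbreviation "supp c \<equiv> {x. c x \<noteq> \<zero>\<^bsub>S\<^esub>}"

definition "coords B c m \<longleftrightarrow> range c \<subseteq> Z \<and> finite (supp c) \<and> supp c \<subseteq> B \<and>
    m = (\<Oplus>\<^bsub>V\<^esub> x \<in> supp c. c x \<odot>\<^bsub>V\<^esub> x)"

lemma module_basis_coords:
  "module_basis ZR V B \<longleftrightarrow> B \<subseteq> carrier V \<and> (\<forall>m\<in>carrier V. \<exists>!c. coords B c m)"
  unfolding module_basis_def coords_def by simp

text \<open>The module sum becomes an equation in the twisted algebra; allowing any finite
  \<open>A\<close> between the support and \<open>B\<close> frees the equation from the exact
  support of \<open>c\<close>.\<close>

lemma coords_iff:
  assumes "B \<subseteq> carrier V" "m \<in> carrier V" "range c \<subseteq> Z" "finite A" "supp c \<subseteq> A" "A \<subseteq> B"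
  shows "coords B c m \<longleftrightarrow> nff m = (\<Sum>x\<in>A. nff (c x) \<star> nff x)"
proof -
  have fin: "finite (supp c)" using assms(4,5) finite_subset by blast
  have g: "c x \<odot>\<^bsub>V\<^esub> x \<in> carrier V \<and> nff (c x \<odot>\<^bsub>V\<^esub> x) = nff (c x) \<star> nff x" if "x \<in> supp c" for x
  proof -
    have x: "x \<in> carrier V" "c x \<in> Z" using that assms by auto
    then show ?thesis by (simp add: V_smult V_mult nf_mult Z_closed V_S)
  qed
  let ?s = "\<Oplus>\<^bsub>V\<^esub> x \<in> supp c. c x \<odot>\<^bsub>V\<^esub> x"
  have s: "?s \<in> carrier V" "nff ?s = (\<Sum>x\<in>supp c. nff (c x) \<star> nff x)"
    using nf_finsum[OF fin, of "\<lambda>x. c x \<odot>\<^bsub>V\<^esub> x"] g by auto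
  have "(\<Sum>x\<in>supp c. nff (c x) \<star> nff x) = (\<Sum>x\<in>A. nff (c x) \<star> nff x)"
    by (rule sum.mono_neutral_left) (use assms in \<open>auto simp: nf_zero\<close>)
  moreover have "m = ?s \<longleftrightarrow> nff m = nff ?s" using nf_inj[of m ?s] s(1) assms(2) V_S by auto
  ultimately show ?thesis unfolding coords_def using s assms fin by auto
qed

lemma mono_inj: "a \<in> E \<Longrightarrow> b \<in> E \<Longrightarrow> mono a = mono b \<Longrightarrow> a = b"
  using nf_mono[of a] nf_mono[of b] by (metis inj_single one_neq_zero keys_single singleton_insert_inj_eq)

text \<open>\<open>\<pi> x\<close> is the element \<open>e\<close> of \<open>B\<close> with \<open>x \<in> e + Ds\<close>.\<close>

lemma mono_basis:
  assumes BU: "B \<subseteq> U"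
    and \<pi>: "\<And>x. x \<in> U \<Longrightarrow> \<pi> x \<in> B \<and> (\<exists>d\<in>Ds. x = d + \<pi> x)"
    and \<pi>_add: "\<And>d e. d \<in> Ds \<Longrightarrow> e \<in> B \<Longrightarrow> \<pi> (d + e) = e"
  shows "module_basis ZR V (mono ` B)"
proof -
  have BE: "e \<in> E" if "e \<in> B" for e using that BU U_E by blast
  have BV: "mono ` B \<subseteq> carrier V"
    using BU BE by (auto intro!: VI simp: mono_closed nf_mono)
  have inj: "inj_on mono B" using mono_inj BE by (auto simp: inj_on_def)
  have tlk: "lk (Q \<star> sg e 1) x = (if x \<in> U \<and> \<pi> x = e then coc (x - e) e * lk Q (x - e) else 0)"
    if Q: "ks Q \<subseteq> Ds" and e: "e \<in> B" for Q e x
  proof (cases "\<exists>d\<in>Ds. x = d + e")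
    case True
    then obtain d where d: "d \<in> Ds" "x = d + e" by blast
    then show ?thesis using lk_tmul_single_right[of n p Q e 1 d] \<pi>_add[OF d(1) e] U_add[OF d(1)] BU e by auto
  next
    case False
    then have "x \<notin> ks (Q \<star> sg e 1)" using ks_tmul[of n p Q "sg e 1"] Q by auto
    moreover have "\<not> (x \<in> U \<and> \<pi> x = e)" using False \<pi> by blast
    ultimately show ?thesis by (auto simp: in_keys_iff)
  qed
  \<comment> \<open>The translates e + Ds are disjoint, so only the summand belonging to
    \<open>\<pi> x\<close> reaches the coefficient at \<open>x\<close>.\<close>
  have main: "lk (\<Sum>e\<in>C. Q e \<star> sg e 1) x = (if x \<in> U \<and> \<pi> x \<in> C then coc (x - \<pi> x) (\<pi> x) * lk (Q (\<pi> x)) (x - \<pi> x) else 0)"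
    if "finite C" "C \<subseteq> B" "\<And>e. e \<in> C \<Longrightarrow> ks (Q e) \<subseteq> Ds" for C Q x
  proof -
    have "lk (\<Sum>e\<in>C. Q e \<star> sg e 1) x = (\<Sum>e\<in>C. lk (Q e \<star> sg e 1) x)" by (rule lookup_sum)
    also have "\<dots> = (\<Sum>e\<in>C. if e = \<pi> x then (if x \<in> U then coc (x - e) e * lk (Q e) (x - e) else 0) else 0)"
      by (rule sum.cong[OF refl]) (use that tlk in auto)
    also have "\<dots> = (if x \<in> U \<and> \<pi> x \<in> C then coc (x - \<pi> x) (\<pi> x) * lk (Q (\<pi> x)) (x - \<pi> x) else 0)"
      using that(1) by (simp add: sum.delta)
    finally show ?thesis .
  qed
  show ?thesis unfolding module_basis_coords
  proof (intro conjI ballI ex_ex1I)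
    fix m assume m: "m \<in> carrier V"
    define F where "F = nff m"
    have FU: "ks F \<subseteq> U" using m V_ks by (simp add: F_def)
    \<comment> \<open>The part of \<open>F\<close> in the translate e + Ds, shifted back by e and
      corrected by the cocycle so that multiplying by x^e restores it.\<close>
    define Q where "Q e = (\<Sum>x\<in>{x\<in>ks F. \<pi> x = e}. sg (x - e) (lk F x / coc (x - e) e))" for e
    define C where "C = \<pi> ` ks F"
    have C: "finite C" "C \<subseteq> B" unfolding C_def using \<pi> FU by auto
    have diff: "x - \<pi> x \<in> Ds \<and> x = (x - \<pi> x) + \<pi> x" if "x \<in> U" for x
    proof -
      obtain d where d: "d \<in> Ds" "x = d + \<pi> x" using \<pi> \<open>x \<in> U\<close> by blast
      have "x - \<pi> x = d" using arg_cong[OF d(2), of "\<lambda>y. y - \<pi> x"] by simp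
      then show ?thesis using d by simp
    qed
    have QD: "ks (Q e) \<subseteq> Ds" for e
    proof -
      have "ks (Q e) \<subseteq> (\<Union>x\<in>{x\<in>ks F. \<pi> x = e}. ks (sg (x - e) (lk F x / coc (x - e) e)))"
        unfolding Q_def by (rule keys_sum)
      also have "\<dots> \<subseteq> Ds" using diff FU by (auto split: if_splits)
      finally show ?thesis .
    qed
    have Qlk: "lk (Q (\<pi> x)) (x - \<pi> x) = lk F x / coc (x - \<pi> x) (\<pi> x)" if x: "x \<in> U" for x
    proof -
      have "lk (Q (\<pi> x)) (x - \<pi> x) = (\<Sum>y\<in>{y\<in>ks F. \<pi> y = \<pi> x}. if y = x then lk F x / coc (x - \<pi> x) (\<pi> x) else 0)"
        unfolding Q_def lookup_sum
      proof (rule sum.cong[OF refl])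
        fix y assume y: "y \<in> {y\<in>ks F. \<pi> y = \<pi> x}"
        then have "y - \<pi> x = x - \<pi> x \<longleftrightarrow> y = x" using diff[of y] diff[OF x] FU by auto
        then show "lk (sg (y - \<pi> x) (lk F y / coc (y - \<pi> x) (\<pi> x))) (x - \<pi> x)
            = (if y = x then lk F x / coc (x - \<pi> x) (\<pi> x) else 0)"
          by (auto simp: lookup_single when_def)
      qed
      then show ?thesis by (simp add: sum.delta in_keys_iff)
    qed
    define c where "c y = (if y \<in> mono ` C then cl (Q (inv_into B mono y)) else \<zero>\<^bsub>S\<^esub>)" for y
    have c_mono: "c (mono e) = cl (Q e)" if "e \<in> C" for e
    proof -
      have "inv_into B mono (mono e) = e" using inv_into_f_f[OF inj, of e] that C by blast
      then show ?thesis using that by (simp add: c_def)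
    qed
    have cZ: "range c \<subseteq> Z"
      using cl_Z[OF QD] cring.cring_simprules(2)[OF cring_ZR] by (auto simp: c_def)
    have "coords (mono ` B) c m \<longleftrightarrow> nff m = (\<Sum>x\<in>mono ` C. nff (c x) \<star> nff x)"
      by (rule coords_iff[OF BV m cZ]) (use C in \<open>auto simp: c_def\<close>)
    also have "(\<Sum>x\<in>mono ` C. nff (c x) \<star> nff x) = (\<Sum>e\<in>C. Q e \<star> sg e 1)"
    proof (subst sum.reindex)
      show "inj_on mono C" using inj C(2) inj_on_subset by blast
      show "sum ((\<lambda>x. nff (c x) \<star> nff x) \<circ> mono) C = (\<Sum>e\<in>C. Q e \<star> sg e 1)"
      proof (rule sum.cong[OF refl])
        fix e assume e: "e \<in> C"
        have "ks (Q e) \<subseteq> E" using QD[of e] Ds_E by blast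
        then show "((\<lambda>x. nff (c x) \<star> nff x) \<circ> mono) e = Q e \<star> sg e 1"
          using e C BE by (auto simp: c_mono nf_cl nf_mono subset_iff)
      qed
    qed
    also have "nff m = (\<Sum>e\<in>C. Q e \<star> sg e 1)"
    proof (rule poly_mapping_eqI)
      fix x
      show "lk (nff m) x = lk (\<Sum>e\<in>C. Q e \<star> sg e 1) x"
      proof (cases "x \<in> U")
        case True
        then show ?thesis
          using main[OF C, of Q x] QD Qlk[OF True] coc_nz[of "x - \<pi> x" "\<pi> x"]
          by (auto simp: F_def[symmetric] C_def in_keys_iff)
      next
        case False
        then show ?thesis using main[OF C, of Q x] QD FU by (auto simp: F_def[symmetric] in_keys_iff)
      qed
    qed
    finally show "\<exists>c. coords (mono ` B) c m" by blast
  next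
    fix m c c' assume m: "m \<in> carrier V" and c: "coords (mono ` B) c m" and c': "coords (mono ` B) c' m"
    \<comment> \<open>Every coefficient of every coordinate can be read off from \<open>m\<close>,
      which gives uniqueness.\<close>
    have key: "lk (nff m) (d + e) = coc d e * lk (nff (c (mono e))) d"
      if c: "coords (mono ` B) c m" and e: "e \<in> B" and d: "d \<in> Ds" for c d e
    proof -
      have cZ: "range c \<subseteq> Z" and fin: "finite (supp c)" and sub: "supp c \<subseteq> mono ` B"
        using c by (auto simp: coords_def)
      define C where "C = {e \<in> B. c (mono e) \<noteq> \<zero>\<^bsub>S\<^esub>}"
      have sC: "supp c = mono ` C" using sub unfolding C_def by blast
      have injC: "inj_on mono C" using inj by (rule inj_on_subset) (auto simp: C_def)
      have C: "finite C" "C \<subseteq> B" using fin injC finite_imageD unfolding sC by (blast, simp add: C_def)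
      have "nff m = (\<Sum>x\<in>mono ` C. nff (c x) \<star> nff x)"
        using coords_iff[OF BV m cZ, of "mono ` C"] C c sC by blast
      also have "\<dots> = (\<Sum>e\<in>C. nff (c (mono e)) \<star> sg e 1)"
        by (subst sum.reindex[OF injC]) (use C BE in \<open>auto simp: nf_mono subset_iff intro!: sum.cong\<close>)
      also have "lk \<dots> (d + e) = (if e \<in> C then coc d e * lk (nff (c (mono e))) d else 0)"
      proof -
        have "ks (nff (c (mono e))) \<subseteq> Ds" for e using cZ Z_ks by blast
        from main[OF C, of "\<lambda>e. nff (c (mono e))" "d + e"] this show ?thesis
          using \<pi>_add[OF d e] U_add[OF d] BU e by auto
      qed
      also have "\<dots> = coc d e * lk (nff (c (mono e))) d"
        using e by (auto simp: C_def nf_zero)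
      finally show ?thesis .
    qed
    show "c = c'"
    proof
      fix y
      have cZ: "c y \<in> Z" "c' y \<in> Z" and sub: "supp c \<subseteq> mono ` B" "supp c' \<subseteq> mono ` B"
        using c c' by (auto simp: coords_def)
      show "c y = c' y"
      proof (cases "y \<in> mono ` B")
        case True
        then obtain e where e: "e \<in> B" "y = mono e" by blast
        have "lk (nff (c y)) d = lk (nff (c' y)) d" for d
        proof (cases "d \<in> Ds")
          case True
          then show ?thesis using key[OF c e(1) True] key[OF c' e(1) True] coc_nz[of d e] e by simp
        next
          case False
          then have "d \<notin> ks (nff (c y))" "d \<notin> ks (nff (c' y))" using cZ Z_ks by blast+
          then show ?thesis by (simp add: in_keys_iff)
        qed
        then have "nff (c y) = nff (c' y)" by (rule poly_mapping_eqI)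
        then show ?thesis using nf_inj cZ Z_closed by blast
      next
        case False
        then show ?thesis using sub by blast
      qed
    qed
  qed (rule BV)
qed

lemma coords_unique:
  "module_basis ZR V B \<Longrightarrow> m \<in> carrier V \<Longrightarrow> coords B c m \<Longrightarrow> coords B c' m \<Longrightarrow> c = c'"
  unfolding module_basis_coords by blast

text \<open>Together with uniqueness, this says that coordinates are linear over \<open>Z\<close>,
  so a relation between monomials passes to their coordinates.\<close>

lemma coords_scale:
  assumes B: "B \<subseteq> carrier V" and m: "m \<in> carrier V" and c: "coords B c m" and z: "z \<in> Z"
  shows "coords B (\<lambda>x. z \<cdot> c x) (z \<cdot> m)"
proof -
  have cZ: "range c \<subseteq> Z" and fin: "finite (supp c)" and sub: "supp c \<subseteq> B" using c by (auto simp: coords_def)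
  have cx: "c x \<in> Z" for x using cZ by blast
  have e: "nff m = (\<Sum>x\<in>supp c. nff (c x) \<star> nff x)"
    using coords_iff[OF B m cZ fin _ sub] c by blast
  have dist: "nff z \<star> (\<Sum>x\<in>A. h x) = (\<Sum>x\<in>A. nff z \<star> h x)" if "finite A" for A and h :: "_ \<Rightarrow> (nat \<Rightarrow>\<^sub>0 nat) \<Rightarrow>\<^sub>0 'k"
    using that by (induction A rule: finite_induct) (simp_all add: tmul_add_right)
  have "nff (z \<cdot> m) = (\<Sum>x\<in>supp c. nff z \<star> (nff (c x) \<star> nff x))"
    using z m by (simp add: nf_mult Z_closed V_S e dist[OF fin])
  also have "\<dots> = (\<Sum>x\<in>supp c. nff (z \<cdot> c x) \<star> nff x)"
  proof (rule sum.cong[OF refl])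
    fix x assume "x \<in> supp c"
    then have x: "x \<in> carrier S" using sub B V_S by blast
    have "nff z \<star> (nff (c x) \<star> nff x) = nff (z \<cdot> (c x \<cdot> x))"
      using x z cx by (simp add: nf_mult Z_closed)
    also have "\<dots> = nff (z \<cdot> c x \<cdot> x)" using x z cx by (simp add: S.m_assoc Z_closed)
    also have "\<dots> = nff (z \<cdot> c x) \<star> nff x" using x z cx by (simp add: nf_mult[of _ x] Z_closed)
    finally show "nff z \<star> (nff (c x) \<star> nff x) = nff (z \<cdot> c x) \<star> nff x" .
  qed
  finally show ?thesis
    by (subst coords_iff[OF B V_mult[OF z m] _ fin _ sub]) (use cx z in \<open>auto simp: Z_mult Z_closed\<close>)
qed

end

section \<open>Freeness of \<open>S\<close> over its center\<close>

lemma mono_module_S: "mono_module (left_module S (carrier S)) E"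
proof -
  have "{s \<in> carrier S. ks (nff s) \<subseteq> E} = carrier S" using nf_closed by blast
  then show ?thesis using mono_module_left[of E] Ds_E by auto
qed

lemma left_module_carrier [simp]: "carrier (left_module S M) = M"
  by (simp add: left_module_def)

text \<open>In the regular case reduction modulo \<open>wi\<close> chooses one representative in
  each translate of \<open>Ds\<close>, so the monomials in the box of \<open>wi\<close> form a
  basis.\<close>

lemma reg_imp_free: "reg \<Longrightarrow> free_module ZR (left_module S (carrier S))"
proof -
  assume reg: reg
  note V = mono_module_S
  have "module_basis ZR (left_module S (carrier S)) (mono ` box n wi)"
  proof (rule mono_basis[OF V])
    show "box n wi \<subseteq> E" by (auto simp: box_def)
  next
    fix x assume x: "x \<in> E"
    obtain d where d: "d \<in> E" "x = md wi x + d" "\<forall>i\<in>{1..n}. wi i dvd lk d i"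
      using md_split[OF x, of wi] by blast
    then have "d \<in> Ds" using dvd_Ds by blast
    then show "md wi x \<in> box n wi \<and> (\<exists>d\<in>Ds. x = d + md wi x)"
      using md_box[of wi x] wi d(2) by (metis add.commute)
  next
    fix d e assume d: "d \<in> Ds" and e: "e \<in> box n wi"
    have eE: "e \<in> E" using e by (simp add: box_def)
    show "md wi (d + e) = e"
    proof (rule poly_mapping_eqI)
      fix i show "lk (md wi (d + e)) i = lk e i"
      proof (cases "i \<in> {1..n}")
        case True
        then have "wi i dvd lk d i" using reg d by (simp add: reg_def)
        then have "(lk d i + lk e i) mod wi i = lk e i mod wi i" by (simp add: mod_add_left_eq[symmetric])
        then show ?thesis using True e by (simp add: lk_md lookup_add box_def)
      next
        case False
        then show ?thesis using eE expo_out md_expo by metis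
      qed
    qed
  qed
  then show ?thesis unfolding free_module_def using V_module[OF V] by blast
qed

text \<open>If \<open>w\<^sub>i\<close> does not divide \<open>d\<^sub>i\<close>, then after reducing \<open>d\<^sub>i\<close> modulo \<open>w\<^sub>i\<close> the coordinates of \<open>x\<^sup>u\<close> and \<open>x\<^sup>v\<close>
  below satisfy a relation which, by uniqueness of coordinates, would make \<open>u\<close> central.\<close>

lemma free_imp_reg: "free_module ZR (left_module S (carrier S)) \<Longrightarrow> reg"
proof (rule ccontr)
  let ?V = "left_module S (carrier S)"
  note V = mono_module_S
  assume "free_module ZR ?V" and nreg: "\<not> reg"
  then obtain B where B: "module_basis ZR ?V B" unfolding free_module_def by blast
  then have BS: "B \<subseteq> carrier ?V" and ex: "\<And>m. m \<in> carrier S \<Longrightarrow> \<exists>c. coords ?V B c m"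
    using module_basis_coords[OF V] by auto
  obtain d i where d: "d \<in> Ds" and i: "i \<in> {1..n}" and nd: "\<not> wi i dvd lk d i"
    using nreg unfolding reg_def by blast
  define r where "r = lk d i mod wi i"
  have r: "0 < r" "r < wi i" using nd wi[OF i] unfolding r_def by (auto simp: mod_greater_zero_iff_not_dvd)
  \<comment> \<open>Here u is d with its i-th entry removed, d' = u + r e_i has that entry reduced
    modulo w_i, and v completes r to w_i. Hence w_i e_i + u = d' + v, with w_i e_i and d'
    central.\<close>
  define u where "u = d - sg i (lk d i)"
  define d' where "d' = u + sg i r"
  define v where "v = sg i (wi i - r)"
  have lu: "lk u j = (if j = i then 0 else lk d j)" for j
    by (simp add: u_def lookup_minus lookup_single when_def)
  have uE: "u \<in> E" using Ds_E[OF d] lu expo_out[OF Ds_E[OF d]]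
    by (auto simp: expo_def in_keys_iff split: if_splits)
  have vE: "v \<in> E" using i by (auto simp: v_def)
  have "d = sc (lk d i div wi i) (sg i (wi i)) + d'"
    by (rule poly_mapping_eqI) (simp add: d'_def lookup_add lu lookup_single when_def r_def)
  then have d': "d' \<in> Ds" using d Ds_cancel Ds_sc wi[OF i] by metis
  have w: "sg i (wi i) \<in> Ds" using wi[OF i] by blast
  have uv: "sg i (wi i) + u = d' + v"
    using r by (intro poly_mapping_eqI) (auto simp: d'_def v_def lookup_add lookup_single when_def)
  \<comment> \<open>The scalar balances the two cocycle factors, so that the identity of exponents
    becomes an identity in \<open>S\<close>.\<close>
  define \<kappa> where "\<kappa> = coc d' v / coc (sg i (wi i)) u"
  have \<kappa>: "\<kappa> \<noteq> 0" "coc (sg i (wi i)) u * \<kappa> = coc d' v" using coc_nz by (auto simp: \<kappa>_def)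
  define z1 where "z1 = cl (sg (sg i (wi i)) \<kappa>)"
  define z2 where "z2 = mono d'"
  have z: "z1 \<in> Z" "z2 \<in> Z" unfolding z1_def z2_def by (rule cl_Z; use w d' in simp)+
  have nz: "nff z1 = sg (sg i (wi i)) \<kappa>" "nff z2 = sg d' 1"
    unfolding z1_def z2_def by (rule nf_cl; use Ds_E[OF w] Ds_E[OF d'] in simp)+
  have eq: "z1 \<cdot> mono u = z2 \<cdot> mono v"
    by (rule nf_inj) (use z \<kappa> in \<open>simp_all add: nf_mult Z_closed mono_closed uE vE nf_mono nz tmul_single uv\<close>)
  obtain \<alpha> where \<alpha>: "coords ?V B \<alpha> (mono u)" using ex mono_closed[OF uE] by blast
  obtain \<gamma> where \<gamma>: "coords ?V B \<gamma> (mono v)" using ex mono_closed[OF vE] by blast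
  have "(\<lambda>x. z1 \<cdot> \<alpha> x) = (\<lambda>x. z2 \<cdot> \<gamma> x)"
  proof (rule coords_unique[OF V B])
    show "coords ?V B (\<lambda>x. z1 \<cdot> \<alpha> x) (z1 \<cdot> mono u)"
      by (rule coords_scale[OF V BS _ \<alpha> z(1)]) (simp add: mono_closed uE)
    show "coords ?V B (\<lambda>x. z2 \<cdot> \<gamma> x) (z1 \<cdot> mono u)" unfolding eq
      by (rule coords_scale[OF V BS _ \<gamma> z(2)]) (simp add: mono_closed vE)
    show "z1 \<cdot> mono u \<in> carrier ?V" using z by (simp add: Z_closed mono_closed uE)
  qed
  then have zz: "z1 \<cdot> \<alpha> x = z2 \<cdot> \<gamma> x" for x by meson
  have aZ: "\<alpha> x \<in> Z" "\<gamma> x \<in> Z" for x using \<alpha> \<gamma> unfolding coords_def[OF V] by auto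
  have "finite (supp \<alpha>)" "supp \<alpha> \<subseteq> B" using \<alpha> unfolding coords_def[OF V] by auto
  then have su: "nff (mono u) = (\<Sum>x\<in>supp \<alpha>. nff (\<alpha> x) \<star> nff x)"
    using coords_iff[OF V BS, of "mono u" \<alpha> "supp \<alpha>"] \<alpha> aZ mono_closed[OF uE] by auto
  \<comment> \<open>The term x^u must come from some basis element: one of its coordinates contains
    a monomial x^a dividing x^u.\<close>
  have "\<exists>x\<in>supp \<alpha>. lk (nff (\<alpha> x) \<star> nff x) u \<noteq> 0"
  proof (rule ccontr)
    assume "\<not> ?thesis"
    then have "lk (nff (mono u)) u = 0" unfolding su lookup_sum by (intro sum.neutral) blast
    then show False by (simp add: nf_mono uE)
  qed
  then obtain x where "u \<in> ks (nff (\<alpha> x) \<star> nff x)" by (auto simp: in_keys_iff)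
  then obtain a \<rho> where a: "a \<in> ks (nff (\<alpha> x))" and u: "u = a + \<rho>"
    using ks_tmul[of n p "nff (\<alpha> x)" "nff x"] by blast
  have "lk (nff (z1 \<cdot> \<alpha> x)) (sg i (wi i) + a) \<noteq> 0"
    using a \<kappa> coc_nz lk_tmul_single_left[of n p "sg i (wi i)" \<kappa> "nff (\<alpha> x)" a] z aZ
    by (simp add: nf_mult Z_closed nz in_keys_iff)
  then have "sg i (wi i) + a \<in> ks (sg d' 1 \<star> nff (\<gamma> x))"
    using z aZ by (simp add: zz nf_mult Z_closed nz in_keys_iff)
  then obtain b where b: "sg i (wi i) + a = d' + b"
    using ks_tmul[of n p "sg d' 1" "nff (\<gamma> x)"] by auto
  \<comment> \<open>Away from i the relation gives a_j = u_j + b_j, while a_j is at most u_j; at i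
    both entries vanish. So u is central, hence so is r e_i, against 0 < r < w_i.\<close>
  have "a = u"
  proof (rule poly_mapping_eqI)
    fix j
    have 1: "lk u j = lk a j + lk \<rho> j" by (simp add: u lookup_add)
    show "lk a j = lk u j"
    proof (cases "j = i")
      case True then show ?thesis using 1 lu[of i] by simp
    next
      case False
      have "lk (sg i (wi i) + a) j = lk (d' + b) j" by (simp add: b)
      then have "lk a j = lk u j + lk b j" using False by (simp add: d'_def lookup_add lookup_single)
      then show ?thesis using 1 by simp
    qed
  qed
  then have "u \<in> Ds" using a aZ Z_ks by blast
  then have "sg i r \<in> Ds" using d' Ds_cancel unfolding d'_def by blast
  then show False using wi_dvd_iff[OF i] r by (auto dest: dvd_imp_le)
qed

end

section \<open>Semi-invariants\<close>

lemma pm_nat_nonneg: "(0::nat \<Rightarrow>\<^sub>0 nat) \<le> a"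
proof (rule ccontr)
  assume "\<not> 0 \<le> a"
  then have "a < 0" by simp
  then show False by (auto simp: less_poly_mapping.rep_eq less_fun_def)
qed

context ozone
begin

section \<open>Units, and generators of modules of rank one\<close>

lemma const_Z: "skew_const n p c \<in> Z"
  by (rule ZI) (auto simp: const_closed nf_const)

text \<open>Finitely supported exponents carry the lexicographic linear order, which addition
  preserves. The sum of the two leading exponents is reached only by the leading terms, so
  \<open>S\<close> is a domain.\<close>

lemma lk_tmul_Max:
  assumes "F \<noteq> 0" "G \<noteq> 0"
  shows "lk (F \<star> G) (Max (ks F) + Max (ks G)) \<noteq> 0"
proof -
  let ?A = "Max (ks F)" and ?B = "Max (ks G)"
  have A: "?A \<in> ks F" and B: "?B \<in> ks G" using assms by (auto intro!: Max_in)
  have eq: "a + b = ?A + ?B \<longleftrightarrow> a = ?A \<and> b = ?B" if "a \<in> ks F" "b \<in> ks G" for a b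
  proof
    assume e: "a + b = ?A + ?B"
    have ab: "a \<le> ?A" "b \<le> ?B" using that by (auto intro: Max_ge)
    then have "a = ?A" using e by (metis add_le_cancel_left add_mono_thms_linordered_semiring(2) antisym_conv add_le_cancel_right)
    then show "a = ?A \<and> b = ?B" using e by simp
  qed auto
  have "lk (F \<star> G) (?A + ?B) = (\<Sum>a\<in>ks F. if a = ?A then (\<Sum>b\<in>ks G. if b = ?B then coc ?A ?B * lk F ?A * lk G ?B else 0) else 0)"
    unfolding lk_tmul
  proof (rule sum.cong[OF refl])
    fix a assume a: "a \<in> ks F"
    show "(\<Sum>b\<in>ks G. if a + b = ?A + ?B then coc a b * lk F a * lk G b else 0)
        = (if a = ?A then (\<Sum>b\<in>ks G. if b = ?B then coc ?A ?B * lk F ?A * lk G ?B else 0) else 0)"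
      using eq[OF a] by (cases "a = ?A") (auto intro!: sum.cong sum.neutral)
  qed
  also have "\<dots> = coc ?A ?B * lk F ?A * lk G ?B" using A B by (simp add: sum.delta)
  finally show ?thesis using A B coc_nz by (simp add: in_keys_iff)
qed

text \<open>The leading exponents of two factors of 1 add up to 0, so both are 0, the least
  exponent.\<close>

lemma unit_const: "F \<star> G = sg 0 1 \<Longrightarrow> \<exists>c. c \<noteq> 0 \<and> G = sg 0 c"
proof -
  assume e: "F \<star> G = sg 0 1"
  have "sg 0 (1::'k) \<noteq> 0" by (metis lookup_single_eq lookup_zero one_neq_zero)
  then have nz: "F \<noteq> 0" "G \<noteq> 0" using e by auto
  have "Max (ks F) + Max (ks G) = 0"
    using lk_tmul_Max[OF nz] unfolding e by (auto simp: lookup_single when_def split: if_splits)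
  then have M: "Max (ks G) = 0"
    by (auto simp: poly_mapping_eq_iff fun_eq_iff lookup_add)
  have "b = 0" if "b \<in> ks G" for b
    using Max_ge[OF finite_keys that] pm_nat_nonneg[of b] unfolding M by simp
  then have "G = sg 0 (lk G 0)"
    by (intro poly_mapping_eqI) (auto simp: lookup_single when_def in_keys_iff)
  then show ?thesis using nz by (metis single_zero)
qed

lemma module_basis_singleton:
  assumes V: "mono_module V U" and g: "g \<in> carrier V"
  shows "module_basis ZR V {g} \<longleftrightarrow> (\<forall>m\<in>carrier V. \<exists>!z. z \<in> Z \<and> m = z \<cdot> g)"
proof -
  define cz where "cz z = (\<lambda>y. if y = g then z else \<zero>\<^bsub>S\<^esub>)" for z
  have zero_Z: "\<zero>\<^bsub>S\<^esub> \<in> Z" by (rule ZI) (auto simp: nf_zero)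
  have gS: "g \<in> carrier S" using g V_S[OF V] by blast
  have prod: "nff m = nff z \<star> nff g \<longleftrightarrow> m = z \<cdot> g" if "m \<in> carrier V" "z \<in> Z" for m z
    using nf_inj[of m "z \<cdot> g"] that gS V_S[OF V] by (auto simp: nf_mult Z_closed)
  have crd: "coords V {g} c m \<longleftrightarrow> m = c g \<cdot> g"
    if "m \<in> carrier V" "range c \<subseteq> Z" "supp c \<subseteq> {g}" for m c
    using coords_iff[OF V, of "{g}" m c "{g}"] prod[of m "c g"] that g by auto
  have crd_cz: "coords V {g} c m \<longleftrightarrow> (\<exists>z. z \<in> Z \<and> m = z \<cdot> g \<and> c = cz z)" if m: "m \<in> carrier V" for c m
  proof
    assume c: "coords V {g} c m"
    then have h: "range c \<subseteq> Z" "supp c \<subseteq> {g}" unfolding coords_def[OF V] by auto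
    have "c = cz (c g)" using h by (auto simp: cz_def fun_eq_iff)
    then show "\<exists>z. z \<in> Z \<and> m = z \<cdot> g \<and> c = cz z" using crd[OF m h] c h by blast
  next
    assume "\<exists>z. z \<in> Z \<and> m = z \<cdot> g \<and> c = cz z"
    then obtain z where z: "z \<in> Z" "m = z \<cdot> g" "c = cz z" by blast
    then have "range c \<subseteq> Z" "supp c \<subseteq> {g}" using zero_Z by (auto simp: cz_def)
    then show "coords V {g} c m" using crd[OF m] z by (simp add: cz_def)
  qed
  have cz_inj: "cz z = cz z' \<Longrightarrow> z = z'" for z z' by (metis cz_def)
  have "(\<exists>!c. coords V {g} c m) \<longleftrightarrow> (\<exists>!z. z \<in> Z \<and> m = z \<cdot> g)" if m: "m \<in> carrier V" for m
    unfolding crd_cz[OF m] using cz_inj by blast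
  then show ?thesis unfolding module_basis_coords[OF V] using g by simp
qed

text \<open>Two generators differ by central factors that are inverse to each other, and units are
  scalars. This is the uniqueness up to a scalar of the Jacobian and of the arrangement.\<close>

lemma free_rank_one_gen_iff:
  assumes V: "mono_module V U" and U: "U = (+) e ` Ds" and e: "e \<in> E"
  shows "free_rank_one_gen ZR V g \<longleftrightarrow> (\<exists>c. c \<noteq> 0 \<and> g = skew_scale n p c (mono e))"
proof -
  let ?m = "mono e"
  have eU: "e \<in> U" unfolding U by (rule image_eqI[of _ _ 0]) simp_all
  have mV: "?m \<in> carrier V"
    by (rule VI[OF V]) (use e eU in \<open>simp_all add: mono_closed nf_mono\<close>)
  have mS: "?m \<in> carrier S" using mV V_S[OF V] by blast
  have "module_basis ZR V (mono ` {e})"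
    by (rule mono_basis[OF V, where \<pi> = "\<lambda>_. e"]) (use eU in \<open>auto simp: U add.commute\<close>)
  then have b: "\<exists>!z. z \<in> Z \<and> m = z \<cdot> ?m" if "m \<in> carrier V" for m
    using module_basis_singleton[OF V mV] that by simp
  have gen: "free_rank_one_gen ZR V g \<longleftrightarrow> g \<in> carrier V \<and> (\<forall>m\<in>carrier V. \<exists>!z. z \<in> Z \<and> m = z \<cdot> g)"
  proof (cases "g \<in> carrier V")
    case True
    then show ?thesis unfolding free_rank_one_gen_def module_basis_singleton[OF V True]
      using V_module[OF V] by (simp only: simp_thms)
  next
    case False
    then have "\<not> module_basis ZR V {g}" unfolding module_basis_coords[OF V] by blast
    then show ?thesis unfolding free_rank_one_gen_def using False by blast
  qed
  show ?thesis unfolding gen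
  proof (intro iffI conjI ballI)
    assume h: "g \<in> carrier V \<and> (\<forall>m\<in>carrier V. \<exists>!z. z \<in> Z \<and> m = z \<cdot> g)"
    from h have gV: "g \<in> carrier V" and h': "\<exists>!z. z \<in> Z \<and> ?m = z \<cdot> g" using mV by simp_all
    from ex1_implies_ex[OF b[OF gV]] obtain z where z: "z \<in> Z" "g = z \<cdot> ?m" by (elim exE conjE)
    from ex1_implies_ex[OF h'] obtain z' where z': "z' \<in> Z" "?m = z' \<cdot> g" by (elim exE conjE)
    have "?m = (z' \<cdot> z) \<cdot> ?m"
      using z'(2) z(2) S.m_assoc[OF Z_closed[OF z'(1)] Z_closed[OF z(1)] mS] by simp
    moreover have "?m = \<one>\<^bsub>S\<^esub> \<cdot> ?m" using mS by simp
    moreover have "z' \<cdot> z \<in> Z" "\<one>\<^bsub>S\<^esub> \<in> Z"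
      using Z_mult z z' cring.cring_simprules(6)[OF cring_ZR] by simp_all
    ultimately have "z' \<cdot> z = \<one>\<^bsub>S\<^esub>" using b[OF mV] by blast
    then have "nff z' \<star> nff z = sg 0 1" using nf_mult[of z' z] z z' Z_closed nf_one by metis
    then obtain c where c: "c \<noteq> 0" "nff z = sg 0 c" using unit_const by blast
    then have "z = skew_const n p c" using nf_inj[of z] z Z_closed const_closed nf_const by metis
    then show "\<exists>c. c \<noteq> 0 \<and> g = skew_scale n p c ?m" using c z by (auto simp: skew_scale_def)
  next
    assume "\<exists>c. c \<noteq> 0 \<and> g = skew_scale n p c ?m"
    then obtain c where c: "c \<noteq> 0" and g: "g = skew_const n p c \<cdot> ?m" by (auto simp: skew_scale_def)
    show gV: "g \<in> carrier V" unfolding g by (rule V_mult[OF V const_Z mV])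
    let ?c = "skew_const n p c" and ?i = "skew_const n p (inverse c)"
    have ci: "?i \<cdot> ?c = \<one>\<^bsub>S\<^esub>"
      by (rule nf_inj) (use c in \<open>simp_all add: const_closed nf_mult nf_const nf_one tmul_single\<close>)
    have ic: "?c \<cdot> ?i = \<one>\<^bsub>S\<^esub>"
      by (rule nf_inj) (use c in \<open>simp_all add: const_closed nf_mult nf_const nf_one tmul_single\<close>)
    fix m assume m: "m \<in> carrier V"
    obtain z where z: "z \<in> Z" "m = z \<cdot> ?m" and
      uniq: "\<And>z'. z' \<in> Z \<Longrightarrow> m = z' \<cdot> ?m \<Longrightarrow> z' = z" using b[OF m] by blast
    show "\<exists>!z. z \<in> Z \<and> m = z \<cdot> g"
    proof (rule ex1I[of _ "z \<cdot> ?i"], rule conjI)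
      show "z \<cdot> ?i \<in> Z" by (rule Z_mult[OF z(1) const_Z])
      have "z \<cdot> ?i \<cdot> g = z \<cdot> ((?i \<cdot> ?c) \<cdot> ?m)"
        unfolding g using z mS by (simp add: S.m_assoc Z_closed const_closed)
      then show "m = z \<cdot> ?i \<cdot> g" using z mS by (simp add: ci)
    next
      fix z' assume z': "z' \<in> Z \<and> m = z' \<cdot> g"
      then have "m = (z' \<cdot> ?c) \<cdot> ?m" unfolding g using mS by (simp add: S.m_assoc Z_closed const_closed)
      then have "z' \<cdot> ?c = z" using uniq z' Z_mult const_Z by blast
      then have "z \<cdot> ?i = z' \<cdot> (?c \<cdot> ?i)" using z' by (auto simp: S.m_assoc Z_closed const_closed)
      then show "z' = z \<cdot> ?i" using z' by (simp add: ic Z_closed)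
    qed
  qed
qed

section \<open>Invariants, homological determinant and semi-invariants\<close>

lemma fixed_ring_eq: "ozone_fixed_ring n p = ZR"
proof -
  have "{x \<in> carrier S. \<forall>\<sigma>\<in>carrier OG. \<sigma> x = x} = Z"
  proof (intro subset_antisym subsetI)
    fix x assume x: "x \<in> {x \<in> carrier S. \<forall>\<sigma>\<in>carrier OG. \<sigma> x = x}"
    have "a \<in> Ds" if a: "a \<in> ks (nff x)" for a
    proof -
      have "\<beta> b a = 1" if b: "b \<in> E" for b
      proof -
        have "sig b x = x" using x b OG_carrier by auto
        then have "lk (twist (\<beta> b) (nff x)) a = lk (nff x) a" using x nf_sig[of x b] by simp
        then show ?thesis using a by (simp add: lk_twist in_keys_iff)
      qed
      then show ?thesis using a x nf_closed by (auto simp: Ds_def)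
    qed
    then show "x \<in> Z" using x by (intro ZI) auto
  next
    fix x assume x: "x \<in> Z"
    have "sig b x = x" if b: "b \<in> E" for b
    proof (rule nf_inj)
      show "nff (sig b x) = nff x"
      proof (rule poly_mapping_eqI)
        fix a show "lk (nff (sig b x)) a = lk (nff x) a"
          using Z_ks[OF x] b x by (cases "a \<in> ks (nff x)") (auto simp: nf_sig Z_closed lk_twist Ds_def in_keys_iff)
      qed
    qed (use x in \<open>simp_all add: sig_closed Z_closed\<close>)
    then show "x \<in> {x \<in> carrier S. \<forall>\<sigma>\<in>carrier OG. \<sigma> x = x}" using x Z_closed OG_carrier by auto
  qed
  then show ?thesis by (simp add: ozone_fixed_ring_def skew_center_ring_def)
qed

lemma \<beta>_prod: "a \<in> E \<Longrightarrow> \<beta> b a = (\<Prod>s\<in>{1..n}. \<beta> b (ev s) ^ lk a s)"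
proof (induction a rule: expo_induct)
  case (add a i)
  have "(\<Prod>s\<in>{1..n}. \<beta> b (ev s) ^ lk (ev i) s) = (\<Prod>s\<in>{1..n}. if s = i then \<beta> b (ev i) else 1)"
    by (rule prod.cong) (auto simp: lookup_single when_def)
  then have "(\<Prod>s\<in>{1..n}. \<beta> b (ev s) ^ lk (ev i) s) = \<beta> b (ev i)" using add by (simp add: prod.delta)
  then show ?case using add by (simp add: bichar_add_right lookup_add power_add prod.distrib)
qed simp

definition ones :: "nat \<Rightarrow>\<^sub>0 nat" where "ones = rst {1..n} (\<lambda>_. 1)"

lemma ones_E: "ones \<in> E" by (simp add: ones_def rst_expo)
lemma lk_ones: "i \<in> {1..n} \<Longrightarrow> lk ones i = 1" by (simp add: ones_def lk_rst)

text \<open>The eigenvalue on a variable is unique, so the definite description in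
  \<open>hdet\<close> has a single candidate.\<close>

lemma sig_var: "i \<in> {1..n} \<Longrightarrow> sig b (skew_var n p i) = skew_scale n p c (skew_var n p i) \<longleftrightarrow> c = \<beta> b (ev i)"
proof -
  assume i: "i \<in> {1..n}"
  have v: "skew_var n p i \<in> carrier S" by (rule var_closed[OF i])
  have "sig b (skew_var n p i) = skew_scale n p c (skew_var n p i) \<longleftrightarrow>
      nff (sig b (skew_var n p i)) = nff (skew_scale n p c (skew_var n p i))"
    using nf_inj[OF sig_closed[OF v] scale_closed[OF v]] by auto
  also have "\<dots> \<longleftrightarrow> (\<forall>a. lk (nff (sig b (skew_var n p i))) a = lk (nff (skew_scale n p c (skew_var n p i))) a)"
    by (simp add: poly_mapping_eq_iff fun_eq_iff)
  also have "\<dots> \<longleftrightarrow> c = \<beta> b (ev i)"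
    by (auto simp: nf_sig v lk_twist lk_scale nf_var[OF i] lookup_single when_def)
  finally show ?thesis .
qed

lemma hdet_sig: "hdet n p (sig b) = \<beta> b ones"
proof -
  have "\<beta> b ones = (\<Prod>i = 1..n. \<beta> b (ev i))"
    by (simp add: \<beta>_prod[OF ones_E] lk_ones)
  then show ?thesis
    unfolding hdet_def
    by (intro the_equality) (auto simp: sig_var \<beta>_nz intro!: exI[of _ "\<lambda>i. \<beta> b (ev i)"] prod.cong)
qed

text \<open>The group acts diagonally, so the semi-invariants are spanned by monomials, and the
  eigenvalue condition on x^a says that a + x is central. The shift is \<open>ones\<close> for the
  inverse determinant and (l - 1) \<open>ones\<close>, standing for its negative, for the
  determinant.\<close>

lemma semi_invariants:
  assumes f: "\<And>b a. b \<in> E \<Longrightarrow> a \<in> E \<Longrightarrow> \<beta> b a = f (\<beta> b ones) \<longleftrightarrow> \<beta> b (a + x) = 1" and x: "x \<in> E"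
  shows "{s \<in> carrier S. \<forall>\<sigma>\<in>carrier OG. \<sigma> s = skew_scale n p (f (hdet n p \<sigma>)) s} =
    {s \<in> carrier S. ks (nff s) \<subseteq> {a \<in> E. a + x \<in> Ds}}"
proof (intro Collect_cong conj_cong refl)
  fix s assume s: "s \<in> carrier S"
  have "(\<forall>\<sigma>\<in>carrier OG. \<sigma> s = skew_scale n p (f (hdet n p \<sigma>)) s) \<longleftrightarrow>
      (\<forall>b\<in>E. sig b s = skew_scale n p (f (\<beta> b ones)) s)"
    by (simp add: OG_carrier hdet_sig)
  also have "\<dots> \<longleftrightarrow> (\<forall>b\<in>E. \<forall>a\<in>ks (nff s). \<beta> b a = f (\<beta> b ones))"
  proof (rule ball_cong[OF refl])
    fix b assume "b \<in> E"
    have "sig b s = skew_scale n p (f (\<beta> b ones)) s \<longleftrightarrow> nff (sig b s) = nff (skew_scale n p (f (\<beta> b ones)) s)"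
      using nf_inj[OF sig_closed[OF s] scale_closed[OF s]] by auto
    also have "\<dots> \<longleftrightarrow> (\<forall>a. \<beta> b a * lk (nff s) a = f (\<beta> b ones) * lk (nff s) a)"
      by (simp add: poly_mapping_eq_iff fun_eq_iff nf_sig s lk_twist lk_scale)
    also have "\<dots> \<longleftrightarrow> (\<forall>a\<in>ks (nff s). \<beta> b a = f (\<beta> b ones))"
      by (auto simp: in_keys_iff)
    finally show "sig b s = skew_scale n p (f (\<beta> b ones)) s \<longleftrightarrow> (\<forall>a\<in>ks (nff s). \<beta> b a = f (\<beta> b ones))" .
  qed
  also have "\<dots> \<longleftrightarrow> (\<forall>a\<in>ks (nff s). \<forall>b\<in>E. \<beta> b (a + x) = 1)"
    using nf_closed[OF s] f by blast
  also have "\<dots> \<longleftrightarrow> ks (nff s) \<subseteq> {a \<in> E. a + x \<in> Ds}"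
    using nf_closed[OF s] x unfolding Ds_def by (auto simp: expo_add_iff subset_iff)
  finally show "(\<forall>\<sigma>\<in>carrier OG. \<sigma> s = skew_scale n p (f (hdet n p \<sigma>)) s) \<longleftrightarrow>
      ks (nff s) \<subseteq> {a \<in> E. a + x \<in> Ds}" .
qed

lemma semi_invariants_gen:
  assumes e: "e \<in> E" and x: "x \<in> E" and U: "{a \<in> E. a + x \<in> Ds} = (+) e ` Ds"
  defines "M \<equiv> {s \<in> carrier S. ks (nff s) \<subseteq> {a \<in> E. a + x \<in> Ds}}"
  shows "free_rank_one_gen ZR (left_module S M) g \<and> free_rank_one_gen ZR (right_module S M) g
    \<longleftrightarrow> (\<exists>c. c \<noteq> 0 \<and> g = skew_scale n p c (mono e))"
proof -
  have U1: "{a \<in> E. a + x \<in> Ds} \<subseteq> E" by blast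
  have U2: "d + a \<in> {a \<in> E. a + x \<in> Ds}" if "d \<in> Ds" "a \<in> {a \<in> E. a + x \<in> Ds}" for d a
    using that Ds_add[of d "a + x"] by (auto simp: add.assoc expo_add_iff Ds_E)
  show ?thesis unfolding M_def
    using free_rank_one_gen_iff[OF mono_module_left[OF U1 U2] U e]
      free_rank_one_gen_iff[OF mono_module_right[OF U1 U2] U e] by blast
qed

lemma \<beta>_inverse_iff: "\<beta> b a = inverse (\<beta> b x) \<longleftrightarrow> \<beta> b (a + x) = 1"
  using \<beta>_nz[of b x] by (auto simp: bichar_add_right field_simps)

lemma \<beta>_eq_iff: "\<beta> b a = \<beta> b x \<longleftrightarrow> \<beta> b (a + sc (l - 1) x) = 1"
proof -
  have "\<beta> b (sc (l - 1) x) * \<beta> b x = 1"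
    using \<beta>_l[of b x] l_pos by (metis One_nat_def Suc_pred bichar_sc_right power_Suc2)
  then have e: "\<beta> b (sc (l - 1) x) = inverse (\<beta> b x)" using \<beta>_nz[of b x] by (simp add: field_simps)
  show ?thesis unfolding bichar_add_right e using \<beta>_nz[of b x] by (auto simp: field_simps)
qed

text \<open>In the regular case the condition splits into congruences modulo w_i, one per entry. The
  hypothesis says that e_i is the least nonnegative solution of the i-th congruence, so the
  solutions are e + Ds.\<close>

lemma translate_Ds:
  assumes reg: reg and e: "e \<in> E" and x: "x \<in> E"
    and h: "\<And>i k. i \<in> {1..n} \<Longrightarrow> wi i dvd k + lk x i \<longleftrightarrow> lk e i \<le> k \<and> wi i dvd k - lk e i"
  shows "{a \<in> E. a + x \<in> Ds} = (+) e ` Ds"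
proof (intro subset_antisym subsetI)
  fix a assume a: "a \<in> {a \<in> E. a + x \<in> Ds}"
  have w: "lk e i \<le> lk a i \<and> wi i dvd lk a i - lk e i" if "i \<in> {1..n}" for i
    using a h[OF that, of "lk a i"] reg that unfolding reg_def by (auto simp: lookup_add)
  let ?d = "rst {1..n} (\<lambda>i. lk a i - lk e i)"
  have "?d \<in> Ds" by (rule dvd_Ds) (use w in \<open>auto simp: rst_expo lk_rst\<close>)
  moreover have "a = e + ?d"
  proof (rule poly_mapping_eqI)
    fix i show "lk a i = lk (e + ?d) i"
      using w[of i] expo_out[of a n i] expo_out[OF e, of i] a by (cases "i \<in> {1..n}") (auto simp: lookup_add lk_rst)
  qed
  ultimately show "a \<in> (+) e ` Ds" by blast
next
  fix a assume "a \<in> (+) e ` Ds"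
  then obtain d where d: "d \<in> Ds" "a = e + d" by blast
  have aE: "a \<in> E" using d e Ds_E by auto
  have "a + x \<in> Ds"
  proof (rule dvd_Ds)
    show "a + x \<in> E" using aE x by blast
    fix i assume i: "i \<in> {1..n}"
    have "wi i dvd lk d i" using reg d i by (simp add: reg_def)
    then show "wi i dvd lk (a + x) i" using h[OF i, of "lk a i"] d by (simp add: lookup_add)
  qed
  then show "a \<in> {a \<in> E. a + x \<in> Ds}" using aE by blast
qed

lemma jacobian_iff:
  assumes reg: reg
  shows "is_jacobian n p g \<longleftrightarrow> (\<exists>c. c \<noteq> 0 \<and> g = skew_scale n p c (ozone_jacobian n p))"
proof -
  let ?e = "rst {1..n} (\<lambda>i. fi i - 1)"
  have e: "?e \<in> E" by (rule rst_expo)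
  have U: "{a \<in> E. a + ones \<in> Ds} = (+) ?e ` Ds"
  proof (rule translate_Ds[OF reg e ones_E])
    fix i k assume i: "i \<in> {1..n}"
    have w: "wi i > 0" and f: "fi i = wi i" using wi[OF i] reg reg_iff_fi i by auto
    \<comment> \<open>The congruence k = -1 modulo w_i has least solution w_i - 1, the exponent of
      the ozone Jacobian.\<close>
    have "wi i dvd k + 1 \<longleftrightarrow> wi i - 1 \<le> k \<and> wi i dvd k - (wi i - 1)"
    proof
      assume d: "wi i dvd k + 1"
      then have "wi i \<le> k + 1" by (rule dvd_imp_le) simp
      moreover have "k - (wi i - 1) = (k + 1) - wi i" using w by simp
      ultimately show "wi i - 1 \<le> k \<and> wi i dvd k - (wi i - 1)" using d by (auto intro: dvd_diff_nat)
    next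
      assume d: "wi i - 1 \<le> k \<and> wi i dvd k - (wi i - 1)"
      have "k + 1 = (k - (wi i - 1)) + wi i" using w d by arith
      then show "wi i dvd k + 1" using d by (metis dvd_add dvd_refl)
    qed
    then show "wi i dvd k + lk ones i \<longleftrightarrow> lk ?e i \<le> k \<and> wi i dvd k - lk ?e i"
      using i f by (simp add: lk_ones lk_rst)
  qed
  have M: "hdet_inv_semi_invariants n p = {s \<in> carrier S. ks (nff s) \<subseteq> {a \<in> E. a + ones \<in> Ds}}"
    unfolding hdet_inv_semi_invariants_def
    by (rule semi_invariants[where f = inverse]) (simp_all add: \<beta>_inverse_iff ones_E)
  show ?thesis
    unfolding is_jacobian_def fixed_ring_eq M semi_invariants_gen[OF e ones_E U]
    by (simp add: ozone_jacobian_def monom_eq)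
qed

lemma arrangement_iff:
  assumes reg: reg
  shows "is_reflection_arrangement n p g \<longleftrightarrow> (\<exists>c. c \<noteq> 0 \<and> g = skew_scale n p c (ozone_arrangement n p))"
proof -
  let ?e = "rst {1..n} (\<lambda>i. if fi i > 1 then 1 else 0)" and ?x = "sc (l - 1) ones"
  have e: "?e \<in> E" by (rule rst_expo)
  have x: "?x \<in> E" using ones_E by (rule sc_expo)
  have U: "{a \<in> E. a + ?x \<in> Ds} = (+) ?e ` Ds"
  proof (rule translate_Ds[OF reg e x])
    fix i k assume i: "i \<in> {1..n}"
    have w: "wi i > 0" and f: "fi i = wi i" and wl: "wi i dvd l" using wi[OF i] reg reg_iff_fi i wi_dvd_l by auto
    \<comment> \<open>As w_i divides \<open>l\<close>, this is the congruence k = 1 modulo w_i. Its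
      least solution is 1, except that it is 0 when w_i = 1; this is why the arrangement omits
      variables with f_i = 1.\<close>
    have "wi i dvd k + (l - 1) \<longleftrightarrow> (if wi i > 1 then 1 else 0) \<le> k \<and> wi i dvd k - (if wi i > 1 then 1 else 0)"
    proof (cases "wi i > 1")
      case True
      show ?thesis
      proof (cases "k = 0")
        case k: True
        have "\<not> wi i dvd l - 1"
        proof
          assume "wi i dvd l - 1"
          then have "wi i dvd l - (l - 1)" using wl by (rule dvd_diff_nat[rotated])
          then show False using True l_pos by simp
        qed
        then show ?thesis using True k by simp
      next
        case False
        then have e: "k + (l - 1) = (k - 1) + l" using l_pos by simp
        have "wi i dvd k + (l - 1) \<longleftrightarrow> wi i dvd k - 1" unfolding e using wl by (rule dvd_add_left_iff)
        then show ?thesis using True False by simp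
      qed
    next
      case False
      then have "wi i = 1" using w by simp
      then show ?thesis by simp
    qed
    then show "wi i dvd k + lk ?x i \<longleftrightarrow> lk ?e i \<le> k \<and> wi i dvd k - lk ?e i"
      using i f by (simp add: lk_ones lk_rst)
  qed
  have M: "hdet_semi_invariants n p = {s \<in> carrier S. ks (nff s) \<subseteq> {a \<in> E. a + ?x \<in> Ds}}"
    unfolding hdet_semi_invariants_def
    by (rule semi_invariants[where f = "\<lambda>t. t"]) (simp_all add: \<beta>_eq_iff x)
  show ?thesis
    unfolding is_reflection_arrangement_def fixed_ring_eq M semi_invariants_gen[OF e x U]
    by (simp add: ozone_arrangement_def monom_eq)
qed

end

section \<open>Polynomial centers\<close>

text \<open>Elimination: more vectors than coordinates are dependent. A vector with nonzero g-entry
  serves as pivot, clears that coordinate from the others, and is removed together with it.\<close>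

lemma linear_dependence:
  fixes v :: "'a \<Rightarrow> 'g \<Rightarrow> 'k::field"
  assumes "finite G" "finite A" "card G < card A"
  shows "\<exists>u. (\<exists>a\<in>A. u a \<noteq> 0) \<and> (\<forall>g\<in>G. (\<Sum>a\<in>A. u a * v a g) = 0)"
  using assms
proof (induction G arbitrary: A v rule: finite_induct)
  case empty
  then have "A \<noteq> {}" by auto
  then show ?case by (intro exI[of _ "\<lambda>_. 1"]) auto
next
  case (insert g G)
  show ?case
  proof (cases "\<forall>a\<in>A. v a g = 0")
    case True
    have "card G < card A" using insert by simp
    then obtain u where "\<exists>a\<in>A. u a \<noteq> 0" "\<forall>g\<in>G. (\<Sum>a\<in>A. u a * v a g) = 0"
      using insert.IH[OF insert.prems(1), of v] by blast
    then show ?thesis using True by (intro exI[of _ u]) simp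
  next
    case False
    then obtain a0 where a0: "a0 \<in> A" "v a0 g \<noteq> 0" by blast
    let ?A = "A - {a0}"
    have A: "finite ?A" "card G < card ?A" using insert a0 by (auto simp: card_Diff_singleton_if)
    define v' where "v' a h = v a h - v a g / v a0 g * v a0 h" for a h
    obtain u where u: "\<exists>a\<in>?A. u a \<noteq> 0" "\<forall>h\<in>G. (\<Sum>a\<in>?A. u a * v' a h) = 0"
      using insert.IH[OF A, of v'] by blast
    \<comment> \<open>The coefficient of the pivot undoes the elimination, so that the original
      combination equals the reduced one.\<close>
    define u' where "u' = u(a0 := - (\<Sum>a\<in>?A. u a * v a g) / v a0 g)"
    have sum: "(\<Sum>a\<in>A. u' a * v a h) = (\<Sum>a\<in>?A. u a * v' a h)" for h
    proof -
      have "(\<Sum>a\<in>A. u' a * v a h) = u' a0 * v a0 h + (\<Sum>a\<in>?A. u' a * v a h)"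
        using insert.prems(1) a0(1) by (rule sum.remove)
      also have "(\<Sum>a\<in>?A. u' a * v a h) = (\<Sum>a\<in>?A. u a * v a h)"
        by (rule sum.cong) (auto simp: u'_def)
      also have "u' a0 * v a0 h = - (\<Sum>a\<in>?A. u a * (v a g / v a0 g * v a0 h))"
        by (simp add: u'_def sum_distrib_right sum_divide_distrib sum_negf[symmetric] mult.assoc)
      finally show ?thesis by (simp add: v'_def right_diff_distrib sum_subtractf)
    qed
    have "(\<Sum>a\<in>A. u' a * v a g) = 0"
      unfolding sum using a0 by (simp add: v'_def)
    moreover have "\<exists>a\<in>A. u' a \<noteq> 0" using u(1) by (auto simp: u'_def)
    ultimately show ?thesis using u(2) by (intro exI[of _ u']) (simp add: sum)
  qed
qed

lemma mpoly_ring_simps [simp]: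
  "carrier (mpoly_ring m) = {f. ks f \<subseteq> expo m}" "monoid.mult (mpoly_ring m) = (*)"
  "\<one>\<^bsub>mpoly_ring m\<^esub> = 1" "ring.zero (mpoly_ring m) = 0" "ring.add (mpoly_ring m) = (+)"
  by (auto simp: mpoly_ring_def ring_of_type_algebra_def expo_def)

definition tdeg :: "nat \<Rightarrow> (nat \<Rightarrow>\<^sub>0 nat) \<Rightarrow> nat" where
  "tdeg n a = (\<Sum>i\<in>{1..n}. lk a i)"

lemma tdeg_add: "tdeg n (a + b) = tdeg n a + tdeg n b"
  by (simp add: tdeg_def lookup_add sum.distrib)

lemma tdeg_eq_0: "a \<in> expo n \<Longrightarrow> tdeg n a = 0 \<longleftrightarrow> a = 0"
proof
  assume a: "a \<in> expo n" and "tdeg n a = 0"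
  then have "lk a i = 0" for i using expo_out[OF a, of i] by (cases "i \<in> {1..n}") (auto simp: tdeg_def)
  then show "a = 0" by (intro poly_mapping_eqI) simp
qed (simp add: tdeg_def)

lemma tdeg_ev: "i \<in> {1..n} \<Longrightarrow> tdeg n (ev i) = 1"
  by (simp add: tdeg_def lookup_single when_def sum.delta')

context ozone
begin

section \<open>From regularity to a polynomial center\<close>

definition "stretch a = rst {1..n} (\<lambda>i. wi i * lk a i)"

lemma lk_stretch: "i \<in> {1..n} \<Longrightarrow> lk (stretch a) i = wi i * lk a i"
  by (simp add: stretch_def lk_rst)
lemma stretch_E: "stretch a \<in> E" by (simp add: stretch_def rst_expo)
lemma stretch_Ds: "stretch a \<in> Ds" by (rule dvd_Ds) (simp_all add: stretch_E lk_stretch)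
lemma stretch_add: "stretch (a + b) = stretch a + stretch b"
  by (rule poly_mapping_eqI) (simp add: stretch_def lk_rst lookup_add distrib_left)
lemma stretch_0: "stretch 0 = 0"
  by (rule poly_mapping_eqI) (simp add: stretch_def lk_rst)
lemma stretch_inj: "a \<in> E \<Longrightarrow> b \<in> E \<Longrightarrow> stretch a = stretch b \<Longrightarrow> a = b"
proof (rule poly_mapping_eqI)
  fix i assume a: "a \<in> E" and b: "b \<in> E" and e: "stretch a = stretch b"
  show "lk a i = lk b i"
  proof (cases "i \<in> {1..n}")
    case True
    have "wi i * lk a i = wi i * lk b i" using e lk_stretch[OF True] by metis
    then show ?thesis using wi[OF True] by simp
  next
    case False
    then show ?thesis using a b expo_out by metis
  qed
qed
lemma stretch_surj: "reg \<Longrightarrow> d \<in> Ds \<Longrightarrow> \<exists>a\<in>E. stretch a = d"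
proof
  assume reg: reg and d: "d \<in> Ds"
  let ?a = "rst {1..n} (\<lambda>i. lk d i div wi i)"
  show "?a \<in> E" by (rule rst_expo)
  show "stretch ?a = d"
  proof (rule poly_mapping_eqI)
    fix i show "lk (stretch ?a) i = lk d i"
      using reg d expo_out[OF Ds_E[OF d], of i]
      by (cases "i \<in> {1..n}") (auto simp: stretch_def lk_rst reg_def)
  qed
qed

lemma p_wi: "i \<in> {1..n} \<Longrightarrow> j \<in> {1..n} \<Longrightarrow> p i j ^ wi j = 1"
proof -
  assume i: "i \<in> {1..n}" and j: "j \<in> {1..n}"
  have "\<beta> (ev i) (sg j (wi j)) = 1" using wi[OF j] i by (auto simp: Ds_def expo_single)
  then show ?thesis using \<beta>_ev[OF i j] bichar_sc_right[of n p "ev i" "wi j" "ev j"] sg_sc[of j "wi j"] by simp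
qed

text \<open>Every factor contains p_ij^(w_j), which is 1 as x_j^(w_j) is central. On stretched
  exponents the twisted product is the ordinary product of polynomials.\<close>

lemma coc_stretch: "coc (stretch a) (stretch b) = 1"
  unfolding cocyc_def
proof (intro prod.neutral ballI)
  fix j i assume j: "j \<in> {1..n}" and "i \<in> {1..<j}"
  then have i: "i \<in> {1..n}" by auto
  have "p i j ^ (lk (stretch a) j * lk (stretch b) i) = (p i j ^ wi j) ^ (lk a j * (wi i * lk b i))"
    by (simp add: lk_stretch[OF i] lk_stretch[OF j] power_mult[symmetric] mult_ac)
  then show "p i j ^ (lk (stretch a) j * lk (stretch b) i) = 1" by (simp add: p_wi[OF i j])
qed

text \<open>The isomorphism sends the i-th variable to x_i^(w_i); its image is all of
  \<open>Z\<close> because every central exponent is stretched.\<close>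

lemma reg_imp_regular: "reg \<Longrightarrow> center_regular n p"
proof -
  assume reg: reg
  define H where "H f = lext (\<lambda>a x. sg (stretch a) (x::'k)) f" for f
  have H_add: "H (f + g) = H f + H g" for f g
    unfolding H_def by (rule lext_add) (simp_all add: single_add)
  have H_single: "H (sg a x) = sg (stretch a) x" for a x by (simp add: H_def lext_single)
  have H_0: "H 0 = 0" by (simp add: H_def)
  have H_mult: "H (f * g) = H f \<star> H g" for f g
  proof -
    have "ks f \<subseteq> UNIV" by simp
    then show ?thesis
    proof (induction rule: pm_induct)
      case (single a x)
      have "ks g \<subseteq> UNIV" by simp
      then show ?case
        by (induction rule: pm_induct)
          (simp_all add: mult_single H_single tmul_single stretch_add coc_stretch H_add tmul_add_right distrib_left H_0)
    qed (simp_all add: H_add tmul_add_left distrib_right H_0)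
  qed
  have H_ks: "ks (H f) \<subseteq> Ds" for f
    unfolding H_def by (rule order_trans[OF ks_lext]) (auto simp: stretch_Ds split: if_splits)
  have H_E: "ks (H f) \<subseteq> E" for f using H_ks Ds_E by blast
  have H_lk: "lk (H f) (stretch a) = lk f a" if "ks f \<subseteq> E" "a \<in> E" for f a
    using that(1)
  proof (induction rule: pm_induct)
    case (single b x)
    then show ?case using stretch_inj[OF \<open>a \<in> E\<close> single] by (auto simp: H_single lookup_single when_def)
  qed (simp_all add: H_0 H_add lookup_add)
  have H_surj: "\<exists>f. ks f \<subseteq> E \<and> H f = F" if "ks F \<subseteq> Ds" for F
    using that
  proof (induction rule: pm_induct)
    case zero then show ?case by (intro exI[of _ 0]) (simp add: H_0)
  next
    case (single d x)
    then obtain a where "a \<in> E" "stretch a = d" using stretch_surj[OF reg] by blast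
    then show ?case by (intro exI[of _ "sg a x"]) (simp add: H_single)
  next
    case (add F G)
    then obtain f g where fg: "ks f \<subseteq> E" "H f = F" "ks g \<subseteq> E" "H g = G" by blast
    then have "ks (f + g) \<subseteq> E" using Poly_Mapping.keys_add[of f g] by blast
    then show ?case using fg by (intro exI[of _ "f + g"]) (simp add: H_add)
  qed
  let ?h = "\<lambda>f. cl (H f)"
  have iso: "?h \<in> ring_iso (mpoly_ring n) ZR"
    unfolding ring_iso_def
  proof (intro CollectI conjI)
    show "?h \<in> ring_hom (mpoly_ring n) ZR"
    proof (rule ring_hom_memI)
      fix f g :: "(nat \<Rightarrow>\<^sub>0 nat) \<Rightarrow>\<^sub>0 'k"
      show "?h f \<in> carrier ZR" using cl_Z[OF H_ks] by simp
      show "?h (f \<otimes>\<^bsub>mpoly_ring n\<^esub> g) = ?h f \<otimes>\<^bsub>ZR\<^esub> ?h g"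
        by (rule nf_inj) (auto simp: cl_closed H_E nf_mult nf_cl H_mult[symmetric])
      show "?h (f \<oplus>\<^bsub>mpoly_ring n\<^esub> g) = ?h f \<oplus>\<^bsub>ZR\<^esub> ?h g"
        using cl_add[OF H_E H_E] by (simp add: H_add)
    next
      show "?h \<one>\<^bsub>mpoly_ring n\<^esub> = \<one>\<^bsub>ZR\<^esub>"
        by (rule nf_inj) (simp_all add: cl_closed nf_one nf_cl single_one[symmetric] H_single stretch_0 del: single_one)
    qed
    show "bij_betw ?h (carrier (mpoly_ring n)) (carrier ZR)"
      unfolding bij_betw_def
    proof (intro conjI subset_antisym subsetI)
      show "inj_on ?h (carrier (mpoly_ring n))"
      proof (rule inj_onI)
        fix f g assume f: "f \<in> carrier (mpoly_ring n)" and g: "g \<in> carrier (mpoly_ring n)" and e: "?h f = ?h g"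
        have HH: "H f = H g" using arg_cong[OF e, of nff] by (simp add: nf_cl H_E)
        show "f = g"
        proof (rule poly_mapping_eqI)
          fix a show "lk f a = lk g a"
          proof (cases "a \<in> E")
            case True
            then show ?thesis using H_lk[of f a] H_lk[of g a] f g HH by simp
          next
            case False
            then have "a \<notin> ks f" "a \<notin> ks g" using f g by auto
            then show ?thesis by (simp add: in_keys_iff)
          qed
        qed
      qed
    next
      fix z assume "z \<in> ?h ` carrier (mpoly_ring n)"
      then show "z \<in> carrier ZR" using cl_Z[OF H_ks] by auto
    next
      fix z assume "z \<in> carrier ZR"
      then have z: "z \<in> Z" by simp
      obtain f where f: "ks f \<subseteq> E" "H f = nff z" using H_surj[OF Z_ks[OF z]] by blast
      then have "z = ?h f" using cl_nf[OF Z_closed[OF z]] by simp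
      then show "z \<in> ?h ` carrier (mpoly_ring n)" using f(1) by (intro image_eqI[of z ?h f]) simp_all
    qed
  qed
  have "\<forall>c. ?h (sg 0 c) = skew_const n p c" by (simp add: H_single stretch_0 const_eq)
  then show ?thesis unfolding center_regular_def using iso by - (rule exI[of _ n], rule bexI[of _ ?h])
qed

section \<open>Indecomposable central exponents and polynomial parametrisations\<close>

definition atom :: "(nat \<Rightarrow>\<^sub>0 nat) \<Rightarrow> bool" where
  "atom a \<longleftrightarrow> a \<in> Ds \<and> a \<noteq> 0 \<and> (\<forall>x\<in>Ds. \<forall>y\<in>Ds. a = x + y \<longrightarrow> x = 0 \<or> y = 0)"

lemma atom_wi: "i \<in> {1..n} \<Longrightarrow> atom (sg i (wi i))"
  unfolding atom_def
proof (intro conjI ballI impI)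
  assume i: "i \<in> {1..n}"
  show "sg i (wi i) \<in> Ds" using wi[OF i] by blast
  show "sg i (wi i) \<noteq> 0"
  proof
    assume "sg i (wi i) = 0"
    then have "lk (sg i (wi i)) i = 0" by simp
    then show False using wi[OF i] by simp
  qed
  fix x y assume x: "x \<in> Ds" and y: "y \<in> Ds" and e: "sg i (wi i) = x + y"
  have ex: "lk x j + lk y j = (if j = i then wi i else 0)" for j
    using arg_cong[OF e, of "\<lambda>a. lk a j"] by (auto simp: lookup_add lookup_single when_def)
  have xs: "x = sg i (lk x i)"
  proof (rule poly_mapping_eqI)
    fix k show "lk x k = lk (sg i (lk x i)) k" using ex[of k] by (auto simp: lookup_single when_def split: if_splits)
  qed
  have ys: "y = sg i (lk y i)"
  proof (rule poly_mapping_eqI)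
    fix k show "lk y k = lk (sg i (lk y i)) k" using ex[of k] by (auto simp: lookup_single when_def split: if_splits)
  qed
  \<comment> \<open>Both summands lie on the i-th axis, and their entries are multiples of w_i with
    sum w_i.\<close>
  have "wi i dvd lk x i" using x wi_dvd_iff[OF i, of "lk x i"] xs by simp
  then have "lk x i = 0 \<or> wi i \<le> lk x i" using dvd_imp_le by blast
  then have "lk x i = 0 \<or> lk y i = 0" using ex[of i] by auto
  then show "x = 0 \<or> y = 0" using xs ys by (metis single_zero)
qed

lemma not_reg_atoms:
  assumes "\<not> reg"
  shows "\<exists>At. finite At \<and> card At = n + 1 \<and> (\<forall>a\<in>At. atom a)"
proof -
  let ?P = "\<lambda>d. d \<in> Ds \<and> (\<exists>i\<in>{1..n}. \<not> wi i dvd lk d i)"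
  have "\<exists>d. ?P d" using assms unfolding reg_def by blast
  \<comment> \<open>A counterexample of least degree is indecomposable, since summands of smaller
    degree would have all entries divisible by w_i. It joins the n exponents w_i e_i.\<close>
  then obtain d where d: "?P d" and min: "\<And>y. ?P y \<Longrightarrow> tdeg n d \<le> tdeg n y"
    using ex_has_least_nat[of ?P _ "tdeg n"] by blast
  have "atom d"
    unfolding atom_def
  proof (intro conjI ballI impI)
    show "d \<in> Ds" "d \<noteq> 0" using d by auto
    fix x y assume x: "x \<in> Ds" and y: "y \<in> Ds" and e: "d = x + y"
    show "x = 0 \<or> y = 0"
    proof (rule ccontr)
      assume "\<not> (x = 0 \<or> y = 0)"
      then have "tdeg n x > 0" "tdeg n y > 0" using tdeg_eq_0 x y Ds_E by (auto intro: Nat.gr0I)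
      then have "tdeg n x < tdeg n d" "tdeg n y < tdeg n d" by (simp_all add: e tdeg_add)
      then have "\<not> ?P x" "\<not> ?P y" using min by (meson not_le)+
      then have "\<forall>i\<in>{1..n}. wi i dvd lk d i" using x y by (auto simp: e lookup_add)
      then show False using d by blast
    qed
  qed
  moreover have "d \<notin> (\<lambda>i. sg i (wi i)) ` {1..n}"
    using d by (auto simp: lookup_single when_def split: if_splits)
  moreover have "inj_on (\<lambda>i. sg i (wi i)) {1..n}"
  proof (rule inj_onI)
    fix i j assume i: "i \<in> {1..n}" and e: "sg i (wi i) = sg j (wi j)"
    have "lk (sg j (wi j)) i > 0" using wi[OF i] unfolding e[symmetric] by simp
    then show "i = j" by (auto simp: lookup_single when_def split: if_splits)
  qed
  ultimately show ?thesis using atom_wi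
    by (intro exI[of _ "insert d ((\<lambda>i. sg i (wi i)) ` {1..n})"]) (auto simp: card_image)
qed

text \<open>An indecomposable exponent splits only as 0 + a and a + 0, so its coefficient is a point
  derivation at the augmentation \<open>lk F 0\<close>.\<close>

lemma atom_tmul:
  assumes a: "atom a"
  shows "ks F \<subseteq> Ds \<Longrightarrow> ks G \<subseteq> Ds \<Longrightarrow> lk (F \<star> G) a = lk F 0 * lk G a + lk F a * lk G 0"
proof (induction rule: pm_induct)
  case (single x c)
  from \<open>ks G \<subseteq> Ds\<close> show ?case
  proof (induction rule: pm_induct)
    case (single y e)
    have "x = 0 \<or> y = 0" if "x + y = a" using a single \<open>x \<in> Ds\<close> that unfolding atom_def by blast
    moreover have "a \<noteq> 0" using a unfolding atom_def by blast
    ultimately show ?case by (auto simp: tmul_single lookup_single when_def)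
  qed (simp_all add: tmul_add_right lookup_add algebra_simps)
qed (simp_all add: tmul_add_left lookup_add algebra_simps)

context
  fixes m :: nat and H :: "((nat \<Rightarrow>\<^sub>0 nat) \<Rightarrow>\<^sub>0 'k) \<Rightarrow> ((nat \<Rightarrow>\<^sub>0 nat) \<Rightarrow>\<^sub>0 'k)"
  assumes H_add: "\<And>f g. ks f \<subseteq> expo m \<Longrightarrow> ks g \<subseteq> expo m \<Longrightarrow> H (f + g) = H f + H g"
    and H_mult: "\<And>f g. ks f \<subseteq> expo m \<Longrightarrow> ks g \<subseteq> expo m \<Longrightarrow> H (f * g) = H f \<star> H g"
    and H_const: "\<And>c. H (sg 0 c) = sg 0 c"
    and H_Ds: "\<And>f. ks f \<subseteq> expo m \<Longrightarrow> ks (H f) \<subseteq> Ds"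
    and H_inj: "\<And>f g. ks f \<subseteq> expo m \<Longrightarrow> ks g \<subseteq> expo m \<Longrightarrow> H f = H g \<Longrightarrow> f = g"
    and H_surj: "\<And>F. ks F \<subseteq> Ds \<Longrightarrow> \<exists>f. ks f \<subseteq> expo m \<and> H f = F"
begin

lemma H_zero: "H 0 = 0"
  using H_const[of 0] by simp

lemma H_scale: "a \<in> expo m \<Longrightarrow> lk (H (sg a x)) g = x * lk (H (sg a 1)) g"
proof -
  assume a: "a \<in> expo m"
  have "H (sg 0 x * sg a 1) = sg 0 x \<star> H (sg a 1)"
    using H_mult[of "sg 0 x" "sg a 1"] a by (simp add: H_const split: if_splits)
  then show ?thesis using lk_tmul_single_left[of n p 0 x "H (sg a 1)" g] by (simp add: mult_single)
qed

text \<open>Growth: the monomials in the \<open>m\<close> generators with exponents below \<open>R\<close> map to linearly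
  independent elements of a space of dimension \<open>O(R\<^sup>n)\<close>.\<close>

lemma param_le: "m \<le> n"
proof (rule ccontr)
  assume "\<not> m \<le> n"
  \<comment> \<open>A common bound for the degrees in the images of the variables; degrees of images
    of monomials then grow by a factor of at most B.\<close>
  define B where "B = (\<Sum>j\<in>{1..m}. \<Sum>a\<in>ks (H (sg (ev j) 1)). tdeg n a)"
  have gen: "tdeg n a \<le> B" if j: "j \<in> {1..m}" and a: "a \<in> ks (H (sg (ev j) 1))" for j a
  proof -
    have "tdeg n a \<le> (\<Sum>a\<in>ks (H (sg (ev j) 1)). tdeg n a)" by (rule member_le_sum) (use a in auto)
    also have "\<dots> \<le> B" unfolding B_def by (rule member_le_sum) (use j in auto)
    finally show ?thesis .
  qed
  have bound: "\<forall>g\<in>ks (H (sg a 1)). tdeg n g \<le> B * tdeg m a" if "a \<in> expo m" for a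
    using that
  proof (induction rule: expo_induct)
    case zero then show ?case by (simp add: H_const tdeg_def)
  next
    case (add a i)
    have "H (sg (ev i + a) 1) = H (sg (ev i) 1) \<star> H (sg a 1)"
      using H_mult[of "sg (ev i) 1" "sg a 1"] add by (simp add: mult_single expo_single)
    show ?case
    proof
      fix g assume "g \<in> ks (H (sg (ev i + a) 1))"
      then obtain x y where "g = x + y" "x \<in> ks (H (sg (ev i) 1))" "y \<in> ks (H (sg a 1))"
        using ks_tmul[of n p "H (sg (ev i) 1)" "H (sg a 1)"]
        unfolding \<open>H (sg (ev i + a) 1) = H (sg (ev i) 1) \<star> H (sg a 1)\<close> by blast
      then have "tdeg n g \<le> B + B * tdeg m a" using gen add by (auto simp: tdeg_add intro!: add_mono)
      then show "tdeg n g \<le> B * tdeg m (ev i + a)" using add by (simp add: tdeg_add tdeg_ev distrib_left)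
    qed
  qed
  \<comment> \<open>Chosen to exceed (B m + 1)^n. The target box has at most ((B m + 1) R)^n < R^(n
    + 1) elements, whereas m > n provides at least R^(n + 1) monomials.\<close>
  define R where "R = (B * m + 1) ^ n + 1"
  have R: "R \<ge> 1" by (simp add: R_def)
  define A where "A = box m (\<lambda>_. R)"
  define G where "G = box n (\<lambda>_. B * (m * R) + 1)"
  have "card G = (B * (m * R) + 1) ^ n" by (simp add: G_def card_box)
  also have "\<dots> \<le> ((B * m + 1) * R) ^ n" by (rule power_mono) (use R in \<open>auto simp: algebra_simps\<close>)
  also have "\<dots> < R * R ^ n" using R by (simp add: power_mult_distrib R_def)
  also have "\<dots> = R ^ Suc n" by simp
  also have "\<dots> \<le> R ^ m" by (rule power_increasing) (use R \<open>\<not> m \<le> n\<close> in auto)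
  also have "\<dots> = card A" by (simp add: A_def card_box)
  finally have less: "card G < card A" .
  have AE: "A \<subseteq> expo m" by (auto simp: A_def box_def)
  have keysG: "ks (H (sg a 1)) \<subseteq> G" if a: "a \<in> A" for a
  proof
    fix g assume g: "g \<in> ks (H (sg a 1))"
    have aE: "a \<in> expo m" using a AE by blast
    have "tdeg m a \<le> (\<Sum>i\<in>{1..m}. R)"
      unfolding tdeg_def by (rule sum_mono) (use a in \<open>force simp: A_def box_def\<close>)
    then have t: "tdeg m a \<le> m * R" by simp
    have "tdeg n g \<le> B * tdeg m a" using bound[OF aE] g by blast
    also have "\<dots> \<le> B * (m * R)" using t by (rule mult_le_mono2)
    finally have tg: "tdeg n g \<le> B * (m * R)" .
    have lg: "lk g i \<le> tdeg n g" if "i \<in> {1..n}" for i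
      unfolding tdeg_def by (rule member_le_sum) (use that in auto)
    have "lk g i < B * (m * R) + 1" if "i \<in> {1..n}" for i using lg[OF that] tg by linarith
    moreover have "g \<in> E" using H_Ds[of "sg a 1"] aE g Ds_E by auto
    ultimately show "g \<in> G" by (simp add: G_def box_def)
  qed
  obtain u where u: "\<exists>a\<in>A. u a \<noteq> 0" "\<forall>g\<in>G. (\<Sum>a\<in>A. u a * lk (H (sg a 1)) g) = 0"
    using linear_dependence[of G A "\<lambda>a g. lk (H (sg a 1)) g"] less finite_box unfolding A_def G_def by blast
  have sumH: "ks (\<Sum>a\<in>C. sg a (u a)) \<subseteq> expo m \<and>
      (\<forall>g. lk (H (\<Sum>a\<in>C. sg a (u a))) g = (\<Sum>a\<in>C. u a * lk (H (sg a 1)) g))" if "finite C" "C \<subseteq> expo m" for C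
    using that
  proof (induction C rule: finite_induct)
    case (insert a C)
    then have k: "ks (\<Sum>a\<in>C. sg a (u a)) \<subseteq> expo m" "ks (sg a (u a)) \<subseteq> expo m" by auto
    then have "ks (sg a (u a) + (\<Sum>a\<in>C. sg a (u a))) \<subseteq> expo m"
      using Poly_Mapping.keys_add[of "sg a (u a)" "\<Sum>a\<in>C. sg a (u a)"] by blast
    then show ?case using insert k H_scale[of a "u a"] by (simp add: H_add lookup_add)
  qed (simp add: H_zero)
  have finA: "finite A" by (simp add: A_def finite_box)
  define f where "f = (\<Sum>a\<in>A. sg a (u a))"
  have f: "ks f \<subseteq> expo m" "\<And>g. lk (H f) g = (\<Sum>a\<in>A. u a * lk (H (sg a 1)) g)"
    using sumH[OF finA AE] unfolding f_def by auto
  have "H f = 0"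
  proof (rule poly_mapping_eqI)
    fix g
    have "(\<Sum>a\<in>A. u a * lk (H (sg a 1)) g) = 0"
    proof (cases "g \<in> G")
      case True then show ?thesis using u(2) by blast
    next
      case False
      then have "lk (H (sg a 1)) g = 0" if "a \<in> A" for a using keysG[OF that] by (auto simp: in_keys_iff)
      then show ?thesis by simp
    qed
    then show "lk (H f) g = lk 0 g" by (simp add: f)
  qed
  then have f0: "f = 0" using H_inj[of f 0] f(1) H_zero by simp
  have "lk f a = u a" if "a \<in> A" for a
    using that finA by (simp add: f_def lookup_sum lookup_single when_def sum.delta')
  then show False using u(1) f0 by auto
qed

text \<open>Reading off the coefficients at the atoms of \<open>Ds\<close> kills products of augmentation ideal
  elements, so \<open>n + 1\<close> atoms cannot be separated by fewer than \<open>n + 1\<close> generators.\<close>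

lemma param_reg: reg
proof (rule ccontr)
  assume "\<not> reg"
  then obtain At where At: "finite At" "card At = n + 1" "\<And>a. a \<in> At \<Longrightarrow> atom a"
    using not_reg_atoms by blast
  have "card {1..m} < card At" using param_le At by simp
  \<comment> \<open>The coefficients combine the n + 1 point derivations into one that vanishes on
    the images of all variables, hence by the product rule on the whole image.\<close>
  then obtain u where u: "\<exists>a\<in>At. u a \<noteq> 0" "\<forall>j\<in>{1..m}. (\<Sum>a\<in>At. u a * lk (H (sg (ev j) 1)) a) = 0"
    using linear_dependence[of "{1..m}" At "\<lambda>a j. lk (H (sg (ev j) 1)) a"] At(1) by blast
  define \<theta> where "\<theta> F = (\<Sum>a\<in>At. u a * lk F a)" for F :: "(nat \<Rightarrow>\<^sub>0 nat) \<Rightarrow>\<^sub>0 'k"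
  have \<theta>_mult: "\<theta> (F \<star> G) = lk F 0 * \<theta> G + lk G 0 * \<theta> F" if "ks F \<subseteq> Ds" "ks G \<subseteq> Ds" for F G
  proof -
    have "\<theta> (F \<star> G) = (\<Sum>a\<in>At. u a * (lk F 0 * lk G a + lk F a * lk G 0))"
      unfolding \<theta>_def using atom_tmul[OF At(3) that] by simp
    then show ?thesis by (simp add: \<theta>_def algebra_simps sum.distrib sum_distrib_left)
  qed
  have mon: "\<theta> (H (sg a 1)) = 0" if "a \<in> expo m" for a
    using that
  proof (induction rule: expo_induct)
    case zero
    have "lk (sg 0 (1::'k)) a = 0" if "a \<in> At" for a
      using At(3)[OF that] by (auto simp: atom_def lookup_single when_def)
    then show ?case by (simp add: H_const \<theta>_def)
  next
    case (add a i)
    have e: "ks (sg (ev i) (1::'k)) \<subseteq> expo m" "ks (sg a (1::'k)) \<subseteq> expo m" using add by (auto simp: expo_single)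
    have "H (sg (ev i + a) 1) = H (sg (ev i) 1) \<star> H (sg a 1)"
      using H_mult[OF e] by (simp add: mult_single)
    moreover have "\<theta> (H (sg (ev i) 1)) = 0" using u(2) add by (simp add: \<theta>_def)
    ultimately show ?case using \<theta>_mult[OF H_Ds[OF e(1)] H_Ds[OF e(2)]] add by simp
  qed
  have all: "\<theta> (H f) = 0" if "ks f \<subseteq> expo m" for f
    using that
  proof (induction rule: pm_induct)
    case (single a x)
    have "\<theta> (H (sg a x)) = x * \<theta> (H (sg a 1))"
      using H_scale[OF single, of x] by (simp add: \<theta>_def sum_distrib_left mult_ac)
    then show ?case using mon[OF single] by simp
  next
    case (add F G)
    then show ?case by (simp add: H_add \<theta>_def lookup_add distrib_left sum.distrib)
  qed (simp add: H_zero \<theta>_def)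
  obtain a0 where a0: "a0 \<in> At" "u a0 \<noteq> 0" using u(1) by blast
  have "ks (sg a0 (1::'k)) \<subseteq> Ds" using At(3)[OF a0(1)] by (simp add: atom_def)
  then obtain f where f: "ks f \<subseteq> expo m" "H f = sg a0 1" using H_surj by blast
  \<comment> \<open>The monomial x^a0 is in the image by surjectivity, but the combined derivation
    takes the value \<open>u a0\<close>, which is not 0, on it.\<close>
  have "\<theta> (sg a0 1) = (\<Sum>a\<in>At. if a = a0 then u a0 else 0)"
    unfolding \<theta>_def by (rule sum.cong) (auto simp: lookup_single when_def)
  then show False using all[OF f(1)] f(2) a0 At(1) by (simp add: sum.delta)
qed

end

lemma regular_imp_reg: "center_regular n p \<Longrightarrow> reg"
proof -
  assume "center_regular n p"
  then obtain m h where h: "h \<in> ring_iso (mpoly_ring m) ZR" and c: "\<And>c. h (sg 0 c) = skew_const n p c"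
    unfolding center_regular_def by blast
  have Z: "h f \<in> Z" if "ks f \<subseteq> expo m" for f
    using h that unfolding ring_iso_def ring_hom_def by auto
  have hom: "h (f * g) = h f \<cdot> h g" "h (f + g) = h f \<oplus>\<^bsub>S\<^esub> h g"
    if "ks f \<subseteq> expo m" "ks g \<subseteq> expo m" for f g
    using h that unfolding ring_iso_def ring_hom_def by auto
  have bij: "bij_betw h {f. ks f \<subseteq> expo m} Z" using h unfolding ring_iso_def by simp
  show reg
  proof (rule param_reg[where m = m and H = "\<lambda>f. nff (h f)"])
    fix f g :: "(nat \<Rightarrow>\<^sub>0 nat) \<Rightarrow>\<^sub>0 'k" assume f: "ks f \<subseteq> expo m" and g: "ks g \<subseteq> expo m"
    show "nff (h (f + g)) = nff (h f) + nff (h g)" using hom[OF f g] Z[OF f] Z[OF g] by (simp add: nf_add Z_closed)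
    show "nff (h (f * g)) = nff (h f) \<star> nff (h g)" using hom[OF f g] Z[OF f] Z[OF g] by (simp add: nf_mult Z_closed)
    assume "nff (h f) = nff (h g)"
    then have "h f = h g" using nf_inj Z[OF f] Z[OF g] Z_closed by blast
    then show "f = g" using bij f g unfolding bij_betw_def inj_on_def by blast
  next
    fix F :: "(nat \<Rightarrow>\<^sub>0 nat) \<Rightarrow>\<^sub>0 'k" assume F: "ks F \<subseteq> Ds"
    then have "cl F \<in> h ` {f. ks f \<subseteq> expo m}" using bij cl_Z unfolding bij_betw_def by blast
    then obtain f where "ks f \<subseteq> expo m" "h f = cl F" by auto
    moreover have "ks F \<subseteq> E" using F Ds_E by blast
    ultimately show "\<exists>f. ks f \<subseteq> expo m \<and> nff (h f) = F" by (intro exI[of _ f]) (simp add: nf_cl)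
  qed (use Z Z_ks c in \<open>simp_all add: nf_const\<close>)
qed

end

section \<open>Traces\<close>

definition hs_set :: "nat set \<Rightarrow> nat \<Rightarrow> (nat \<Rightarrow>\<^sub>0 nat) set" where
  "hs_set A j = {a. ks a \<subseteq> A \<and> (\<Sum>i\<in>A. lk a i) = j}"

lemma finite_hs_set: "finite A \<Longrightarrow> finite (hs_set A j)"
proof -
  assume A: "finite A"
  have "hs_set A j \<subseteq> rst A ` (PiE A (\<lambda>_. {..j}))"
  proof
    fix a assume a: "a \<in> hs_set A j"
    have "a = rst A (restrict (lk a) A)"
      by (rule poly_mapping_eqI) (use a A in \<open>auto simp: hs_set_def lk_rst in_keys_iff subset_iff\<close>)
    moreover have "lk a i \<le> j" if "i \<in> A" for i
      using a member_le_sum[OF that _ A, of "lk a"] by (auto simp: hs_set_def)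
    then have "restrict (lk a) A \<in> PiE A (\<lambda>_. {..j})" by auto
    ultimately show "a \<in> rst A ` (PiE A (\<lambda>_. {..j}))" by blast
  qed
  then show ?thesis using A by (meson finite_PiE finite_atMost finite_imageI finite_subset)
qed

text \<open>The complete homogeneous symmetric polynomial of degree j in the variables
  \<open>A\<close>, evaluated at \<mu>.\<close>

definition hs :: "(nat \<Rightarrow> 'k::field) \<Rightarrow> nat set \<Rightarrow> nat \<Rightarrow> 'k" where
  "hs \<mu> A j = (\<Sum>a\<in>hs_set A j. \<Prod>s\<in>A. \<mu> s ^ lk a s)"

text \<open>Monomials of degree j either avoid s or are s times a monomial of degree j - 1.\<close>

lemma hs_insert:
  assumes A: "finite A" "s \<notin> A"
  shows "hs \<mu> (insert s A) j = hs \<mu> A j + (if j = 0 then 0 else \<mu> s * hs \<mu> (insert s A) (j - 1))"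
proof -
  let ?B = "insert s A"
  let ?f = "\<lambda>a. \<Prod>s\<in>?B. \<mu> s ^ lk a s"
  define T where "T = (if j = 0 then {} else (+) (ev s) ` hs_set ?B (j - 1))"
  have U: "hs_set ?B j = hs_set A j \<union> T"
  proof (intro subset_antisym subsetI)
    fix a assume a: "a \<in> hs_set ?B j"
    show "a \<in> hs_set A j \<union> T"
    proof (cases "lk a s = 0")
      case True
      then have "ks a \<subseteq> A" using a by (auto simp: hs_set_def in_keys_iff)
      then show ?thesis using a True A by (simp add: hs_set_def)
    next
      case False
      have e: "a = ev s + (a - ev s)"
        by (rule poly_mapping_eqI) (use False in \<open>auto simp: lookup_add lookup_minus lookup_single when_def\<close>)
      have "lk a x \<noteq> 0" if "x \<in> ks (a - ev s)" for x
        using that by (auto simp: in_keys_iff lookup_minus)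
      then have k: "ks (a - ev s) \<subseteq> ?B" using a unfolding hs_set_def by (auto simp: in_keys_iff subset_iff)
      have sA: "(\<Sum>i\<in>A. lk (a - ev s) i) = (\<Sum>i\<in>A. lk a i)"
        by (rule sum.cong) (use A in \<open>auto simp: lookup_minus lookup_single when_def\<close>)
      have "(\<Sum>i\<in>?B. lk (a - ev s) i) = j - 1" "j \<noteq> 0"
        using a A False sA by (auto simp: hs_set_def lookup_minus)
      then have "a - ev s \<in> hs_set ?B (j - 1)" "j \<noteq> 0" using k by (auto simp: hs_set_def)
      then show ?thesis using e by (auto simp: T_def)
    qed
  next
    fix a assume "a \<in> hs_set A j \<union> T"
    then show "a \<in> hs_set ?B j"
    proof
      assume a: "a \<in> hs_set A j"
      then have "lk a s = 0" using A by (auto simp: hs_set_def in_keys_iff)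
      then show ?thesis using a A by (auto simp: hs_set_def)
    next
      assume "a \<in> T"
      then obtain b where j: "j \<noteq> 0" and b: "b \<in> hs_set ?B (j - 1)" "a = ev s + b" by (auto simp: T_def split: if_splits)
      have "ks a \<subseteq> ?B" using b Poly_Mapping.keys_add[of "ev s" b] by (auto simp: hs_set_def)
      moreover have "(\<Sum>i\<in>?B. lk a i) = 1 + (\<Sum>i\<in>?B. lk b i)"
        using A by (simp add: b lookup_add sum.distrib lookup_single when_def)
      ultimately show ?thesis using b j by (auto simp: hs_set_def)
    qed
  qed
  have disj: "hs_set A j \<inter> T = {}"
  proof -
    have "lk a s = 0" if "a \<in> hs_set A j" for a using that A by (auto simp: hs_set_def in_keys_iff)
    moreover have "lk a s \<noteq> 0" if "a \<in> T" for a using that by (auto simp: T_def lookup_add split: if_splits)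
    ultimately show ?thesis by blast
  qed
  have fin: "finite (hs_set A j)" "finite T" using A by (auto simp: T_def finite_hs_set)
  have "hs \<mu> ?B j = (\<Sum>a\<in>hs_set A j. ?f a) + (\<Sum>a\<in>T. ?f a)"
    unfolding hs_def U by (rule sum.union_disjoint[OF fin disj])
  also have "(\<Sum>a\<in>hs_set A j. ?f a) = hs \<mu> A j"
    unfolding hs_def
  proof (rule sum.cong[OF refl])
    fix a assume "a \<in> hs_set A j"
    then have "lk a s = 0" using A by (auto simp: hs_set_def in_keys_iff)
    then show "?f a = (\<Prod>s\<in>A. \<mu> s ^ lk a s)" using A by simp
  qed
  also have "(\<Sum>a\<in>T. ?f a) = (if j = 0 then 0 else \<mu> s * hs \<mu> ?B (j - 1))"
  proof (cases "j = 0")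
    case False
    have sh: "?f (ev s + b) = \<mu> s * ?f b" for b
    proof -
      have "(\<Prod>t\<in>A. \<mu> t ^ lk (ev s + b) t) = (\<Prod>t\<in>A. \<mu> t ^ lk b t)"
        by (rule prod.cong) (use A in \<open>auto simp: lookup_add lookup_single when_def\<close>)
      then show ?thesis using A by (simp add: lookup_add power_add)
    qed
    have "(\<Sum>a\<in>T. ?f a) = (\<Sum>b\<in>hs_set ?B (j - 1). ?f (ev s + b))"
      using False unfolding T_def by (simp only: if_False) (subst sum.reindex; simp add: inj_on_def)
    then show ?thesis using False by (simp only: sh hs_def sum_distrib_left if_False)
  qed (simp add: T_def)
  finally show ?thesis .
qed

text \<open>The recurrence says that the factor 1 - \<mu>_s t removes the variable s from the
  generating series.\<close>

lemma hs_series: "finite A \<Longrightarrow> Abs_fps (hs \<mu> A) * fps_of_poly (\<Prod>s\<in>A. [:1, - \<mu> s:]) = 1"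
proof (induction A rule: finite_induct)
  case empty
  have "hs \<mu> {} j = (if j = 0 then 1 else 0)" for j
  proof -
    have "hs_set {} j = (if j = 0 then {0} else {})"
      by (auto simp: hs_set_def)
    then show ?thesis by (simp add: hs_def)
  qed
  then have "Abs_fps (hs \<mu> {}) = 1" by (intro fps_ext) simp
  then show ?case by simp
next
  case (insert s A)
  have step: "Abs_fps (hs \<mu> (insert s A)) * fps_of_poly [:1, - \<mu> s:] = Abs_fps (hs \<mu> A)"
  proof (rule fps_ext)
    fix j
    have lin: "F * fps_of_poly [:1, - \<mu> s:] = F - fps_const (\<mu> s) * (fps_X * F)" for F
      by (simp add: fps_of_poly_pCons algebra_simps flip: fps_const_neg)
    have "fps_nth (Abs_fps (hs \<mu> (insert s A)) * fps_of_poly [:1, - \<mu> s:]) j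
        = hs \<mu> (insert s A) j - \<mu> s * (if j = 0 then 0 else hs \<mu> (insert s A) (j - 1))"
      unfolding lin by simp
    then show "fps_nth (Abs_fps (hs \<mu> (insert s A)) * fps_of_poly [:1, - \<mu> s:]) j = fps_nth (Abs_fps (hs \<mu> A)) j"
      using hs_insert[OF insert(1,2), of \<mu> j] by simp
  qed
  have "Abs_fps (hs \<mu> (insert s A)) * fps_of_poly (\<Prod>s\<in>insert s A. [:1, - \<mu> s:])
      = Abs_fps (hs \<mu> (insert s A)) * fps_of_poly [:1, - \<mu> s:] * fps_of_poly (\<Prod>s\<in>A. [:1, - \<mu> s:])"
    unfolding prod.insert[OF insert(1,2)] fps_of_poly_mult by (rule mult.assoc[symmetric])
  then show ?case unfolding step insert.IH .
qed

text \<open>The multiplicity of the root 1 is well defined.\<close>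

lemma linear_power_cancel:
  fixes q r :: "'k::field poly"
  assumes "[:1, -1:] ^ a * q = [:1, -1:] ^ b * r" "poly q 1 \<noteq> 0" "poly r 1 \<noteq> 0"
  shows "a = b"
proof -
  have aux: False
    if "[:1, -1:] ^ a * q = [:1, -1:] ^ b * r" "poly q 1 \<noteq> 0" "a < b" for a b and q r :: "'k poly"
  proof -
    obtain c where c: "b = a + Suc c" using \<open>a < b\<close> less_imp_Suc_add by auto
    have "[:1, -1:] ^ a * q = [:1, -1:] ^ a * ([:1, -1:] ^ Suc c * r)"
      using that(1) unfolding c power_add by (simp only: mult.assoc)
    then have "q = [:1, -1:] ^ Suc c * r" by (subst (asm) mult_cancel_left) auto
    then have "poly q 1 = 0" by simp
    then show False using that(2) by simp
  qed
  show ?thesis using aux[of a q b r] aux[of b r a q] assms by (metis linorder_neqE_nat)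
qed

text \<open>Inverses of power series are unique, so the denominator must be the product of the 1 -
  \<mu>_s t, in which the root 1 has multiplicity equal to the number of s with \<mu>_s = 1.\<close>

lemma reflection_series_iff:
  fixes \<mu> :: "nat \<Rightarrow> 'k::field"
  assumes A: "finite A"
  shows "(\<exists>q. poly q 1 \<noteq> 0 \<and> Abs_fps (hs \<mu> A) * fps_of_poly ([:1, -1:] ^ k * q) = 1)
    \<longleftrightarrow> card {s\<in>A. \<mu> s = 1} = k"
proof -
  define r where "r = (\<Prod>s\<in>{s\<in>A. \<mu> s \<noteq> 1}. [:1, - \<mu> s:])"
  let ?P = "\<Prod>s\<in>A. [:1, - \<mu> s:]" and ?k = "card {s\<in>A. \<mu> s = 1}"
  have split: "A = {s\<in>A. \<mu> s = 1} \<union> {s\<in>A. \<mu> s \<noteq> 1}" by blast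
  have "?P = (\<Prod>s\<in>{s\<in>A. \<mu> s = 1}. [:1, - \<mu> s:]) * r"
    unfolding r_def by (subst split, rule prod.union_disjoint) (use A in auto)
  also have "(\<Prod>s\<in>{s\<in>A. \<mu> s = 1}. [:1, - \<mu> s:]) = [:1, -1:] ^ ?k" by simp
  finally have P: "?P = [:1, -1:] ^ ?k * r" .
  have r1: "poly r 1 \<noteq> 0" using A by (simp add: r_def poly_prod)
  have inv: "Abs_fps (hs \<mu> A) * fps_of_poly Q = 1 \<longleftrightarrow> Q = ?P" for Q
  proof
    assume Q: "Abs_fps (hs \<mu> A) * fps_of_poly Q = 1"
    have "fps_of_poly Q = fps_of_poly Q * (Abs_fps (hs \<mu> A) * fps_of_poly ?P)"
      by (simp only: hs_series[OF A] mult_1_right)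
    also have "\<dots> = (Abs_fps (hs \<mu> A) * fps_of_poly Q) * fps_of_poly ?P" by (simp only: mult_ac)
    finally have "fps_of_poly Q = fps_of_poly ?P" by (simp only: Q mult_1_left)
    then show "Q = ?P" by (simp only: fps_of_poly_eq_iff)
  qed (simp only: hs_series[OF A])
  show ?thesis unfolding inv P
    using linear_power_cancel[of k _ ?k r] r1 by blast
qed

context ozone
begin

section \<open>Traces on the graded pieces\<close>

abbreviation "K \<equiv> ring_of_type_algebra :: 'k ring"
abbreviation "Vd j \<equiv> skew_degree_space n p j"

lemma K_simps [simp]: "carrier K = UNIV" "\<zero>\<^bsub>K\<^esub> = 0"
  by (simp_all add: ring_of_type_algebra_def)

lemma hs_set_expo: "hs_set {1..n} j = {a \<in> E. tdeg n a = j}"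
  by (auto simp: hs_set_def expo_def tdeg_def)

lemma Vd_group: "mono_group (Vd j) (hs_set {1..n} j)"
  and Vd_smult: "(\<odot>\<^bsub>Vd j\<^esub>) = skew_scale n p"
proof -
  have "{s \<in> carrier S. \<forall>a\<in>ks (nff s). (\<Sum>i\<in>{1..n}. lk a i) = j} = {s \<in> carrier S. ks (nff s) \<subseteq> hs_set {1..n} j}"
    using nf_closed unfolding hs_set_expo tdeg_def by blast
  then show "mono_group (Vd j) (hs_set {1..n} j)"
    by (simp add: mono_group_def skew_degree_space_def Let_def degree_eq)
qed (simp add: skew_degree_space_def Let_def)

lemmas Vd_S = G_S[OF Vd_group] and Vd_ks = G_ks[OF Vd_group] and VdI = GI[OF Vd_group]

lemma Vd_mono: "a \<in> hs_set {1..n} j \<Longrightarrow> mono a \<in> carrier (Vd j)"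
  by (rule VdI) (auto simp: hs_set_expo mono_closed nf_mono)

lemma Vd_scale: "x \<in> carrier (Vd j) \<Longrightarrow> skew_scale n p c x \<in> carrier (Vd j)"
proof (rule VdI)
  assume x: "x \<in> carrier (Vd j)"
  show "skew_scale n p c x \<in> carrier S" using scale_closed Vd_S[OF x] by blast
  show "ks (nff (skew_scale n p c x)) \<subseteq> hs_set {1..n} j"
    using Vd_ks[OF x] by (auto simp: in_keys_iff lk_scale[OF Vd_S[OF x]])
qed

lemma Vd_eq_sum_iff:
  assumes "finite B" "B \<subseteq> carrier (Vd j)" "m \<in> carrier (Vd j)"
  shows "m = (\<Oplus>\<^bsub>Vd j\<^esub> y\<in>B. c y \<odot>\<^bsub>Vd j\<^esub> y) \<longleftrightarrow> (\<forall>a. lk (nff m) a = (\<Sum>y\<in>B. c y * lk (nff y) a))"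
proof -
  let ?s = "\<Oplus>\<^bsub>Vd j\<^esub> y\<in>B. c y \<odot>\<^bsub>Vd j\<^esub> y"
  have s: "?s \<in> carrier (Vd j) \<and> nff ?s = (\<Sum>y\<in>B. nff (c y \<odot>\<^bsub>Vd j\<^esub> y))"
    by (rule mono_group_finsum[OF Vd_group]) (use assms Vd_scale in \<open>auto simp: Vd_smult\<close>)
  have "m = ?s \<longleftrightarrow> nff m = nff ?s" using nf_inj[of m ?s] s assms(3) Vd_S by blast
  also have "\<dots> \<longleftrightarrow> (\<forall>a. lk (nff m) a = (\<Sum>y\<in>B. lk (nff (skew_scale n p (c y) y)) a))"
    using s by (simp add: poly_mapping_eq_iff fun_eq_iff lookup_sum Vd_smult)
  also have "\<dots> \<longleftrightarrow> (\<forall>a. lk (nff m) a = (\<Sum>y\<in>B. c y * lk (nff y) a))"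
  proof -
    have "(\<Sum>y\<in>B. lk (nff (skew_scale n p (c y) y)) a) = (\<Sum>y\<in>B. c y * lk (nff y) a)" for a
      by (rule sum.cong[OF refl], rule lk_scale) (use assms(2) Vd_S in blast)
    then show ?thesis by (simp only:)
  qed
  finally show ?thesis .
qed

definition "kcoords B m c \<longleftrightarrow> {x. c x \<noteq> 0} \<subseteq> B \<and> (\<forall>a. lk (nff m) a = (\<Sum>y\<in>B. c y * lk (nff y) a))"

text \<open>For a finite basis the sum over the support may run over the whole basis, which turns
  the notion into coefficient equations.\<close>

lemma Vd_basis_iff:
  assumes "finite B"
  shows "module_basis K (Vd j) B \<longleftrightarrow>
    B \<subseteq> carrier (Vd j) \<and> (\<forall>m\<in>carrier (Vd j). \<exists>!c::_ \<Rightarrow> 'k. kcoords B m c)"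
proof -
  have eq: "(finite {x. c x \<noteq> 0} \<and> {x. c x \<noteq> 0} \<subseteq> B \<and> m = (\<Oplus>\<^bsub>Vd j\<^esub> y\<in>{x. c x \<noteq> 0}. c y \<odot>\<^bsub>Vd j\<^esub> y)) \<longleftrightarrow> kcoords B m c"
    if B: "B \<subseteq> carrier (Vd j)" and m: "m \<in> carrier (Vd j)" for m c
  proof (cases "{x. c x \<noteq> 0} \<subseteq> B")
    case True
    then have fin: "finite {x. c x \<noteq> 0}" using assms finite_subset by blast
    have "(\<Sum>y\<in>{x. c x \<noteq> 0}. c y * lk (nff y) a) = (\<Sum>y\<in>B. c y * lk (nff y) a)" for a
      by (rule sum.mono_neutral_left) (use assms True in auto)
    then show ?thesis using Vd_eq_sum_iff[OF fin _ m, of c] True B fin by (auto simp: kcoords_def)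
  qed (simp add: kcoords_def)
  have "(\<exists>!c. range c \<subseteq> carrier K \<and> finite {x. c x \<noteq> \<zero>\<^bsub>K\<^esub>} \<and> {x. c x \<noteq> \<zero>\<^bsub>K\<^esub>} \<subseteq> B \<and>
      m = (\<Oplus>\<^bsub>Vd j\<^esub> y\<in>{x. c x \<noteq> \<zero>\<^bsub>K\<^esub>}. c y \<odot>\<^bsub>Vd j\<^esub> y)) \<longleftrightarrow> (\<exists>!c. kcoords B m c)"
    if "B \<subseteq> carrier (Vd j)" "m \<in> carrier (Vd j)" for m
    by (simp only: K_simps subset_UNIV simp_thms eq[OF that])
  then show ?thesis unfolding module_basis_def by (intro conj_cong ball_cong refl)
qed

lemma kcoords_cong:
  "(\<And>x. x \<in> B \<Longrightarrow> c x = c' x) \<Longrightarrow> \<forall>a. lk (nff m) a = (\<Sum>y\<in>B. c y * lk (nff y) a) \<Longrightarrow>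
    kcoords B m (\<lambda>x. if x \<in> B then c' x else 0)"
  by (auto simp: kcoords_def intro!: sum.cong)

lemma mono_basis_Vd: "module_basis K (Vd j) (mono ` hs_set {1..n} j)"
proof -
  let ?D = "hs_set {1..n} j"
  have fin: "finite ?D" by (simp add: finite_hs_set)
  have DE: "a \<in> E" if "a \<in> ?D" for a using that by (simp add: hs_set_expo)
  have inj: "inj_on mono ?D" using mono_inj[OF mono_module_S] DE by (auto simp: inj_on_def)
  have sum: "(\<Sum>y\<in>mono ` ?D. c y * lk (nff y) a) = (if a \<in> ?D then c (mono a) else 0)" for c :: "_ \<Rightarrow> 'k" and a
  proof -
    have "(\<Sum>y\<in>mono ` ?D. c y * lk (nff y) a) = (\<Sum>e\<in>?D. c (mono e) * lk (sg e 1) a)"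
      by (subst sum.reindex[OF inj]) (auto simp: nf_mono DE intro!: sum.cong)
    also have "\<dots> = (\<Sum>e\<in>?D. if e = a then c (mono a) else 0)"
      by (rule sum.cong) (auto simp: lookup_single when_def)
    finally show ?thesis using fin by (simp add: sum.delta)
  qed
  have "\<exists>!c::_ \<Rightarrow> 'k. kcoords (mono ` ?D) m c" if m: "m \<in> carrier (Vd j)" for m
  proof (rule ex_ex1I)
    define c where "c y = (if y \<in> mono ` ?D then lk (nff m) (inv_into ?D mono y) else 0)" for y
    have "c (mono a) = lk (nff m) a" if "a \<in> ?D" for a
      using that inv_into_f_f[OF inj that] by (simp add: c_def)
    moreover have "lk (nff m) a = 0" if "a \<notin> ?D" for a using Vd_ks[OF m] that by (auto simp: in_keys_iff)
    ultimately have "kcoords (mono ` ?D) m c"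
      unfolding kcoords_def sum by (auto simp: c_def)
    then show "\<exists>c. kcoords (mono ` ?D) m c" by blast
  next
    fix c c' :: "_ \<Rightarrow> 'k" assume c: "kcoords (mono ` ?D) m c" "kcoords (mono ` ?D) m c'"
    show "c = c'"
    proof
      fix y show "c y = c' y"
      proof (cases "y \<in> mono ` ?D")
        case True
        then obtain a where "a \<in> ?D" "y = mono a" by blast
        then show ?thesis using c unfolding kcoords_def sum by metis
      next
        case False
        then have "c y = 0" "c' y = 0" using c unfolding kcoords_def by blast+
        then show ?thesis by simp
      qed
    qed
  qed
  then show ?thesis using fin Vd_mono by (subst Vd_basis_iff) auto
qed

lemma sig_Vd: "x \<in> carrier (Vd j) \<Longrightarrow> sig b x \<in> carrier (Vd j)"
  using ks_twist[of "\<beta> b" "nff x"] Vd_ks[of x j] Vd_S[of x j]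
  by (intro VdI) (auto simp: sig_closed nf_sig)

text \<open>The diagonal entries with respect to any basis are read off by expanding the monomials in
  that basis.\<close>

lemma trace_any_basis:
  fixes c :: "_ \<Rightarrow> _ \<Rightarrow> 'k"
  assumes fin: "finite B" and basis: "module_basis K (Vd j) B"
    and c: "\<And>x. x \<in> B \<Longrightarrow> sig b x = (\<Oplus>\<^bsub>Vd j\<^esub> y\<in>B. c y x \<odot>\<^bsub>Vd j\<^esub> y)"
  shows "(\<Sum>x\<in>B. c x x) = (\<Sum>a\<in>hs_set {1..n} j. \<beta> b a)"
proof -
  let ?D = "hs_set {1..n} j"
  have finD: "finite ?D" by (simp add: finite_hs_set)
  have BV: "B \<subseteq> carrier (Vd j)" and uniq: "\<And>m. m \<in> carrier (Vd j) \<Longrightarrow> \<exists>!c::_ \<Rightarrow> 'k. kcoords B m c"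
    using basis unfolding Vd_basis_iff[OF fin] by auto
  define Q where "Q a = (SOME c::_ \<Rightarrow> 'k. kcoords B (mono a) c)" for a
  have Q: "kcoords B (mono a) (Q a)" if "a \<in> ?D" for a
    unfolding Q_def using ex1_implies_ex[OF uniq[OF Vd_mono[OF that]]] by (rule someI_ex)
  have Qlk: "(\<Sum>y\<in>B. Q a y * lk (nff y) e) = lk (sg a (1::'k)) e" if a: "a \<in> ?D" for a e
    using Q[OF a] nf_mono[of a] a unfolding kcoords_def hs_set_expo by simp
  \<comment> \<open>The coordinates of \<open>sig b x\<close> are computed a second time: x is
    expanded into monomials, scaled there, and the monomials are expanded in the basis. Uniqueness
    of coordinates identifies the two.\<close>
  have diag: "c x x = (\<Sum>a\<in>?D. \<beta> b a * lk (nff x) a * Q a x)" if x: "x \<in> B" for x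
  proof -
    have xV: "x \<in> carrier (Vd j)" using x BV by blast
    let ?m = "sig b x"
    have m: "?m \<in> carrier (Vd j)" by (rule sig_Vd[OF xV])
    obtain c0 :: "_ \<Rightarrow> 'k" where c0: "\<And>c. kcoords B ?m c \<Longrightarrow> c = c0"
      using uniq[OF m] by (elim ex1E) blast
    have 1: "kcoords B ?m (\<lambda>y. if y \<in> B then c y x else 0)"
      by (rule kcoords_cong[of B "\<lambda>y. c y x"]) (use Vd_eq_sum_iff[OF fin BV m, of "\<lambda>y. c y x"] c[OF x] in simp_all)
    have 2: "kcoords B ?m (\<lambda>y. if y \<in> B then \<Sum>a\<in>?D. \<beta> b a * lk (nff x) a * Q a y else 0)"
    proof (rule kcoords_cong[of B "\<lambda>y. \<Sum>a\<in>?D. \<beta> b a * lk (nff x) a * Q a y"])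
      show "\<forall>e. lk (nff ?m) e = (\<Sum>y\<in>B. (\<Sum>a\<in>?D. \<beta> b a * lk (nff x) a * Q a y) * lk (nff y) e)"
      proof
        fix e
        have "(\<Sum>y\<in>B. (\<Sum>a\<in>?D. \<beta> b a * lk (nff x) a * Q a y) * lk (nff y) e)
            = (\<Sum>a\<in>?D. \<beta> b a * lk (nff x) a * (\<Sum>y\<in>B. Q a y * lk (nff y) e))"
          by (simp add: sum_distrib_left sum_distrib_right mult.assoc) (rule sum.swap)
        also have "\<dots> = (\<Sum>a\<in>?D. if a = e then \<beta> b e * lk (nff x) e else 0)"
          by (rule sum.cong) (auto simp: Qlk lookup_single when_def)
        also have "\<dots> = \<beta> b e * lk (nff x) e"
          using finD Vd_ks[OF xV] by (auto simp: sum.delta in_keys_iff subset_iff)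
        also have "\<dots> = lk (nff ?m) e" by (simp add: nf_sig Vd_S[OF xV] lk_twist)
        finally show "lk (nff ?m) e = (\<Sum>y\<in>B. (\<Sum>a\<in>?D. \<beta> b a * lk (nff x) a * Q a y) * lk (nff y) e)" by simp
      qed
    qed simp
    have "(\<lambda>y. if y \<in> B then c y x else 0)
        = (\<lambda>y. if y \<in> B then \<Sum>a\<in>?D. \<beta> b a * lk (nff x) a * Q a y else 0)"
      by (rule trans[OF c0[OF 1] c0[OF 2, symmetric]])
    from fun_cong[OF this, of x] show ?thesis using x by simp
  qed
  \<comment> \<open>After exchanging the sums, the inner one is the coefficient of x^a at its own
    exponent, which is 1.\<close>
  have "(\<Sum>x\<in>B. c x x) = (\<Sum>x\<in>B. \<Sum>a\<in>?D. \<beta> b a * lk (nff x) a * Q a x)"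
    by (rule sum.cong[OF refl diag])
  also have "\<dots> = (\<Sum>a\<in>?D. \<beta> b a * (\<Sum>x\<in>B. Q a x * lk (nff x) a))"
    by (subst sum.swap) (simp add: sum_distrib_left mult_ac)
  also have "\<dots> = (\<Sum>a\<in>?D. \<beta> b a)" by (rule sum.cong) (simp_all add: Qlk)
  finally show ?thesis .
qed

text \<open>The definite description needs one admissible basis, namely the monomials, and agreement
  of the diagonal sums over all bases.\<close>

lemma trace_sig: "lin_trace (Vd j) (sig b) = (\<Sum>a\<in>hs_set {1..n} j. \<beta> b a)"
  unfolding lin_trace_def
proof (rule the_equality)
  let ?D = "hs_set {1..n} j"
  let ?B = "mono ` ?D"
  have fin: "finite ?B" by (simp add: finite_hs_set)
  have ex: "\<exists>c::_ \<Rightarrow> 'k. sig b x = (\<Oplus>\<^bsub>Vd j\<^esub> y\<in>?B. c y \<odot>\<^bsub>Vd j\<^esub> y)" if "x \<in> ?B" for x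
  proof -
    have BV: "?B \<subseteq> carrier (Vd j)" using Vd_mono by blast
    have m: "sig b x \<in> carrier (Vd j)" using sig_Vd that BV by blast
    then obtain c :: "_ \<Rightarrow> 'k" where "kcoords ?B (sig b x) c"
      using mono_basis_Vd[of j] unfolding Vd_basis_iff[OF fin] by blast
    then show ?thesis using Vd_eq_sum_iff[OF fin BV m] unfolding kcoords_def by blast
  qed
  define c where "c y x = (SOME c::_ \<Rightarrow> 'k. sig b x = (\<Oplus>\<^bsub>Vd j\<^esub> y\<in>?B. c y \<odot>\<^bsub>Vd j\<^esub> y)) y" for x y
  have c: "sig b x = (\<Oplus>\<^bsub>Vd j\<^esub> y\<in>?B. c y x \<odot>\<^bsub>Vd j\<^esub> y)" if "x \<in> ?B" for x
    unfolding c_def using someI_ex[OF ex[OF that]] .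
  have "(\<Sum>x\<in>?B. c x x) = (\<Sum>a\<in>?D. \<beta> b a)"
    by (rule trace_any_basis[OF fin mono_basis_Vd c])
  then show "\<exists>B c. finite B \<and> module_basis K (Vd j) B \<and> (\<forall>x\<in>B. sig b x = (\<Oplus>\<^bsub>Vd j\<^esub> y\<in>B. c y x \<odot>\<^bsub>Vd j\<^esub> y))
      \<and> (\<Sum>a\<in>?D. \<beta> b a) = (\<Sum>x\<in>B. c x x)"
    using fin mono_basis_Vd c by (intro exI[of _ ?B] exI[of _ c]) simp
next
  fix t assume "\<exists>B c. finite B \<and> module_basis K (Vd j) B \<and> (\<forall>x\<in>B. sig b x = (\<Oplus>\<^bsub>Vd j\<^esub> y\<in>B. c y x \<odot>\<^bsub>Vd j\<^esub> y))
      \<and> t = (\<Sum>x\<in>B. c x x)"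
  then obtain B and c :: "_ \<Rightarrow> _ \<Rightarrow> 'k" where B: "finite B" "module_basis K (Vd j) B"
    and c: "\<forall>x\<in>B. sig b x = (\<Oplus>\<^bsub>Vd j\<^esub> y\<in>B. c y x \<odot>\<^bsub>Vd j\<^esub> y)" and t: "t = (\<Sum>x\<in>B. c x x)"
    by (elim exE conjE)
  show "t = (\<Sum>a\<in>hs_set {1..n} j. \<beta> b a)"
    unfolding t by (rule trace_any_basis[OF B bspec[OF c]])
qed

section \<open>Reflections\<close>

abbreviation "ew b s \<equiv> \<beta> b (ev s)"

lemma trace_hs: "lin_trace (Vd j) (sig b) = hs (ew b) {1..n} j"
  unfolding trace_sig hs_def by (rule sum.cong) (auto simp: hs_set_expo intro: \<beta>_prod)

lemma sig_eq_ew: "(\<And>s. s \<in> {1..n} \<Longrightarrow> ew b s = ew b' s) \<Longrightarrow> sig b = sig b'"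
  by (rule sig_cong) (simp add: \<beta>_prod)

lemma sig_ew: "sig b = sig b' \<Longrightarrow> s \<in> {1..n} \<Longrightarrow> ew b s = ew b' s"
  unfolding sig_eq_iff by (blast intro: expo_single)

lemma Perm_pow: "sig b [^]\<^bsub>Perm\<^esub> (k::nat) = sig (sc k b)"
proof -
  interpret P: group Perm by (rule group_BijGroup)
  show ?thesis
  proof (induction k)
    case 0
    have "sc 0 b = 0" by (rule poly_mapping_eqI) simp
    then show ?case by (simp add: Perm_one)
  next
    case (Suc k)
    have "sc (Suc k) b = sc k b + b" by (rule poly_mapping_eqI) (simp add: lookup_add)
    then show ?case by (simp add: Suc Perm_mult)
  qed
qed

text \<open>A nontrivial automorphism in the group moves some variable, so n is positive, and n - 1
  trivial eigenvalues mean that exactly one variable is moved.\<close>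

lemma reflection_iff:
  "skew_reflection n p (sig b) \<longleftrightarrow> (\<exists>s\<in>{1..n}. ew b s \<noteq> 1 \<and> (\<forall>t\<in>{1..n} - {s}. ew b t = 1))"
proof -
  have "sig (sc l b) = sig 0" by (rule sig_cong) (simp add: bichar_sc_left \<beta>_l)
  then have fin: "\<exists>m::nat. 0 < m \<and> sig b [^]\<^bsub>Perm\<^esub> m = \<one>\<^bsub>Perm\<^esub>"
    using l_pos unfolding Perm_one Perm_pow by blast
  have nontriv: "sig b \<noteq> \<one>\<^bsub>Perm\<^esub> \<longleftrightarrow> (\<exists>s\<in>{1..n}. ew b s \<noteq> 1)"
    unfolding Perm_one using sig_eq_ew[of b 0] sig_ew[of b 0] by fastforce
  have "skew_reflection n p (sig b) \<longleftrightarrow> sig b \<noteq> \<one>\<^bsub>Perm\<^esub> \<and> card {s\<in>{1..n}. ew b s = 1} = n - 1"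
    unfolding skew_reflection_def using graded_sig fin
    by (simp add: trace_hs reflection_series_iff)
  also have "\<dots> \<longleftrightarrow> (\<exists>s\<in>{1..n}. ew b s \<noteq> 1 \<and> (\<forall>t\<in>{1..n} - {s}. ew b t = 1))"
    unfolding nontriv
  proof (intro iffI conjI)
    assume h: "(\<exists>s\<in>{1..n}. ew b s \<noteq> 1) \<and> card {s\<in>{1..n}. ew b s = 1} = n - 1"
    then obtain s where s: "s \<in> {1..n}" "ew b s \<noteq> 1" by blast
    have "{s\<in>{1..n}. ew b s = 1} = {1..n} - {s}"
      by (rule card_subset_eq) (use s h in auto)
    then show "\<exists>s\<in>{1..n}. ew b s \<noteq> 1 \<and> (\<forall>t\<in>{1..n} - {s}. ew b t = 1)" using s by blast
  next
    assume "\<exists>s\<in>{1..n}. ew b s \<noteq> 1 \<and> (\<forall>t\<in>{1..n} - {s}. ew b t = 1)"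
    then obtain s where s: "s \<in> {1..n}" "ew b s \<noteq> 1" "\<forall>t\<in>{1..n} - {s}. ew b t = 1" by blast
    then have "{s\<in>{1..n}. ew b s = 1} = {1..n} - {s}" by auto
    then show "card {s\<in>{1..n}. ew b s = 1} = n - 1" using s by simp
  qed blast
  finally show ?thesis .
qed

text \<open>A reflection moves a single x_s, so fixing x^d means fixing x_s^(d_s): it fixes every
  factor x_i^(d_i) separately. This passes to products and inverses, so x_i^(d_i) is invariant,
  hence central.\<close>

lemma reflection_group_imp_reg: "reflection_group n p OG \<Longrightarrow> reg"
proof -
  assume "reflection_group n p OG"
  then obtain R where R: "R \<subseteq> carrier OG" "\<And>\<sigma>. \<sigma> \<in> R \<Longrightarrow> skew_reflection n p \<sigma>" "generate OG R = carrier OG"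
    unfolding reflection_group_def by blast
  interpret G: group OG by (rule group_OG)
  show reg unfolding reg_def
  proof (intro ballI)
    fix d i assume d: "d \<in> Ds" and i: "i \<in> {1..n}"
    have gen: "\<exists>b\<in>E. \<sigma> = sig b \<and> ew b i ^ lk d i = 1" if "\<sigma> \<in> generate OG R" for \<sigma>
    proof -
      have refl: "\<exists>b\<in>E. \<sigma> = sig b \<and> ew b i ^ lk d i = 1" if \<sigma>: "\<sigma> \<in> R" for \<sigma>
      proof -
        obtain b where b: "b \<in> E" "\<sigma> = sig b" using R(1) \<sigma> unfolding OG_carrier by blast
        obtain s where s: "s \<in> {1..n}" "\<forall>t\<in>{1..n} - {s}. ew b t = 1"
          using R(2)[OF \<sigma>] unfolding b(2) reflection_iff by blast
        have "ew b i ^ lk d i = 1"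
        proof (cases "i = s")
          case True
          have "1 = \<beta> b d" using d b(1) by (simp add: Ds_def)
          also have "\<dots> = (\<Prod>t\<in>{1..n}. if t = s then ew b s ^ lk d s else 1)"
            unfolding \<beta>_prod[OF Ds_E[OF d]] by (rule prod.cong) (use s in auto)
          also have "\<dots> = ew b s ^ lk d s" using s by (simp add: prod.delta)
          finally show ?thesis using True by simp
        next
          case False
          then show ?thesis using s i by simp
        qed
        then show ?thesis using b by blast
      qed
      show ?thesis using that
      proof (induction rule: generate.induct)
        case one then show ?case unfolding OG_simps by (intro bexI[of _ 0]) simp_all
      next
        case (incl h) then show ?case by (rule refl)
      next
        case (inv h)
        then obtain b where b: "b \<in> E" "h = sig b" "ew b i ^ lk d i = 1" using refl by blast
        have sb: "sig b \<in> carrier OG" "sig (sc (l - 1) b) \<in> carrier OG" using b sc_expo unfolding OG_carrier by auto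
        have "sig (sc (l - 1) b) \<otimes>\<^bsub>OG\<^esub> sig b = \<one>\<^bsub>OG\<^esub>"
        proof -
          have "sc (l - 1) b + b = sc l b"
            using l_pos by (intro poly_mapping_eqI) (cases l; simp add: lookup_add)
          then show ?thesis unfolding OG_mult OG_simps(2) by (intro sig_cong) (simp add: bichar_sc_left \<beta>_l)
        qed
        then have "inv\<^bsub>OG\<^esub> h = sig (sc (l - 1) b)" using G.inv_equality sb b(2) by blast
        moreover have "ew (sc (l - 1) b) i ^ lk d i = (ew b i ^ lk d i) ^ (l - 1)"
          by (simp add: bichar_sc_left power_mult[symmetric] mult.commute)
        ultimately show ?case using b sc_expo by auto
      next
        case (eng h1 h2)
        then obtain b1 b2 where "b1 \<in> E" "h1 = sig b1" "ew b1 i ^ lk d i = 1"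
          "b2 \<in> E" "h2 = sig b2" "ew b2 i ^ lk d i = 1" by blast
        then show ?case by (intro bexI[of _ "b1 + b2"]) (auto simp: OG_mult bichar_add_left power_mult_distrib)
      qed
    qed
    have "\<beta> b (sg i (lk d i)) = 1" if b: "b \<in> E" for b
    proof -
      have "sig b \<in> generate OG R" using b unfolding R(3) OG_carrier by blast
      then obtain b' where b': "sig b = sig b'" "ew b' i ^ lk d i = 1" using gen by blast
      then have "ew b i ^ lk d i = 1" using sig_ew[OF b'(1) i] by simp
      then show ?thesis using bichar_sc_right[of n p b "lk d i" "ev i"] sg_sc[of i "lk d i"] by simp
    qed
    then have "sg i (lk d i) \<in> Ds" using i by (auto simp: Ds_def expo_single)
    then show "wi i dvd lk d i" using wi_dvd_iff[OF i] by blast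
  qed
qed

lemma card_roots_of_unity_le:
  assumes "k > 0"
  shows "finite {z::'k. z ^ k = 1} \<and> card {z::'k. z ^ k = 1} \<le> k"
proof -
  let ?p = "monom (1::'k) k - 1"
  have "coeff ?p k = 1" using assms by (simp add: coeff_1)
  then have nz: "?p \<noteq> 0" by (metis coeff_0 zero_neq_one)
  have e: "{z. poly ?p z = 0} = {z::'k. z ^ k = 1}" by (simp add: poly_monom)
  have "degree ?p \<le> k" by (intro degree_diff_le) (simp_all add: degree_monom_eq)
  with card_poly_roots_bound[OF nz] have "card {z::'k. z ^ k = 1} \<le> k" unfolding e by (rule order_trans)
  then show ?thesis using poly_roots_finite[OF nz] unfolding e by blast
qed

text \<open>In the regular case x_s^(f_s) is central, hence fixed by the whole group.\<close>

lemma ew_fi: "reg \<Longrightarrow> b \<in> E \<Longrightarrow> s \<in> {1..n} \<Longrightarrow> ew b s ^ fi s = 1"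
proof -
  assume reg: reg and b: "b \<in> E" and s: "s \<in> {1..n}"
  have "\<beta> b (sg s (fi s)) = 1" using reg s b unfolding reg_iff_dvd Ds_def by blast
  then show ?thesis using bichar_sc_right[of n p b "fi s" "ev s"] sg_sc[of s "fi s"] by simp
qed

text \<open>There are at most \<open>fi 1 \<cdots> fi n\<close> such tuples \<open>\<mu>\<close>, and the ozone group realises that many.\<close>

lemma reg_all_characters:
  assumes reg: reg and \<mu>: "\<And>s. s \<in> {1..n} \<Longrightarrow> \<mu> s ^ fi s = 1"
  shows "\<exists>b\<in>E. \<forall>s\<in>{1..n}. ew b s = \<mu> s"
proof -
  let ?P = "PiE {1..n} (\<lambda>s. {z::'k. z ^ fi s = 1})" and ?h = "\<lambda>b. restrict (ew b) {1..n}"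
  have finP: "finite ?P" using card_roots_of_unity_le fi_pos by (intro finite_PiE) auto
  have sub: "?h ` box n fi \<subseteq> ?P" using ew_fi[OF reg] by (auto simp: box_def)
  have inj: "inj_on ?h (box n fi)"
  proof (rule inj_onI)
    fix b b' assume b: "b \<in> box n fi" "b' \<in> box n fi" and e: "?h b = ?h b'"
    have "ew b s = ew b' s" if "s \<in> {1..n}" for s using fun_cong[OF e, of s] that by simp
    then have "sig b = sig b'" by (rule sig_eq_ew)
    then show "b = b'" using inj_sig_fi b by (meson inj_onD)
  qed
  have "card ?P = (\<Prod>s\<in>{1..n}. card {z::'k. z ^ fi s = 1})" by (simp add: card_PiE)
  also have "\<dots> \<le> (\<Prod>s\<in>{1..n}. fi s)"
    by (rule prod_mono) (use card_roots_of_unity_le fi_pos in auto)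
  also have "\<dots> = card (?h ` box n fi)" by (simp add: card_image[OF inj] card_box)
  finally have "?h ` box n fi = ?P" using sub finP by (intro card_seteq) auto
  moreover have "restrict \<mu> {1..n} \<in> ?P" using \<mu> by auto
  ultimately have "restrict \<mu> {1..n} \<in> ?h ` box n fi" by (simp only:)
  then obtain b where b: "restrict \<mu> {1..n} = ?h b" "b \<in> box n fi" by (rule imageE)
  have "ew b s = \<mu> s" if "s \<in> {1..n}" for s using fun_cong[OF b(1), of s] that by simp
  then show ?thesis using b(2) unfolding box_def by blast
qed

text \<open>Every tuple of eigenvalues with the right orders occurs in \<open>O\<close>, so an
  element splits into factors that each move at most one variable; each factor is trivial or a
  reflection.\<close>

lemma reg_imp_reflection_group: "reg \<Longrightarrow> reflection_group n p OG"
proof -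
  assume reg: reg
  define R where "R = {\<sigma> \<in> carrier OG. skew_reflection n p \<sigma>}"
  interpret G: group OG by (rule group_OG)
  have "sig b \<in> generate OG R" if b: "b \<in> E" for b
  proof -
    \<comment> \<open>The variables are treated one at a time: b' agrees with b on \<open>C\<close>
      and acts trivially on the others.\<close>
    have "\<exists>b'\<in>E. (\<forall>s\<in>C. ew b' s = ew b s) \<and> (\<forall>s\<in>{1..n} - C. ew b' s = 1) \<and> sig b' \<in> generate OG R"
      if "finite C" "C \<subseteq> {1..n}" for C
      using that
    proof (induction C rule: finite_induct)
      case empty
      then show ?case using generate.one[of OG R] by (intro bexI[of _ 0]) (simp_all add: OG_simps)
    next
      case (insert s C)
      then have s: "s \<in> {1..n}" by blast
      obtain b' where b': "b' \<in> E" "\<forall>s\<in>C. ew b' s = ew b s" "\<forall>s\<in>{1..n} - C. ew b' s = 1"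
        "sig b' \<in> generate OG R" using insert by blast
      have "(if t = s then ew b s else 1) ^ fi t = 1" if "t \<in> {1..n}" for t
        using ew_fi[OF reg b that] by (cases "t = s") simp_all
      from reg_all_characters[OF reg, where \<mu> = "\<lambda>t. if t = s then ew b s else 1", OF this]
      obtain c where c: "c \<in> E" "\<forall>t\<in>{1..n}. ew c t = (if t = s then ew b s else 1)" by blast
      have cg: "sig c \<in> generate OG R"
      proof (cases "ew b s = 1")
        case True
        then have "sig c = sig 0" using c by (intro sig_eq_ew) simp
        then show ?thesis using generate.one[of OG R] by (simp add: OG_simps)
      next
        case False
        then have "skew_reflection n p (sig c)" unfolding reflection_iff using c s by (intro bexI[of _ s]) auto
        then show ?thesis using c(1) unfolding R_def OG_carrier by (intro generate.incl) auto
      qed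
      have "sig (c + b') \<in> generate OG R" unfolding OG_mult[symmetric] using cg b'(4) by (rule generate.eng)
      moreover have "ew (c + b') t = (if t \<in> insert s C then ew b t else 1)" if t: "t \<in> {1..n}" for t
      proof -
        have "ew b' t = (if t \<in> C then ew b t else 1)" using b'(2,3) t by simp
        then show ?thesis using c(2) t insert(2) by (auto simp: bichar_add_left)
      qed
      ultimately show ?case using c(1) b'(1) insert.prems by (intro bexI[of _ "c + b'"]) (auto simp: subset_iff)
    qed
    from this[of "{1..n}"] obtain b' where "\<forall>s\<in>{1..n}. ew b' s = ew b s" "sig b' \<in> generate OG R" by auto
    then show ?thesis using sig_eq_ew[of b' b] by auto
  qed
  then have "carrier OG \<subseteq> generate OG R" unfolding OG_carrier by blast
  moreover have "generate OG R \<subseteq> carrier OG" using G.generate_incl by (simp add: R_def)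
  ultimately have "generate OG R = carrier OG" by blast
  moreover have "\<forall>\<sigma>\<in>carrier OG. graded_automorphism n p \<sigma>" unfolding OG_carrier using graded_sig by blast
  moreover have "R \<subseteq> carrier OG" "\<forall>\<sigma>\<in>R. skew_reflection n p \<sigma>" by (auto simp: R_def)
  ultimately show ?thesis unfolding reflection_group_def using finite_OG by blast
qed

end

section \<open>The orders w_s in terms of the exponents b_ij\<close>

lemma primitive_root_powi_eq_1_iff:
  fixes \<xi> :: "'k::field"
  assumes "primitive_root_of_unity l \<xi>"
  shows "\<xi> powi e = 1 \<longleftrightarrow> int l dvd e"
proof -
  have l: "l > 0" "\<xi> ^ l = 1" "\<And>m. 0 < m \<Longrightarrow> m < l \<Longrightarrow> \<xi> ^ m \<noteq> 1"
    using assms by (auto simp: primitive_root_of_unity_def)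
  have nz: "\<xi> \<noteq> 0" using l by (metis power_eq_0_iff zero_neq_one zero_power)
  define r where "r = nat (e mod int l)"
  have r: "int r = e mod int l" "r < l" using l(1) by (auto simp: r_def nat_less_iff)
  have "e = int l * (e div int l) + int r" by (simp add: r(1))
  then have "\<xi> powi e = (\<xi> powi int l) powi (e div int l) * \<xi> powi int r"
    using nz by (metis power_int_add power_int_mult)
  then have "\<xi> powi e = \<xi> ^ r" using l(2) by simp
  moreover have "\<xi> ^ r = 1 \<longleftrightarrow> r = 0" using l(3)[of r] r(2) by (cases "r = 0") auto
  moreover have "r = 0 \<longleftrightarrow> int l dvd e" using r(1) by (metis dvd_eq_mod_eq_0 of_nat_0 of_nat_eq_iff)
  ultimately show ?thesis by simp
qed

text \<open>The k-th power of \<phi>_s is trivial iff \<open>l\<close> divides k b_ts for all t,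
  that is, iff \<open>l\<close> divides k g for the gcd g. Since g divides \<open>l\<close>, the
  order is l / g.\<close>

lemma (in ozone) wi_times_Gcd:
  assumes prim: "primitive_root_of_unity l \<xi>"
    and p_eq: "\<And>i j. i \<in> {1..n} \<Longrightarrow> j \<in> {1..n} \<Longrightarrow> p i j = \<xi> powi b i j"
    and s: "s \<in> {1..n}"
  shows "int (wi s) * Gcd (insert (int l) ((\<lambda>t. b t s) ` {1..n})) = int l"
proof -
  define g where "g = Gcd (insert (int l) ((\<lambda>t. b t s) ` {1..n}))"
  have gl: "g dvd int l" unfolding g_def by (rule Gcd_dvd) simp
  have "g \<ge> 0" by (simp add: g_def)
  moreover have "g \<noteq> 0" using gl l_pos by auto
  ultimately have g0: "g > 0" by simp
  have iff: "wi s dvd k \<longleftrightarrow> int l dvd int k * g" for k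
  proof -
    have "wi s dvd k \<longleftrightarrow> (\<forall>i\<in>{1..n}. \<beta> (ev i) (sg s k) = 1)"
      using wi_dvd_iff[OF s, of k] Ds_iff_ev[of "sg s k"] s by (auto simp: expo_single)
    also have "\<dots> \<longleftrightarrow> (\<forall>i\<in>{1..n}. int l dvd int k * b i s)"
    proof (rule ball_cong[OF refl])
      fix i assume i: "i \<in> {1..n}"
      have "\<beta> (ev i) (sg s k) = p i s ^ k"
        using bichar_sc_right[of n p "ev i" k "ev s"] sg_sc[of s k] \<beta>_ev[OF i s] by simp
      also have "\<dots> = \<xi> powi (int k * b i s)"
        by (simp add: p_eq[OF i s] power_int_mult mult.commute[of "int k"])
      finally show "\<beta> (ev i) (sg s k) = 1 \<longleftrightarrow> int l dvd int k * b i s"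
        by (simp only: primitive_root_powi_eq_1_iff[OF prim])
    qed
    also have "\<dots> \<longleftrightarrow> (\<forall>x\<in>insert (int l) ((\<lambda>t. b t s) ` {1..n}). int l dvd int k * x)" by auto
    also have "\<dots> \<longleftrightarrow> int l dvd Gcd ((*) (int k) ` insert (int l) ((\<lambda>t. b t s) ` {1..n}))"
      by (simp only: dvd_Gcd_iff ball_simps)
    also have "Gcd ((*) (int k) ` insert (int l) ((\<lambda>t. b t s) ` {1..n})) = normalize (int k * g)"
      unfolding g_def by (rule Gcd_mult)
    finally show ?thesis by simp
  qed
  obtain q where q: "int l = g * q" using gl by (rule dvdE)
  moreover have "q \<ge> 0" using q g0 by (metis of_nat_0_le_iff zero_le_mult_iff not_less)
  ultimately obtain m where m: "int l = g * int m" by (metis nat_0_le)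
  have "wi s dvd m" using iff[of m] m by (simp add: mult.commute)
  moreover have "m dvd wi s"
  proof -
    have "g * int m dvd g * int (wi s)" using iff[of "wi s"] m by (simp add: mult.commute)
    then show ?thesis using g0 by simp
  qed
  ultimately have "wi s = m" by (rule dvd_antisym)
  then show ?thesis using m unfolding g_def[symmetric] by (simp add: mult.commute)
qed

text \<open>Multiplying the identities w_s g_s = l shows that the quotient is the product of the
  w_s, the upper bound for |O|.\<close>

lemma (in ozone) reg_iff_card_Gcd:
  assumes prim: "primitive_root_of_unity l \<xi>"
    and p_eq: "\<And>i j. i \<in> {1..n} \<Longrightarrow> j \<in> {1..n} \<Longrightarrow> p i j = \<xi> powi b i j"
  shows "reg \<longleftrightarrow> (of_nat (card (carrier (ozone_group n p))) :: rat) =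
          of_nat (l ^ n) / of_int (\<Prod>s = 1..n. Gcd (insert (int l) ((\<lambda>t. b t s) ` {1..n})))"
proof -
  let ?g = "\<lambda>s. Gcd (insert (int l) ((\<lambda>t. b t s) ` {1..n}))"
  have e: "int (wi s) * ?g s = int l" if "s \<in> {1..n}" for s
    using wi_times_Gcd[OF prim p_eq that] .
  have "(\<Prod>s = 1..n. int (wi s)) * (\<Prod>s = 1..n. ?g s) = (\<Prod>s = 1..n. int l)"
    unfolding prod.distrib[symmetric] by (rule prod.cong[OF refl e])
  then have P: "int (\<Prod>s = 1..n. wi s) * (\<Prod>s = 1..n. ?g s) = int (l ^ n)" by simp
  have quot: "int a * g = int L \<Longrightarrow> g \<noteq> 0 \<Longrightarrow> (of_nat L :: rat) / of_int g = of_nat a" for a g L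
  proof -
    assume "int a * g = int L" and g: "g \<noteq> 0"
    then have "(of_nat L :: rat) = of_nat a * of_int g" by (metis of_int_mult of_int_of_nat_eq)
    then show ?thesis using g by simp
  qed
  have "int (l ^ n) \<noteq> 0" using l_pos by simp
  then have "(\<Prod>s = 1..n. ?g s) \<noteq> 0" unfolding P[symmetric] by (metis mult_zero_right)
  from quot[OF P this]
  have "of_nat (l ^ n) / of_int (\<Prod>s = 1..n. ?g s) = (of_nat (\<Prod>s = 1..n. wi s) :: rat)" .
  then show ?thesis unfolding reg_iff_card_wi by (simp only: of_nat_eq_iff)
qed

theorem theorem0p6:
  fixes n l :: nat
    and p :: "nat \<Rightarrow> nat \<Rightarrow> 'k::field_char_0"
    and \<xi> :: 'k
    and b :: "nat \<Rightarrow> nat \<Rightarrow> int"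
  assumes p_diag: "\<And>i. i \<in> {1..n} \<Longrightarrow> p i i = 1"
    and p_antisym: "\<And>i j. i \<in> {1..n} \<Longrightarrow> j \<in> {1..n} \<Longrightarrow> p j i = inverse (p i j)"
    and p_roots: "\<And>i j. i \<in> {1..n} \<Longrightarrow> j \<in> {1..n} \<Longrightarrow> \<exists>m>0. p i j ^ m = 1"
    and \<xi>_prim: "primitive_root_of_unity l \<xi>"
    and p_eq: "\<And>i j. i \<in> {1..n} \<Longrightarrow> j \<in> {1..n} \<Longrightarrow> p i j = \<xi> powi b i j"
    and b_diag: "\<And>i. i \<in> {1..n} \<Longrightarrow> b i i = 0"
    and b_antisym: "\<And>i j. i \<in> {1..n} \<Longrightarrow> j \<in> {1..n} \<Longrightarrow> b j i = - b i j"
    and l_minimal: "\<And>m (\<zeta>::'k). primitive_root_of_unity m \<zeta> \<Longrightarrow>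
          (\<forall>i \<in> {1..n}. \<forall>j \<in> {1..n}. \<exists>e::int. p i j = \<zeta> powi e) \<Longrightarrow> l \<le> m"
    and l_gt_1: "l > 1"
  shows
    "(center_regular n p \<longleftrightarrow>
        (\<exists>w. (\<forall>i \<in> {1..n}. w i \<ge> (1::nat)) \<and>
           skew_center n p = skew_subalgebra n p ((\<lambda>i. skew_var n p i [^]\<^bsub>skew_poly n p\<^esub> w i) ` {1..n}))) \<and>
     (center_regular n p \<longleftrightarrow>
        skew_center n p =
          skew_subalgebra n p ((\<lambda>i. skew_var n p i [^]\<^bsub>skew_poly n p\<^esub> ozone_exp n p i) ` {1..n})) \<and>
     (center_regular n p \<longleftrightarrow>
        free_module (skew_center_ring n p) (left_module (skew_poly n p) (carrier (skew_poly n p)))) \<and>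
     (center_regular n p \<longleftrightarrow> reflection_group n p (ozone_group n p)) \<and>
     (center_regular n p \<longleftrightarrow>
        (of_nat (card (carrier (ozone_group n p))) :: rat) =
          of_nat (l ^ n) / of_int (\<Prod>s = 1..n. Gcd (insert (int l) ((\<lambda>t. b t s) ` {1..n})))) \<and>
     (center_regular n p \<longleftrightarrow>
        card (carrier (ozone_group n p)) = (\<Prod>i = 1..n. ozone_exp n p i)) \<and>
     (center_regular n p \<longleftrightarrow>
        ozone_group n p \<cong> product_group {1..n} (ozone_cyclic n p)) \<and>
     (center_regular n p \<longleftrightarrow>
        (\<forall>i \<in> {1..n}. skew_var n p i [^]\<^bsub>skew_poly n p\<^esub> ozone_exp n p i \<in> skew_center n p)) \<and>
     (center_regular n p \<longrightarrow>
        (\<forall>g. is_jacobian n p g \<longleftrightarrow> (\<exists>c. c \<noteq> 0 \<and> g = skew_scale n p c (ozone_jacobian n p))) \<and>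
        (\<forall>g. is_reflection_arrangement n p g \<longleftrightarrow>
           (\<exists>c. c \<noteq> 0 \<and> g = skew_scale n p c (ozone_arrangement n p))))"
proof -
  have l0: "l > 0" and \<xi>: "\<xi> ^ l = 1" using \<xi>_prim by (auto simp: primitive_root_of_unity_def)
  have nz: "p i j \<noteq> 0" if "i \<in> {1..n}" "j \<in> {1..n}" for i j
  proof
    assume "p i j = 0"
    moreover from p_roots[OF that] obtain m where "m > 0" "p i j ^ m = 1" by blast
    ultimately show False by (simp add: zero_power)
  qed
  have pl: "p i j ^ l = 1" if "i \<in> {1..n}" "j \<in> {1..n}" for i j
  proof -
    have "p i j ^ l = (\<xi> powi int l) powi b i j"
      unfolding p_eq[OF that] by (metis mult.commute power_int_mult power_int_of_nat)
    then show ?thesis using \<xi> by simp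
  qed
  interpret ozone n p l
    by unfold_locales (fact p_diag p_antisym nz l0 pl)+
  have r: "center_regular n p \<longleftrightarrow> reg" using reg_imp_regular regular_imp_reg by blast
  have jac: "center_regular n p \<longrightarrow>
        (\<forall>g. is_jacobian n p g \<longleftrightarrow> (\<exists>c. c \<noteq> 0 \<and> g = skew_scale n p c (ozone_jacobian n p))) \<and>
        (\<forall>g. is_reflection_arrangement n p g \<longleftrightarrow>
           (\<exists>c. c \<noteq> 0 \<and> g = skew_scale n p c (ozone_arrangement n p)))"
    using jacobian_iff arrangement_iff r by blast
  have free: "reg \<longleftrightarrow> free_module (skew_center_ring n p) (left_module (skew_poly n p) (carrier (skew_poly n p)))"
    using reg_imp_free free_imp_reg by blast
  have refl: "reg \<longleftrightarrow> reflection_group n p (ozone_group n p)"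
    using reg_imp_reflection_group reflection_group_imp_reg by blast
  show ?thesis
    by (intro conjI jac; unfold r; rule reg_iff_subalgebra reg_iff_subalgebra_fi free refl
        reg_iff_card_Gcd[OF \<xi>_prim p_eq] reg_iff_card_fi reg_iff_product reg_iff_center_powers)
qed

end
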